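(* Let $\nu\in[0,1)$ and $0<b<\infty$, and let $A_{\nu,b}$ be the Bessel operator in $L^2(0,b)$ acting as $\tau_\nu=-\frac{d^2}{dx^2}+\frac{\nu^2-1/4}{x^2}$ on the domain $\{f\in H^2[0,b]: f(0)=f'(0)=f(b)=0\}$. Then: (i) A boundary triplet $\{\mathcal H,\Gamma_0^{\nu,b},\Gamma_1^{\nu,b}\}$ for $A_{\nu,b}^*$ can be chosen in the form $$\mathcal H=\mathbb C,\qquad \Gamma_0^{\nu,b}f=[f,x^{1/2+\nu}]_0,\qquad \Gamma_1^{\nu,b}f=\begin{cases}-(2\nu)^{-1}[f,x^{1/2-\nu}]_0, & \nu\in(0,1),\\ [f,x^{1/2}\log(x)]_0, & \nu=0.\end{cases}$$ (ii) The Weyl function $M_{\nu;b}(\cdot)$ corresponding to this boundary triplet is, for $z\neq 0$ in the resolvent set of $A_{\nu,b}^*\upharpoonright\ker\Gamma_0^{\nu,b}$, $$M_{\nu;b}(z)=\begin{cases}-\dfrac{\Gamma(1-\nu)}{2\nu 4^\nu\Gamma(1+\nu)}\cdot\dfrac{J_{-\nu}(b\sqrt z)}{J_\nu(b\sqrt z)}\cdot z^\nu, & \nu\in(0,1),\\[2mm] -\log\left(\dfrac{\sqrt z}{2}\right)+\dfrac{\pi}{2}\,\dfrac{Y_0(b\sqrt z)}{J_0(b\sqrt z)}-\gamma, & \nu=0,\end{cases}$$ where $\gamma$ is Euler's constant.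
   Context: $[f,g]_x=f(x)\overline{g'(x)}-f'(x)\overline{g(x)}$ and $[f,g]_0=\lim_{x\to0^+}[f,g]_x$. $J_{\pm\nu}$, $Y_0$ are the Bessel functions of the first and second kind; $\Gamma(\cdot)$ (with a numerical argument) is the Gamma function. The branch of $z^\nu$ (and of $\sqrt z$) is taken in $\mathbb C$ cut along $\mathbb R_+$ with $z^\nu=x^\nu$ for $z=x>0$, i.e. $\arg z\in[0,2\pi)$; $\log$ in $\log(\sqrt z/2)$ is the principal branch. Boundary triplet: for a densely defined closed symmetric operator $A$ with equal deficiency indices, $\{\mathcal H,\Gamma_0,\Gamma_1\}$ is a boundary triplet for $A^*$ if $\mathcal H$ is a Hilbert space, $\Gamma_0,\Gamma_1:\operatorname{dom}(A^* )\to\mathcal H$ are linear, $(A^*f,g)-(f,A^*g)=(\Gamma_1f,\Gamma_0g)_{\mathcal H}-(\Gamma_0f,\Gamma_1g)_{\mathcal H}$ for all $f,g\in\operatorname{dom}(A^* )$, and $f\mapsto(\Gamma_0f,\Gamma_1f)$ is surjective onto $\mathcal H\oplus\mathcal H$. Put $A_0=A^*\upharpoonright\ker\Gamma_0$. The corresponding Weyl function is $M(z)=\Gamma_1(\Gamma_0\upharpoonright\ker(A^*-z))^{-1}$, $z\in\rho(A_0)$. *)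

theory Defs
  imports "HOL-Analysis.Analysis" "HOL-Library.Equipollence"
begin

section \<open>Complex Hilbert spaces with explicit carrier\<close>

text \<open>
  Carriers are explicit because the space \<open>L\<^sup>2(0,b)\<close> depends on the real parameter \<open>b\<close>.
  Inner products are linear in the first argument and conjugate linear in the second.
\<close>

record 'a inner_space =
  vcarrier :: "'a set"
  vzero :: 'a
  vadd :: "'a \<Rightarrow> 'a \<Rightarrow> 'a"
  vscale :: "complex \<Rightarrow> 'a \<Rightarrow> 'a"
  vinner :: "'a \<Rightarrow> 'a \<Rightarrow> complex"

definition vdiff :: "'a inner_space \<Rightarrow> 'a \<Rightarrow> 'a \<Rightarrow> 'a" where
  "vdiff X f g = vadd X f (vscale X (-1) g)"

definition vnorm :: "'a inner_space \<Rightarrow> 'a \<Rightarrow> real" where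
  "vnorm X f = sqrt (Re (vinner X f f))"

definition vconverges :: "'a inner_space \<Rightarrow> (nat \<Rightarrow> 'a) \<Rightarrow> 'a \<Rightarrow> bool" where
  "vconverges X s f \<longleftrightarrow> (\<lambda>n. vnorm X (vdiff X (s n) f)) \<longlonglongrightarrow> 0"

definition vcauchy :: "'a inner_space \<Rightarrow> (nat \<Rightarrow> 'a) \<Rightarrow> bool" where
  "vcauchy X s \<longleftrightarrow> (\<forall>e>0. \<exists>N. \<forall>m\<ge>N. \<forall>n\<ge>N. vnorm X (vdiff X (s m) (s n)) < e)"

locale hilbert_space =
  fixes X :: "'a inner_space"
  assumes zero_closed: "vzero X \<in> vcarrier X"
    and add_closed: "\<lbrakk>f \<in> vcarrier X; g \<in> vcarrier X\<rbrakk> \<Longrightarrow> vadd X f g \<in> vcarrier X"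
    and scale_closed: "f \<in> vcarrier X \<Longrightarrow> vscale X c f \<in> vcarrier X"
    and add_assoc: "\<lbrakk>f \<in> vcarrier X; g \<in> vcarrier X; h \<in> vcarrier X\<rbrakk>
          \<Longrightarrow> vadd X (vadd X f g) h = vadd X f (vadd X g h)"
    and add_commute: "\<lbrakk>f \<in> vcarrier X; g \<in> vcarrier X\<rbrakk> \<Longrightarrow> vadd X f g = vadd X g f"
    and add_zero: "f \<in> vcarrier X \<Longrightarrow> vadd X f (vzero X) = f"
    and add_inverse: "f \<in> vcarrier X \<Longrightarrow> vadd X f (vscale X (-1) f) = vzero X"
    and scale_one: "f \<in> vcarrier X \<Longrightarrow> vscale X 1 f = f"
    and scale_scale: "f \<in> vcarrier X \<Longrightarrow> vscale X c (vscale X d f) = vscale X (c * d) f"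
    and scale_add_right: "\<lbrakk>f \<in> vcarrier X; g \<in> vcarrier X\<rbrakk>
          \<Longrightarrow> vscale X c (vadd X f g) = vadd X (vscale X c f) (vscale X c g)"
    and scale_add_left: "f \<in> vcarrier X
          \<Longrightarrow> vscale X (c + d) f = vadd X (vscale X c f) (vscale X d f)"
    and inner_add: "\<lbrakk>f \<in> vcarrier X; g \<in> vcarrier X; h \<in> vcarrier X\<rbrakk>
          \<Longrightarrow> vinner X (vadd X f g) h = vinner X f h + vinner X g h"
    and inner_scale: "\<lbrakk>f \<in> vcarrier X; g \<in> vcarrier X\<rbrakk>
          \<Longrightarrow> vinner X (vscale X c f) g = c * vinner X f g"
    and inner_commute: "\<lbrakk>f \<in> vcarrier X; g \<in> vcarrier X\<rbrakk> \<Longrightarrow> vinner X g f = cnj (vinner X f g)"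
    and inner_nonneg: "f \<in> vcarrier X \<Longrightarrow> 0 \<le> Re (vinner X f f)"
    and inner_definite: "\<lbrakk>f \<in> vcarrier X; vinner X f f = 0\<rbrakk> \<Longrightarrow> f = vzero X"
    and complete: "\<lbrakk>range s \<subseteq> vcarrier X; vcauchy X s\<rbrakk>
          \<Longrightarrow> \<exists>f\<in>vcarrier X. vconverges X s f"

definition complex_space :: "complex inner_space" where
  "complex_space =
     \<lparr>vcarrier = UNIV, vzero = 0, vadd = (+), vscale = (*), vinner = (\<lambda>z w. z * cnj w)\<rparr>"


section \<open>Unbounded operators\<close>

text \<open>
  An operator is represented by its graph: \<open>(f, h) \<in> T\<close> means that \<open>f\<close> lies in the domain of
  \<open>T\<close> and \<open>T f = h\<close>. The domain is \<^term>\<open>Domain T\<close>.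
\<close>

definition linear_operator :: "'a inner_space \<Rightarrow> ('a \<times> 'a) set \<Rightarrow> bool" where
  "linear_operator X T \<longleftrightarrow>
     T \<subseteq> vcarrier X \<times> vcarrier X \<and> single_valued T \<and> (vzero X, vzero X) \<in> T \<and>
     (\<forall>(f, f')\<in>T. \<forall>(g, g')\<in>T. (vadd X f g, vadd X f' g') \<in> T) \<and>
     (\<forall>c. \<forall>(f, f')\<in>T. (vscale X c f, vscale X c f') \<in> T)"

definition densely_defined :: "'a inner_space \<Rightarrow> ('a \<times> 'a) set \<Rightarrow> bool" where
  "densely_defined X T \<longleftrightarrow>
     (\<forall>f\<in>vcarrier X. \<forall>e>0. \<exists>g\<in>Domain T. vnorm X (vdiff X f g) < e)"

definition closed_operator :: "'a inner_space \<Rightarrow> ('a \<times> 'a) set \<Rightarrow> bool" where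
  "closed_operator X T \<longleftrightarrow>
     (\<forall>s t. \<forall>f\<in>vcarrier X. \<forall>h\<in>vcarrier X.
        (\<forall>n. (s n, t n) \<in> T) \<and> vconverges X s f \<and> vconverges X t h \<longrightarrow> (f, h) \<in> T)"

definition symmetric_operator :: "'a inner_space \<Rightarrow> ('a \<times> 'a) set \<Rightarrow> bool" where
  "symmetric_operator X T \<longleftrightarrow>
     (\<forall>(f, f')\<in>T. \<forall>(g, g')\<in>T. vinner X f' g = vinner X f g')"

definition adjoint_op :: "'a inner_space \<Rightarrow> ('a \<times> 'a) set \<Rightarrow> ('a \<times> 'a) set" where
  "adjoint_op X T =
     {(g, h) \<in> vcarrier X \<times> vcarrier X. \<forall>(f, f')\<in>T. vinner X f' g = vinner X f h}"

definition restrict_op :: "('a \<times> 'a) set \<Rightarrow> 'a set \<Rightarrow> ('a \<times> 'a) set" where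
  "restrict_op T D = {(f, h) \<in> T. f \<in> D}"

text \<open>The kernel of \<open>T - z\<close>.\<close>

definition eigenspace :: "'a inner_space \<Rightarrow> ('a \<times> 'a) set \<Rightarrow> complex \<Rightarrow> 'a set" where
  "eigenspace X T z = {f. (f, vscale X z f) \<in> T}"

text \<open>
  \<open>T - z\<close> is a bijection from the domain of \<open>T\<close> onto the whole space, with bounded inverse.
\<close>

definition resolvent_set :: "'a inner_space \<Rightarrow> ('a \<times> 'a) set \<Rightarrow> complex set" where
  "resolvent_set X T =
     {z. (\<forall>g\<in>vcarrier X. \<exists>!f. (f, vadd X g (vscale X z f)) \<in> T) \<and>
         (\<exists>C. \<forall>(f, h)\<in>T. vnorm X f \<le> C * vnorm X (vdiff X h (vscale X z f)))}"

definition orthonormal_basis :: "'a inner_space \<Rightarrow> 'a set \<Rightarrow> 'a set \<Rightarrow> bool" where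
  "orthonormal_basis X S E \<longleftrightarrow>
     E \<subseteq> S \<and>
     (\<forall>e\<in>E. \<forall>e'\<in>E. vinner X e e' = (if e = e' then 1 else 0)) \<and>
     (\<forall>f\<in>S. (\<forall>e\<in>E. vinner X f e = 0) \<longrightarrow> f = vzero X)"

text \<open>
  The deficiency indices are the Hilbert space dimensions of the closed subspaces
  \<open>ker (A\<^sup>* - \<i>)\<close> and \<open>ker (A\<^sup>* + \<i>)\<close>, that is, the cardinalities of orthonormal bases.
\<close>

definition equal_deficiency_indices :: "'a inner_space \<Rightarrow> ('a \<times> 'a) set \<Rightarrow> bool" where
  "equal_deficiency_indices X A \<longleftrightarrow>
     (\<exists>E F. orthonormal_basis X (eigenspace X (adjoint_op X A) \<i>) E \<and>
            orthonormal_basis X (eigenspace X (adjoint_op X A) (- \<i>)) F \<and> E \<approx> F)"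


section \<open>Boundary triplets and Weyl functions\<close>

definition linear_on_domain ::
    "'a inner_space \<Rightarrow> 'a set \<Rightarrow> 'k inner_space \<Rightarrow> ('a \<Rightarrow> 'k) \<Rightarrow> bool" where
  "linear_on_domain X D K G \<longleftrightarrow>
     (\<forall>f\<in>D. G f \<in> vcarrier K) \<and>
     (\<forall>f\<in>D. \<forall>g\<in>D. G (vadd X f g) = vadd K (G f) (G g)) \<and>
     (\<forall>c. \<forall>f\<in>D. G (vscale X c f) = vscale K c (G f))"

text \<open>
  \<open>(K, G0, G1)\<close> is a boundary triplet for the adjoint of \<open>A\<close>. The standing assumptions on \<open>A\<close>
  (a densely defined closed symmetric operator with equal deficiency indices in a Hilbert space)
  are part of the definition.
\<close>

definition boundary_triplet ::
    "'a inner_space \<Rightarrow> ('a \<times> 'a) set \<Rightarrow> 'k inner_space \<Rightarrow> ('a \<Rightarrow> 'k) \<Rightarrow> ('a \<Rightarrow> 'k) \<Rightarrow> bool" where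
  "boundary_triplet X A K G0 G1 \<longleftrightarrow>
     hilbert_space X \<and> linear_operator X A \<and> densely_defined X A \<and> closed_operator X A \<and>
     symmetric_operator X A \<and> equal_deficiency_indices X A \<and>
     hilbert_space K \<and>
     linear_on_domain X (Domain (adjoint_op X A)) K G0 \<and>
     linear_on_domain X (Domain (adjoint_op X A)) K G1 \<and>
     (\<forall>(f, f')\<in>adjoint_op X A. \<forall>(g, g')\<in>adjoint_op X A.
        vinner X f' g - vinner X f g' = vinner K (G1 f) (G0 g) - vinner K (G0 f) (G1 g)) \<and>
     (\<forall>h0\<in>vcarrier K. \<forall>h1\<in>vcarrier K. \<exists>f\<in>Domain (adjoint_op X A). G0 f = h0 \<and> G1 f = h1)"

text \<open>The extension \<open>A\<^sub>0\<close>, the restriction of the adjoint of \<open>A\<close> to the kernel of \<open>G0\<close>.\<close>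

definition triplet_extension ::
    "'a inner_space \<Rightarrow> ('a \<times> 'a) set \<Rightarrow> 'k inner_space \<Rightarrow> ('a \<Rightarrow> 'k) \<Rightarrow> ('a \<times> 'a) set" where
  "triplet_extension X A K G0 = restrict_op (adjoint_op X A) {f. G0 f = vzero K}"

definition weyl_function ::
    "'a inner_space \<Rightarrow> ('a \<times> 'a) set \<Rightarrow> ('a \<Rightarrow> 'k) \<Rightarrow> ('a \<Rightarrow> 'k) \<Rightarrow> complex \<Rightarrow> 'k \<Rightarrow> 'k" where
  "weyl_function X A G0 G1 z h = G1 (inv_into (eigenspace X (adjoint_op X A) z) G0 h)"


section \<open>The space \<open>L\<^sup>2(0,b)\<close>\<close>

definition sq_integrable :: "real \<Rightarrow> (real \<Rightarrow> complex) \<Rightarrow> bool" where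
  "sq_integrable b f \<longleftrightarrow>
     f \<in> borel_measurable (lebesgue_on {0<..<b}) \<and>
     integrable (lebesgue_on {0<..<b}) (\<lambda>x. (norm (f x))\<^sup>2)"

text \<open>
  Elements of \<open>L\<^sup>2(0,b)\<close> are classes of functions that agree almost everywhere on \<open>(0,b)\<close>;
  the values of the representatives outside \<open>(0,b)\<close> are irrelevant.
\<close>

definition L2_class :: "real \<Rightarrow> (real \<Rightarrow> complex) \<Rightarrow> (real \<Rightarrow> complex) set" where
  "L2_class b f = {g. sq_integrable b g \<and> (AE x in lebesgue_on {0<..<b}. g x = f x)}"

definition L2_rep :: "(real \<Rightarrow> complex) set \<Rightarrow> real \<Rightarrow> complex" where
  "L2_rep F = (SOME f. f \<in> F)"

definition L2_space :: "real \<Rightarrow> (real \<Rightarrow> complex) set inner_space" where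
  "L2_space b =
     \<lparr>vcarrier = L2_class b ` {f. sq_integrable b f},
      vzero = L2_class b (\<lambda>x. 0),
      vadd = (\<lambda>F G. L2_class b (\<lambda>x. L2_rep F x + L2_rep G x)),
      vscale = (\<lambda>c F. L2_class b (\<lambda>x. c * L2_rep F x)),
      vinner = (\<lambda>F G. LINT x|lebesgue_on {0<..<b}. L2_rep F x * cnj (L2_rep G x))\<rparr>"


section \<open>The Bessel operator\<close>

text \<open>
  \<open>f \<in> H\<^sup>2[0,b]\<close> with \<open>f' = f1\<close> and \<open>f'' = f2\<close>: both \<open>f\<close> and \<open>f1\<close> are absolutely continuous on
  \<open>[0,b]\<close> (that is, indefinite integrals of integrable functions), and \<open>f2\<close> is square integrable.
  Only the continuous representative of a class satisfies this, so that \<open>f 0\<close>, \<open>f1 0\<close> and \<open>f b\<close>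
  are the boundary values of \<open>f\<close> and \<open>f'\<close>.
\<close>

definition sobolev_H2 ::
    "real \<Rightarrow> (real \<Rightarrow> complex) \<Rightarrow> (real \<Rightarrow> complex) \<Rightarrow> (real \<Rightarrow> complex) \<Rightarrow> bool" where
  "sobolev_H2 b f f1 f2 \<longleftrightarrow>
     sq_integrable b f2 \<and>
     (\<forall>x\<in>{0..b}. f1 x = f1 0 + integral {0..x} f2) \<and>
     (\<forall>x\<in>{0..b}. f x = f 0 + integral {0..x} f1)"

definition bessel_operator ::
    "real \<Rightarrow> real \<Rightarrow> ((real \<Rightarrow> complex) set \<times> (real \<Rightarrow> complex) set) set" where
  "bessel_operator \<nu> b =
     {(L2_class b f, L2_class b (\<lambda>x. - f2 x + of_real ((\<nu>\<^sup>2 - 1/4) / x\<^sup>2) * f x)) | f f1 f2.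
        sobolev_H2 b f f1 f2 \<and> f 0 = 0 \<and> f1 0 = 0 \<and> f b = 0}"

definition bracket :: "(real \<Rightarrow> complex) \<Rightarrow> (real \<Rightarrow> complex) \<Rightarrow> real \<Rightarrow> complex" where
  "bracket f g x =
     f x * cnj (vector_derivative g (at x)) - vector_derivative f (at x) * cnj (g x)"

definition bracket0 :: "(real \<Rightarrow> complex) \<Rightarrow> (real \<Rightarrow> complex) \<Rightarrow> complex" where
  "bracket0 f g = Lim (at_right 0) (bracket f g)"

text \<open>
  Any two differentiable representatives of a class agree on \<open>(0,b)\<close>, so the choice does not
  affect \<^const>\<open>bracket0\<close>.
\<close>

definition diff_rep :: "real \<Rightarrow> (real \<Rightarrow> complex) set \<Rightarrow> real \<Rightarrow> complex" where
  "diff_rep b F = (SOME f. f \<in> F \<and> f differentiable_on {0<..<b})"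

definition u_plus :: "real \<Rightarrow> real \<Rightarrow> complex" where
  "u_plus \<nu> x = of_real (x powr (1/2 + \<nu>))"

definition u_minus :: "real \<Rightarrow> real \<Rightarrow> complex" where
  "u_minus \<nu> x = of_real (if \<nu> = 0 then x powr (1/2) * ln x else x powr (1/2 - \<nu>))"

definition bessel_Gamma0 :: "real \<Rightarrow> real \<Rightarrow> (real \<Rightarrow> complex) set \<Rightarrow> complex" where
  "bessel_Gamma0 \<nu> b F = bracket0 (diff_rep b F) (u_plus \<nu>)"

definition bessel_Gamma1 :: "real \<Rightarrow> real \<Rightarrow> (real \<Rightarrow> complex) set \<Rightarrow> complex" where
  "bessel_Gamma1 \<nu> b F =
     (if \<nu> = 0 then bracket0 (diff_rep b F) (u_minus \<nu>)
      else - of_real (1 / (2 * \<nu>)) * bracket0 (diff_rep b F) (u_minus \<nu>))"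


section \<open>Bessel functions and branches\<close>

text \<open>
  Power series of the Bessel function of the first kind of real order, with principal branch of
  the power. The case distinction is needed since \<open>0 powr 0 = 0\<close>.
\<close>

definition bessel_J :: "real \<Rightarrow> complex \<Rightarrow> complex" where
  "bessel_J \<mu> w =
     (if \<mu> = 0 then 1 else (w / 2) powr of_real \<mu>) *
     (\<Sum>k. (-1) ^ k * rGamma (of_real (real k + \<mu> + 1)) / fact k * (w / 2) ^ (2 * k))"

text \<open>For integer order, the function of the second kind is a limit in the order.\<close>

definition bessel_Y :: "real \<Rightarrow> complex \<Rightarrow> complex" where
  "bessel_Y \<mu> w =
     (let Q = (\<lambda>\<alpha>. (bessel_J \<alpha> w * of_real (cos (\<alpha> * pi)) - bessel_J (- \<alpha>) w)
                      / of_real (sin (\<alpha> * pi)))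
      in if \<mu> \<in> \<int> then Lim (at \<mu>) Q else Q \<mu>)"

text \<open>The power with \<open>arg z \<in> [0, 2\<pi>)\<close>, to be used for \<open>z \<noteq> 0\<close> only.\<close>

definition cut_power :: "complex \<Rightarrow> real \<Rightarrow> complex" where
  "cut_power z a = exp (of_real a * (of_real (ln (norm z)) + \<i> * of_real (Arg2pi z)))"

definition cut_sqrt :: "complex \<Rightarrow> complex" where
  "cut_sqrt z = cut_power z (1/2)"

definition bessel_weyl :: "real \<Rightarrow> real \<Rightarrow> complex \<Rightarrow> complex" where
  "bessel_weyl \<nu> b z =
     (if \<nu> = 0 then
        - Ln (cut_sqrt z / 2)
        + of_real (pi / 2) * (bessel_Y 0 (of_real b * cut_sqrt z) / bessel_J 0 (of_real b * cut_sqrt z))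
        - of_real euler_mascheroni
      else
        - of_real (Gamma (1 - \<nu>) / (2 * \<nu> * 4 powr \<nu> * Gamma (1 + \<nu>)))
        * (bessel_J (- \<nu>) (of_real b * cut_sqrt z) / bessel_J \<nu> (of_real b * cut_sqrt z))
        * cut_power z \<nu>)"

end

theory Submission
  imports Defs "HOL-Complex_Analysis.Complex_Analysis"
begin

text \<open>
Write \<open>\<tau>\<close> for the Bessel expression \<open>- d\<^sup>2/dx\<^sup>2 + q\<close> with \<open>q(x) = (\<nu>\<^sup>2 - 1/4) / x\<^sup>2\<close>. The equation
\<open>\<tau> f = 0\<close> has two explicit solutions \<open>u = x\<^sup>1\<^sup>/\<^sup>2\<^sup>+\<^sup>\<nu>\<close> and \<open>v\<close>, a multiple of \<open>x\<^sup>1\<^sup>/\<^sup>2\<^sup>-\<^sup>\<nu>\<close> (of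
\<open>x\<^sup>1\<^sup>/\<^sup>2 ln x\<close> if \<open>\<nu> = 0\<close>) normalised by \<open>u v' - u' v = 1\<close>; both are square integrable because
\<open>\<nu> < 1\<close>. The operator, its adjoint and the boundary maps are all expressed by these two functions.

Variation of parameters turns \<open>\<tau> f = h\<close> into a Volterra integral. Let \<open>V h\<close> (\<open>Vol0 h\<close> below) be the solution with
zero data at \<open>0\<close>, let \<open>V\<^sub>b k\<close> (\<open>Volb k\<close> below) be the solution with zero data at \<open>b\<close>, and let \<open>\<phi> = v(b) u - u(b) v\<close> be the
homogeneous solution that vanishes at \<open>b\<close>. Then \<open>(V h, k) = (h, V\<^sub>b k)\<close>, by exchanging two integrations
over a triangle, and \<open>(V h)(b) = - (h, \<phi>)\<close>. Hence the minimal operator is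
\<open>A = {(V h, h) | h \<bottom> \<phi>}\<close>. The analytic content here is a Hardy inequality: a
function with zero data at \<open>0\<close> and \<open>\<tau> f \<in> L\<^sup>2\<close> satisfies \<open>f / x\<^sup>2 \<in> L\<^sup>2\<close>, so that \<open>f''\<close> and \<open>q f\<close> are
separately square integrable; this is why the domain is a subspace of \<open>H\<^sup>2\<close>
(lemmas \<open>H2_zero_data\<close>, \<open>H2_Vol0\<close>, \<open>bessel_operator_eq\<close>).

From this description the adjoint is read off by elementary duality,
\<open>A\<^sup>* = {(V\<^sub>b k + c \<phi>, k) | k \<in> L\<^sup>2, c \<in> \<complex>}\<close>, and in the same way \<open>A = A\<^sup>*\<^sup>*\<close>, so that \<open>A\<close> is closed
(\<open>adjoint_bessel_eq\<close>, \<open>bessel_operator_eq_biadjoint\<close>). An element of the domain of \<open>A\<^sup>*\<close> is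
\<open>\<alpha> u - \<beta> v\<close> with continuous coefficients, and the brackets with \<open>v\<close> and \<open>u\<close> are exactly
\<open>\<alpha>\<close> and \<open>\<beta>\<close>. Therefore \<open>\<Gamma>\<^sub>0 f = \<beta>(0)\<close> and \<open>\<Gamma>\<^sub>1 f = \<alpha>(0)\<close> are explicit integrals of \<open>k\<close> against \<open>u\<close>
and \<open>v\<close>, and Green's identity and the surjectivity become finite-dimensional algebra
(\<open>Gamma0_eq\<close>, \<open>Gamma1_eq\<close>, \<open>green_adj\<close>, \<open>Gamma_surjective\<close>).

For the Weyl function two solutions \<open>S\<^sub>1\<close>, \<open>S\<^sub>2\<close> of \<open>\<tau> f = z f\<close> are constructed as Frobenius series that
behave like \<open>u\<close> and \<open>v\<close> at \<open>0\<close>. The combination \<open>S\<^sub>2(b) S\<^sub>1 - S\<^sub>1(b) S\<^sub>2\<close> vanishes at \<open>b\<close> and has boundary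
values \<open>\<Gamma>\<^sub>0 = S\<^sub>1(b)\<close>, \<open>\<Gamma>\<^sub>1 = S\<^sub>2(b)\<close>, so that \<open>M(z) = S\<^sub>2(b) / S\<^sub>1(b)\<close>. If \<open>S\<^sub>1(b) = 0\<close>, then \<open>S\<^sub>1\<close> is an
eigenfunction of \<open>A\<^sub>0\<close>, which is impossible for \<open>z\<close> in the resolvent set. It remains to
recognise \<open>S\<^sub>1(b)\<close> and \<open>S\<^sub>2(b)\<close> as Bessel functions of \<open>b \<surd>z\<close>; for \<open>\<nu> = 0\<close> this requires the logarithmic
series of \<open>Y\<^sub>0\<close>, which comes from differentiating the series of \<open>J\<close> with respect to its order
(\<open>frob_fun_eigen\<close>, \<open>bessel_Y_0\<close>, \<open>weyl_quotient\<close>).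
\<close>

section \<open>Integration by parts for indefinite integrals\<close>

lemma measurable_triangle:
  "Measurable.pred (lebesgue_on {a..b::real} \<Otimes>\<^sub>M lebesgue_on {a..b}) (\<lambda>w. snd w \<le> fst w)"
proof -
  have id: "(\<lambda>x::real. x) \<in> borel_measurable (lebesgue_on {a..b})"
    by (rule measurable_restrict_space1) (rule measurable_completion, simp)
  have 1: "(\<lambda>w. fst w) \<in> borel_measurable (lebesgue_on {a..b} \<Otimes>\<^sub>M lebesgue_on {a..b::real})"
    by (rule measurable_compose[OF measurable_fst id])
  have 2: "(\<lambda>w. snd w) \<in> borel_measurable (lebesgue_on {a..b} \<Otimes>\<^sub>M lebesgue_on {a..b::real})"
    by (rule measurable_compose[OF measurable_snd id])
  show ?thesis
    using borel_measurable_le[OF 2 1] by (simp add: pred_def)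
qed

lemma lebesgue_on_integral_eq:
  fixes p :: "real \<Rightarrow> complex"
  assumes "p absolutely_integrable_on S" "S \<in> sets lebesgue"
  shows "integrable (lebesgue_on S) p" "integral\<^sup>L (lebesgue_on S) p = integral S p"
proof -
  show 1: "integrable (lebesgue_on S) p"
    using assms by (simp add: integrable_restrict_space set_integrable_def)
  show "integral\<^sup>L (lebesgue_on S) p = integral S p"
    using lebesgue_integral_eq_integral[OF 1 assms(2)] .
qed

text \<open>
Both sides are iterated integrals of \<open>p(x) q(t)\<close> over the triangle \<open>t \<le> x\<close>. The integrands are only
integrable, hence the Lebesgue version of Fubini's theorem is needed; all later integrations by
parts and the duality of the two Volterra operators rest on this identity.
\<close>

lemma triangle_fubini:
  fixes p q :: "real \<Rightarrow> complex"
  assumes p: "p absolutely_integrable_on {a..b}" and q: "q absolutely_integrable_on {a..b}"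
  shows "integral {a..b} (\<lambda>x. p x * integral {a..x} q) = integral {a..b} (\<lambda>t. q t * integral {t..b} p)"
    "(\<lambda>x. p x * integral {a..x} q) absolutely_integrable_on {a..b}"
    "(\<lambda>t. q t * integral {t..b} p) absolutely_integrable_on {a..b}"
proof -
  let ?M = "lebesgue_on {a..b}"
  interpret F: finite_measure ?M by (rule finite_measure_lebesgue_on) auto
  interpret P: pair_sigma_finite ?M ?M ..
  note ip = lebesgue_on_integral_eq[OF p, simplified]
  note iq = lebesgue_on_integral_eq[OF q, simplified]
  define f where "f = (\<lambda>(x,t). if t \<le> x then p x * q t else 0)"
  have fm: "f \<in> borel_measurable (?M \<Otimes>\<^sub>M ?M)"
  proof -
    have [measurable]: "p \<in> borel_measurable ?M" "q \<in> borel_measurable ?M"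
      using ip iq by auto
    note measurable_triangle[measurable]
    have "(\<lambda>w. if snd w \<le> fst w then p (fst w) * q (snd w) else 0) \<in> borel_measurable (?M \<Otimes>\<^sub>M ?M)"
      by measurable
    then show ?thesis by (simp add: f_def case_prod_beta')
  qed
  have fi: "integrable (?M \<Otimes>\<^sub>M ?M) f"
  proof -
    have pq: "integrable (?M \<Otimes>\<^sub>M ?M) (\<lambda>(x,t). p x * q t)"
    proof (rule P.Fubini_integrable)
      show "(\<lambda>(x,t). p x * q t) \<in> borel_measurable (?M \<Otimes>\<^sub>M ?M)"
        using ip iq by (auto simp: case_prod_beta')
      show "integrable ?M (\<lambda>x. LINT y|?M. norm (case (x, y) of (x, t) \<Rightarrow> p x * q t))"
        using ip iq by (simp add: norm_mult)
      show "AE x in ?M. integrable ?M (\<lambda>y. case (x, y) of (x, t) \<Rightarrow> p x * q t)"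
        using ip iq by simp
    qed
    show ?thesis
      by (rule Bochner_Integration.integrable_bound[OF pq fm]) (auto simp: f_def)
  qed
  have 1: "(LINT t|?M. f (x,t)) = p x * integral {a..x} q" if "x \<in> {a..b}" for x
  proof -
    have "(LINT t|?M. f (x,t)) = (LINT t|lebesgue. indicator {a..b} t *\<^sub>R f (x,t))"
      by (simp add: integral_restrict_space)
    also have "\<dots> = (LINT t|lebesgue. p x * (indicator {a..x} t *\<^sub>R q t))"
      by (rule Bochner_Integration.integral_cong) (use that in \<open>auto simp: f_def indicator_def\<close>)
    also have "\<dots> = p x * (LINT t|lebesgue. (indicator {a..x} t *\<^sub>R q t))"
      by (rule integral_mult_right_zero)
    also have "(LINT t|lebesgue. (indicator {a..x} t *\<^sub>R q t)) = integral {a..x} q"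
      using set_lebesgue_integral_eq_integral(2)[of "{a..x}" q]
        absolutely_integrable_on_subinterval[OF q, of a x] that
      by (auto simp: set_lebesgue_integral_def)
    finally show ?thesis .
  qed
  have 2: "(LINT x|?M. f (x,t)) = q t * integral {t..b} p" if "t \<in> {a..b}" for t
  proof -
    have "(LINT x|?M. f (x,t)) = (LINT x|lebesgue. indicator {a..b} x *\<^sub>R f (x,t))"
      by (simp add: integral_restrict_space)
    also have "\<dots> = (LINT x|lebesgue. q t * (indicator {t..b} x *\<^sub>R p x))"
      by (rule Bochner_Integration.integral_cong) (use that in \<open>auto simp: f_def indicator_def\<close>)
    also have "\<dots> = q t * (LINT x|lebesgue. (indicator {t..b} x *\<^sub>R p x))"
      by (rule integral_mult_right_zero)
    also have "(LINT x|lebesgue. (indicator {t..b} x *\<^sub>R p x)) = integral {t..b} p"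
      using set_lebesgue_integral_eq_integral(2)[of "{t..b}" p]
        absolutely_integrable_on_subinterval[OF p, of t b] that
      by (auto simp: set_lebesgue_integral_def)
    finally show ?thesis .
  qed
  have i1: "integrable ?M (\<lambda>x. LINT t|?M. f (x,t))"
    using P.integrable_fst'[OF fi] by simp
  have i1': "integrable ?M (\<lambda>x. p x * integral {a..x} q)"
    by (rule iffD1[OF Bochner_Integration.integrable_cong i1]) (use 1 in auto)
  then show "(\<lambda>x. p x * integral {a..x} q) absolutely_integrable_on {a..b}"
    by (simp add: integrable_restrict_space set_integrable_def)
  have fi2: "integrable (?M \<Otimes>\<^sub>M ?M) (\<lambda>(x,y). f (y,x))"
    using P.integrable_product_swap[OF fi] by simp
  have i2: "integrable ?M (\<lambda>t. LINT x|?M. f (x,t))"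
    using P.integrable_fst'[OF fi2] by simp
  have i2': "integrable ?M (\<lambda>t. q t * integral {t..b} p)"
    by (rule iffD1[OF Bochner_Integration.integrable_cong i2]) (use 2 in auto)
  then show "(\<lambda>t. q t * integral {t..b} p) absolutely_integrable_on {a..b}"
    by (simp add: integrable_restrict_space set_integrable_def)
  have "integral {a..b} (\<lambda>x. p x * integral {a..x} q) = (LINT x|?M. p x * integral {a..x} q)"
    using lebesgue_integral_eq_integral[OF i1'] by simp
  also have "\<dots> = (LINT x|?M. LINT t|?M. f (x,t))"
    by (rule Bochner_Integration.integral_cong) (use 1 in auto)
  also have "\<dots> = (LINT t|?M. LINT x|?M. f (x,t))"
    using P.Fubini_integral[of "\<lambda>x t. f (x,t)"] fi by simp
  also have "\<dots> = (LINT t|?M. q t * integral {t..b} p)"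
    by (rule Bochner_Integration.integral_cong) (use 2 in auto)
  also have "\<dots> = integral {a..b} (\<lambda>t. q t * integral {t..b} p)"
    using lebesgue_integral_eq_integral[OF i2'] by simp
  finally show "integral {a..b} (\<lambda>x. p x * integral {a..x} q) = integral {a..b} (\<lambda>t. q t * integral {t..b} p)" .
qed

text \<open>
The product rule for absolutely continuous functions, stated without derivatives: a function with an
integrable density need not be differentiable everywhere, so that the usual integration by parts does
not apply. It follows from the two triangle integrals, which add up to the integral over the square.
\<close>

lemma ac_product_rule:
  fixes p q F G :: "real \<Rightarrow> complex"
  assumes p: "p absolutely_integrable_on {a..b}" and q: "q absolutely_integrable_on {a..b}"
    and F: "\<And>x. x \<in> {a..b} \<Longrightarrow> F x = F a + integral {a..x} p"
    and G: "\<And>x. x \<in> {a..b} \<Longrightarrow> G x = G a + integral {a..x} q"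
    and "a \<le> b"
  shows "F b * G b = F a * G a + integral {a..b} (\<lambda>x. p x * G x + F x * q x)"
    "(\<lambda>x. p x * G x + F x * q x) absolutely_integrable_on {a..b}"
proof -
  note t1 = triangle_fubini[OF p q] and t2 = triangle_fubini[OF q p]
  have ip: "p integrable_on {a..b}" and iq: "q integrable_on {a..b}"
    using p q set_lebesgue_integral_eq_integral(1) by auto
  have i: "(\<lambda>x. p x * integral {a..x} q) integrable_on {a..b}" "(\<lambda>x. q x * integral {a..x} p) integrable_on {a..b}"
    "(\<lambda>t. q t * integral {t..b} p) integrable_on {a..b}"
    using t1 t2 set_lebesgue_integral_eq_integral(1) by auto
  have e: "p x * G x + F x * q x = p x * G a + F a * q x + (p x * integral {a..x} q + q x * integral {a..x} p)"
    if "x \<in> {a..b}" for x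
    by (subst F[OF that], subst G[OF that]) (simp add: algebra_simps)
  have ai: "(\<lambda>x. p x * G a + F a * q x + (p x * integral {a..x} q + q x * integral {a..x} p))
     absolutely_integrable_on {a..b}"
    using p q t1(2) t2(2) by (intro set_integral_add) auto
  then show "(\<lambda>x. p x * G x + F x * q x) absolutely_integrable_on {a..b}"
    by (rule iffD2[OF set_integrable_cong, rotated -1]) (use e in auto)
  have s: "q x * integral {a..x} p = q x * integral {a..b} p - q x * integral {x..b} p" if "x \<in> {a..b}" for x
  proof -
    have e: "integral {a..x} p = integral {a..b} p - integral {x..b} p"
      using Henstock_Kurzweil_Integration.integral_combine[of a x b p] ip that
      by (auto simp: algebra_simps)
    show ?thesis unfolding e by (rule right_diff_distrib)
  qed
  have "integral {a..b} (\<lambda>x. q x * integral {a..x} p) = integral {a..b} (\<lambda>x. q x * integral {a..b} p - q x * integral {x..b} p)"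
    by (rule integral_cong) (use s in auto)
  also have "\<dots> = integral {a..b} q * integral {a..b} p - integral {a..b} (\<lambda>x. q x * integral {x..b} p)"
    using iq i by (subst integral_diff) (auto intro: integrable_on_mult_left)
  finally have c: "integral {a..b} (\<lambda>x. q x * integral {a..x} p) + integral {a..b} (\<lambda>x. p x * integral {a..x} q)
     = integral {a..b} q * integral {a..b} p"
    using t1(1) by simp
  have "integral {a..b} (\<lambda>x. p x * G x + F x * q x) =
    integral {a..b} (\<lambda>x. p x * G a + F a * q x + (p x * integral {a..x} q + q x * integral {a..x} p))"
    by (rule integral_cong) (use e in auto)
  also have "\<dots> = integral {a..b} p * G a + F a * integral {a..b} q +
     (integral {a..b} (\<lambda>x. p x * integral {a..x} q) + integral {a..b} (\<lambda>x. q x * integral {a..x} p))"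
  proof -
    have j: "(\<lambda>x. p x * G a) integrable_on {a..b}" "(\<lambda>x. F a * q x) integrable_on {a..b}"
      using ip iq by (auto intro: integrable_on_mult_left integrable_on_mult_right)
    show ?thesis
      using i j by (simp add: Henstock_Kurzweil_Integration.integral_add integrable_add)
  qed
  also have "\<dots> = integral {a..b} p * G a + F a * integral {a..b} q + integral {a..b} q * integral {a..b} p"
    using c by (simp add: add.commute)
  finally show "F b * G b = F a * G a + integral {a..b} (\<lambda>x. p x * G x + F x * q x)"
    using F[of b] G[of b] \<open>a \<le> b\<close> by (simp add: algebra_simps)
qed

section \<open>Square integrable functions\<close>

abbreviation leb :: "real \<Rightarrow> real measure" where
  "leb b \<equiv> lebesgue_on {0<..<b}"

text \<open>
The squared norm and the inner product of \<open>L\<^sup>2(0,b)\<close> on the level of functions. All analysis is done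
with functions; classes enter only through the transfer lemmas for the operations of \<open>L2_space\<close>.
\<close>

definition sqnorm :: "real \<Rightarrow> (real \<Rightarrow> complex) \<Rightarrow> real" where
  "sqnorm b f = (LINT x|leb b. (norm (f x))\<^sup>2)"

definition sqinner :: "real \<Rightarrow> (real \<Rightarrow> complex) \<Rightarrow> (real \<Rightarrow> complex) \<Rightarrow> complex" where
  "sqinner b f g = (LINT x|leb b. f x * cnj (g x))"

lemma finite_measure_leb: "finite_measure (leb b)"
  by (rule finite_measure_lebesgue_on) auto

lemma sqnorm_nonneg: "0 \<le> sqnorm b f"
  unfolding sqnorm_def by simp

lemma sq_integrable_measurable [measurable_dest]:
  "sq_integrable b f \<Longrightarrow> f \<in> borel_measurable (leb b)"
  by (simp add: sq_integrable_def)

lemma sq_integrable_dominated: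
  assumes "f \<in> borel_measurable (leb b)" "sq_integrable b g"
    "\<And>x. 0 < x \<Longrightarrow> x < b \<Longrightarrow> norm (f x) \<le> C * norm (g x)"
  shows "sq_integrable b f"
  unfolding sq_integrable_def
proof
  show "integrable (leb b) (\<lambda>x. (norm (f x))\<^sup>2)"
  proof (rule Bochner_Integration.integrable_bound)
    show "integrable (leb b) (\<lambda>x. C\<^sup>2 * (norm (g x))\<^sup>2)"
      using assms(2) by (simp add: sq_integrable_def)
    show "(\<lambda>x. (norm (f x))\<^sup>2) \<in> borel_measurable (leb b)"
      using assms(1) by measurable
    show "AE x in leb b. norm ((norm (f x))\<^sup>2) \<le> norm (C\<^sup>2 * (norm (g x))\<^sup>2)"
    proof (rule AE_I2)
      fix x assume "x \<in> space (leb b)"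
      then have "norm (f x) \<le> C * norm (g x)" using assms(3) by auto
      then have "(norm (f x))\<^sup>2 \<le> (C * norm (g x))\<^sup>2" by (intro power_mono) auto
      then show "norm ((norm (f x))\<^sup>2) \<le> norm (C\<^sup>2 * (norm (g x))\<^sup>2)"
        by (simp add: power_mult_distrib abs_mult)
    qed
  qed
qed (use assms in auto)

lemma norm_sum_sq_le: "(norm (z + w))\<^sup>2 \<le> 2 * (norm z)\<^sup>2 + 2 * (norm (w::'a::real_normed_vector))\<^sup>2"
proof -
  have "(norm (z + w))\<^sup>2 \<le> (norm z + norm w)\<^sup>2"
    by (intro power_mono norm_triangle_ineq) auto
  also have "\<dots> \<le> 2 * (norm z)\<^sup>2 + 2 * (norm w)\<^sup>2"
    using zero_le_power2[of "norm z - norm w"] by (simp add: power2_eq_square algebra_simps)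
  finally show ?thesis .
qed

lemma sq_integrable_add:
  assumes "sq_integrable b f" "sq_integrable b g"
  shows "sq_integrable b (\<lambda>x. f x + g x)"
  unfolding sq_integrable_def
proof
  note [measurable] = sq_integrable_measurable[OF assms(1)] sq_integrable_measurable[OF assms(2)]
  show m: "(\<lambda>x. f x + g x) \<in> borel_measurable (leb b)" by measurable
  show "integrable (leb b) (\<lambda>x. (norm (f x + g x))\<^sup>2)"
  proof (rule Bochner_Integration.integrable_bound)
    show "integrable (leb b) (\<lambda>x. 2 * (norm (f x))\<^sup>2 + 2 * (norm (g x))\<^sup>2)"
      using assms by (simp add: sq_integrable_def)
  qed (use norm_sum_sq_le in \<open>auto intro!: AE_I2\<close>)
qed

lemma sq_integrable_scale:
  assumes "sq_integrable b f" shows "sq_integrable b (\<lambda>x. c * f x)"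
  using assms by (auto simp: sq_integrable_def norm_mult power_mult_distrib)

lemma sq_integrable_diff:
  assumes "sq_integrable b f" "sq_integrable b g"
  shows "sq_integrable b (\<lambda>x. f x - g x)"
  using sq_integrable_add[OF assms(1) sq_integrable_scale[OF assms(2), of "-1"]] by simp

lemma sq_integrable_cnj: "sq_integrable b f \<Longrightarrow> sq_integrable b (\<lambda>x. cnj (f x))"
  using borel_measurable_continuous_on[of cnj f "leb b"]
  by (auto simp: sq_integrable_def intro: continuous_intros)

lemma sq_integrable_zero: "sq_integrable b (\<lambda>x. 0)"
  by (simp add: sq_integrable_def)

lemma integrable_mult_sq:
  assumes "sq_integrable b f" "sq_integrable b g"
  shows "integrable (leb b) (\<lambda>x. f x * g x)"
proof (rule Bochner_Integration.integrable_bound)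
  note [measurable] = sq_integrable_measurable[OF assms(1)] sq_integrable_measurable[OF assms(2)]
  show "integrable (leb b) (\<lambda>x. (norm (f x))\<^sup>2 + (norm (g x))\<^sup>2)"
    using assms by (simp add: sq_integrable_def)
  show "(\<lambda>x. f x * g x) \<in> borel_measurable (leb b)" by measurable
  have "norm (z * w) \<le> norm ((norm z)\<^sup>2 + (norm w)\<^sup>2)" for z w :: complex
  proof -
    have "0 \<le> norm z * norm w" by simp
    with sum_squares_bound[of "norm z" "norm w"] have "norm z * norm w \<le> (norm z)\<^sup>2 + (norm w)\<^sup>2"
      by linarith
    then show ?thesis by (simp add: norm_mult)
  qed
  then show "AE x in leb b. norm (f x * g x) \<le> norm ((norm (f x))\<^sup>2 + (norm (g x))\<^sup>2)" by simp
qed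

lemma integrable_sqinner:
  assumes "sq_integrable b f" "sq_integrable b g"
  shows "integrable (leb b) (\<lambda>x. f x * cnj (g x))"
  using integrable_mult_sq[OF assms(1) sq_integrable_cnj[OF assms(2)]] .

lemma sq_integrable_const: "sq_integrable b (\<lambda>x. c)"
proof -
  interpret finite_measure "leb b" by (rule finite_measure_leb)
  show ?thesis by (simp add: sq_integrable_def)
qed

lemma absolutely_integrable_Icc_iff:
  fixes f :: "real \<Rightarrow> complex"
  shows "f absolutely_integrable_on {0..b} \<longleftrightarrow> integrable (leb b) f"
  using absolutely_integrable_on_open_interval[where f=f and a=0 and b=b]
  by (simp add: integrable_restrict_space set_integrable_def)

lemma sq_integrable_imp_absolutely_integrable:
  "sq_integrable b f \<Longrightarrow> f absolutely_integrable_on {0..b}"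
  using integrable_mult_sq[OF _ sq_integrable_const[of b 1]] by (simp add: absolutely_integrable_Icc_iff)

lemma absolutely_integrable_mult_sq:
  "sq_integrable b f \<Longrightarrow> sq_integrable b g \<Longrightarrow> (\<lambda>x. f x * g x) absolutely_integrable_on {0..b}"
  by (simp add: absolutely_integrable_Icc_iff integrable_mult_sq)

lemma leb_eq_integral:
  fixes f :: "real \<Rightarrow> complex"
  assumes "integrable (leb b) f"
  shows "(LINT x|leb b. f x) = integral {0..b} f"
  using lebesgue_integral_eq_integral[OF assms] integral_open_interval_real[of 0 b f] by simp

lemma sqinner_self: "sq_integrable b f \<Longrightarrow> sqinner b f f = of_real (sqnorm b f)"
  unfolding sqinner_def sqnorm_def
  by (simp add: complex_norm_square[symmetric] del: of_real_power)

lemma nn_sqnorm: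
  assumes "sq_integrable b f"
  shows "(\<integral>\<^sup>+x. (ennreal (norm (f x)))\<^sup>2 \<partial>leb b) = ennreal (sqnorm b f)"
  using assms unfolding sqnorm_def sq_integrable_def
  by (simp add: nn_integral_eq_integral[symmetric] ennreal_power)

lemma Cauchy_Schwarz_sq:
  assumes "sq_integrable b f" "sq_integrable b g"
  shows "(LINT x|leb b. norm (f x * g x)) \<le> sqrt (sqnorm b f) * sqrt (sqnorm b g)"
proof -
  note [measurable] = sq_integrable_measurable[OF assms(1)] sq_integrable_measurable[OF assms(2)]
  let ?I = "LINT x|leb b. norm (f x * g x)"
  have "(\<integral>\<^sup>+x. ennreal (norm (f x)) * ennreal (norm (g x)) \<partial>leb b) = ennreal ?I"
    using integrable_norm[OF integrable_mult_sq[OF assms]]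
    by (simp add: nn_integral_eq_integral[symmetric] norm_mult ennreal_mult)
  then have "(ennreal ?I)\<^sup>2 \<le> ennreal (sqnorm b f) * ennreal (sqnorm b g)"
    using Cauchy_Schwarz_nn_integral[of "\<lambda>x. ennreal (norm (f x))" "leb b" "\<lambda>x. ennreal (norm (g x))"]
    by (simp add: nn_sqnorm assms)
  then have "ennreal (?I\<^sup>2) \<le> ennreal (sqnorm b f * sqnorm b g)"
    by (simp add: ennreal_power ennreal_mult sqnorm_nonneg)
  then have "?I\<^sup>2 \<le> sqnorm b f * sqnorm b g"
    by (simp add: sqnorm_nonneg)
  then show ?thesis
    by (metis real_sqrt_le_mono real_sqrt_mult real_le_rsqrt)
qed

lemma norm_sqinner_le:
  assumes "sq_integrable b f" "sq_integrable b g"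
  shows "norm (sqinner b f g) \<le> sqrt (sqnorm b f) * sqrt (sqnorm b g)"
proof -
  have "norm (sqinner b f g) \<le> (LINT x|leb b. norm (f x * cnj (g x)))"
    unfolding sqinner_def by (rule integral_norm_bound)
  also have "\<dots> = (LINT x|leb b. norm (f x * g x))"
    by (simp add: norm_mult)
  finally show ?thesis using Cauchy_Schwarz_sq[OF assms] by simp
qed

lemma sqinner_add:
  assumes "sq_integrable b f" "sq_integrable b g" "sq_integrable b h"
  shows "sqinner b (\<lambda>x. f x + g x) h = sqinner b f h + sqinner b g h"
  unfolding sqinner_def
  using integrable_sqinner assms by (simp add: distrib_right)

lemma sqinner_add_right:
  assumes "sq_integrable b f" "sq_integrable b g" "sq_integrable b h"
  shows "sqinner b h (\<lambda>x. f x + g x) = sqinner b h f + sqinner b h g"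
  unfolding sqinner_def
  using integrable_sqinner assms by (simp add: distrib_left)

lemma sqinner_diff:
  assumes "sq_integrable b f" "sq_integrable b g" "sq_integrable b h"
  shows "sqinner b (\<lambda>x. f x - g x) h = sqinner b f h - sqinner b g h"
  unfolding sqinner_def
  using integrable_sqinner assms by (simp add: left_diff_distrib)

lemma sqinner_diff_right:
  assumes "sq_integrable b f" "sq_integrable b g" "sq_integrable b h"
  shows "sqinner b h (\<lambda>x. f x - g x) = sqinner b h f - sqinner b h g"
  unfolding sqinner_def
  using integrable_sqinner assms by (simp add: right_diff_distrib)

lemma sqinner_scale: "sqinner b (\<lambda>x. c * f x) h = c * sqinner b f h"
  unfolding sqinner_def by (simp add: mult.assoc)

lemma sqinner_scale_right: "sqinner b h (\<lambda>x. c * f x) = cnj c * sqinner b h f"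
  unfolding sqinner_def by (simp add: mult.left_commute)

lemma sqinner_commute: "sqinner b g f = cnj (sqinner b f g)"
  unfolding sqinner_def by (subst Bochner_Integration.integral_cnj[symmetric]) (simp add: mult.commute)

lemma sqnorm_eq_0:
  assumes "sq_integrable b f"
  shows "sqnorm b f = 0 \<longleftrightarrow> (AE x in leb b. f x = 0)"
  using assms unfolding sqnorm_def sq_integrable_def
  by (subst integral_nonneg_eq_0_iff_AE) auto

lemma sqnorm_add_le:
  assumes "sq_integrable b f" "sq_integrable b g"
  shows "sqnorm b (\<lambda>x. f x + g x) \<le> 2 * sqnorm b f + 2 * sqnorm b g"
proof -
  have "sqnorm b (\<lambda>x. f x + g x) \<le> (LINT x|leb b. 2 * (norm (f x))\<^sup>2 + 2 * (norm (g x))\<^sup>2)"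
    unfolding sqnorm_def
    using sq_integrable_add[OF assms] assms
    by (intro integral_mono norm_sum_sq_le) (auto simp: sq_integrable_def)
  also have "\<dots> = 2 * sqnorm b f + 2 * sqnorm b g"
    using assms by (simp add: sqnorm_def sq_integrable_def)
  finally show ?thesis .
qed

section \<open>Completeness and a dense set of polynomials\<close>

text \<open>
The Riesz-Fischer theorem. The interval has finite measure, so that the increments of a rapidly convergent
subsequence are summable in \<open>L\<^sup>1\<close> and the subsequence converges almost everywhere; Fatou's lemma then
gives convergence in \<open>L\<^sup>2\<close> of the whole sequence.
\<close>

lemma sq_integrable_complete:
  assumes s: "\<And>n. sq_integrable b (s n)"
    and cauchy: "\<And>e. e > 0 \<Longrightarrow> \<exists>N. \<forall>m\<ge>N. \<forall>n\<ge>N. sqnorm b (\<lambda>x. s m x - s n x) < e"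
  obtains f where "sq_integrable b f" "(\<lambda>n. sqnorm b (\<lambda>x. s n x - f x)) \<longlonglongrightarrow> 0"
proof -
  have "\<exists>N. \<forall>m\<ge>N. \<forall>n\<ge>N. sqnorm b (\<lambda>x. s m x - s n x) < (1/4)^k" for k :: nat
    by (rule cauchy) simp
  then obtain N where N: "\<And>k m n. m \<ge> N k \<Longrightarrow> n \<ge> N k \<Longrightarrow> sqnorm b (\<lambda>x. s m x - s n x) < (1/4)^k"
    by metis
  \<comment> \<open>The partial sums dominate every earlier \<open>N i\<close>, so that all later members of the subsequence satisfy the \<open>i\<close>-th estimate.\<close>
  define r where "r k = (\<Sum>i\<le>k. N i)" for k
  have rN: "r j \<ge> N k" if "k \<le> j" for j k
  proof -
    have "sum N {k} \<le> sum N {..j}" by (rule sum_mono2) (use that in auto)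
    then show ?thesis by (simp add: r_def)
  qed
  define d where "d k = (\<lambda>x. s (r (Suc k)) x - s (r k) x)" for k
  have dsq: "sq_integrable b (d k)" for k
    unfolding d_def by (intro sq_integrable_diff s)
  have dn: "sqnorm b (d k) \<le> (1/4)^k" for k
    using N[of k "r (Suc k)" "r k"] rN[of k] rN[of k "Suc k"] by (simp add: d_def)
  note [measurable] = sq_integrable_measurable[OF s] sq_integrable_measurable[OF dsq]
  define C where "C = sqrt (sqnorm b (\<lambda>x. 1))"
  have C: "0 \<le> C" by (simp add: C_def sqnorm_nonneg)
  have "(\<integral>\<^sup>+x. ennreal (norm (d k x)) \<partial>leb b) \<le> ennreal (C * (1/2)^k)" for k
  proof -
    have "(LINT x|leb b. norm (d k x)) \<le> sqrt (sqnorm b (d k)) * C"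
      using Cauchy_Schwarz_sq[OF dsq sq_integrable_const, of k 1] by (simp add: C_def)
    also have "\<dots> \<le> sqrt ((1/4)^k) * C"
      using dn C by (intro mult_right_mono real_sqrt_le_mono) auto
    also have "sqrt ((1/4)^k) = (1/2)^k"
      by (simp add: real_sqrt_power real_sqrt_divide)
    finally have "(LINT x|leb b. norm (d k x)) \<le> C * (1/2)^k" by (simp add: mult.commute)
    moreover have "integrable (leb b) (\<lambda>x. norm (d k x))"
      using integrable_mult_sq[OF dsq sq_integrable_const[of b 1], of k] by simp
    ultimately show ?thesis
      by (simp add: nn_integral_eq_integral ennreal_leI)
  qed
  then have "(\<Sum>k. \<integral>\<^sup>+x. ennreal (norm (d k x)) \<partial>leb b) \<le> (\<Sum>k. ennreal (C * (1/2)^k))"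
    by (intro suminf_le) auto
  also have "\<dots> = ennreal (\<Sum>k. C * (1/2)^k)"
    using C by (intro suminf_ennreal2 summable_mult summable_geometric) auto
  finally have "(\<integral>\<^sup>+x. (\<Sum>k. ennreal (norm (d k x))) \<partial>leb b) \<noteq> \<infinity>"
    by (subst nn_integral_suminf) (auto simp: top_unique)
  then have "AE x in leb b. (\<Sum>k. ennreal (norm (d k x))) \<noteq> \<infinity>"
    by (intro nn_integral_noteq_infinite) auto
  then have conv: "AE x in leb b. convergent (\<lambda>j. s (r j) x)"
  proof eventually_elim
    case (elim x)
    then have "summable (\<lambda>k. norm (d k x))"
      by (intro summable_suminf_not_top) auto
    then have "summable (\<lambda>k. s (r (Suc k)) x - s (r k) x)"
      unfolding d_def by (rule summable_norm_cancel)
    then have "convergent (\<lambda>n. \<Sum>k<n. s (r (Suc k)) x - s (r k) x)"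
      by (simp add: summable_iff_convergent)
    then have "convergent (\<lambda>n. s (r n) x - s (r 0) x)"
      using sum_lessThan_telescope[of "\<lambda>n. s (r n) x"] by simp
    then have "convergent (\<lambda>n. (s (r n) x - s (r 0) x) + s (r 0) x)"
      by (intro convergent_add convergent_const)
    then show ?case by simp
  qed
  define f where "f x = lim (\<lambda>j. s (r j) x)" for x
  have fm [measurable]: "f \<in> borel_measurable (leb b)"
    unfolding f_def by (rule borel_measurable_lim_metric) auto
  have bound: "(\<integral>\<^sup>+x. (ennreal (norm (s n x - f x)))\<^sup>2 \<partial>leb b) \<le> ennreal ((1/4)^k)" if "n \<ge> N k" for n k
  proof -
    have "AE x in leb b. (ennreal (norm (s n x - f x)))\<^sup>2 = liminf (\<lambda>j. (ennreal (norm (s n x - s (r j) x)))\<^sup>2)"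
      using conv
    proof eventually_elim
      case (elim x)
      then have "(\<lambda>j. s (r j) x) \<longlonglongrightarrow> f x"
        by (simp add: f_def convergent_LIMSEQ_iff)
      then have "(\<lambda>j. ennreal ((norm (s n x - s (r j) x))\<^sup>2)) \<longlonglongrightarrow> ennreal ((norm (s n x - f x))\<^sup>2)"
        by (intro tendsto_intros)
      then have "(\<lambda>j. (ennreal (norm (s n x - s (r j) x)))\<^sup>2) \<longlonglongrightarrow> (ennreal (norm (s n x - f x)))\<^sup>2"
        by (simp add: ennreal_power)
      then show ?case by (simp add: lim_imp_Liminf)
    qed
    then have "(\<integral>\<^sup>+x. (ennreal (norm (s n x - f x)))\<^sup>2 \<partial>leb b) =
      (\<integral>\<^sup>+x. liminf (\<lambda>j. (ennreal (norm (s n x - s (r j) x)))\<^sup>2) \<partial>leb b)"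
      by (rule nn_integral_cong_AE)
    also have "\<dots> \<le> liminf (\<lambda>j. \<integral>\<^sup>+x. (ennreal (norm (s n x - s (r j) x)))\<^sup>2 \<partial>leb b)"
      by (rule nn_integral_liminf) auto
    also have "\<dots> = liminf (\<lambda>j. ennreal (sqnorm b (\<lambda>x. s n x - s (r j) x)))"
      by (simp add: nn_sqnorm s sq_integrable_diff)
    also have "\<dots> \<le> limsup (\<lambda>j. ennreal (sqnorm b (\<lambda>x. s n x - s (r j) x)))"
      by (rule Liminf_le_Limsup) auto
    also have "\<dots> \<le> ennreal ((1/4)^k)"
    proof (rule Limsup_bounded)
      show "\<forall>\<^sub>F j in sequentially. ennreal (sqnorm b (\<lambda>x. s n x - s (r j) x)) \<le> ennreal ((1/4)^k)"
        using eventually_ge_at_top[of k]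
      proof eventually_elim
        case (elim j)
        then show ?case using N[OF that rN[OF elim]] by (intro ennreal_leI) simp
      qed
    qed
    finally show ?thesis .
  qed
  have sfsq: "sq_integrable b (\<lambda>x. s n x - f x)" if "n \<ge> N k" for n k
  proof -
    have "(\<integral>\<^sup>+x. ennreal ((norm (s n x - f x))\<^sup>2) \<partial>leb b) < \<infinity>"
      using order_le_less_trans[OF bound[OF that], of \<infinity>] by (simp add: ennreal_power)
    then have "integrable (leb b) (\<lambda>x. (norm (s n x - f x))\<^sup>2)"
      by (intro integrableI_nonneg) auto
    then show ?thesis by (simp add: sq_integrable_def)
  qed
  have sf: "sqnorm b (\<lambda>x. s n x - f x) \<le> (1/4)^k" if "n \<ge> N k" for n k
    using bound[OF that] by (simp add: nn_sqnorm[OF sfsq[OF that]])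
  have "sq_integrable b (\<lambda>x. s (N 0) x - (s (N 0) x - f x))"
    by (rule sq_integrable_diff[OF s sfsq[OF order_refl]])
  then have fsq: "sq_integrable b f" by simp
  have "(\<lambda>n. sqnorm b (\<lambda>x. s n x - f x)) \<longlonglongrightarrow> 0"
  proof (rule LIMSEQ_I)
    fix e :: real assume "0 < e"
    then obtain k where "(1/4)^k < e" using real_arch_pow_inv[of e "1/4"] by auto
    then have "\<forall>n\<ge>N k. norm (sqnorm b (\<lambda>x. s n x - f x) - 0) < e"
      using sf sqnorm_nonneg by (fastforce simp: abs_of_nonneg)
    then show "\<exists>no. \<forall>n\<ge>no. norm (sqnorm b (\<lambda>x. s n x - f x) - 0) < e" by blast
  qed
  with fsq show ?thesis by (rule that)
qed

lemma sqnorm_dominated_convergence: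
  assumes g: "sq_integrable b g"
    and m: "\<And>n. s n \<in> borel_measurable (leb b)" "f \<in> borel_measurable (leb b)"
    and lim: "AE x in leb b. (\<lambda>n. s n x) \<longlonglongrightarrow> f x"
    and bound: "\<And>n. AE x in leb b. norm (s n x - f x) \<le> norm (g x)"
  shows "(\<lambda>n. sqnorm b (\<lambda>x. s n x - f x)) \<longlonglongrightarrow> 0"
proof -
  note [measurable] = m
  have "(\<lambda>n. LINT x|leb b. (norm (s n x - f x))\<^sup>2) \<longlonglongrightarrow> (LINT x|leb b. 0)"
  proof (rule integral_dominated_convergence[where w="\<lambda>x. (norm (g x))\<^sup>2"])
    show "integrable (leb b) (\<lambda>x. (norm (g x))\<^sup>2)" using g by (simp add: sq_integrable_def)
    show "AE x in leb b. (\<lambda>i. (norm (s i x - f x))\<^sup>2) \<longlonglongrightarrow> 0"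
      using lim
    proof eventually_elim
      case (elim x)
      have "(\<lambda>i. (norm (s i x - f x))\<^sup>2) \<longlonglongrightarrow> (norm (f x - f x))\<^sup>2"
        by (intro tendsto_intros elim)
      then show ?case by simp
    qed
    show "AE x in leb b. norm ((norm (s i x - f x))\<^sup>2) \<le> (norm (g x))\<^sup>2" for i
      using bound[of i] by eventually_elim (simp add: power_mono)
  qed auto
  then show ?thesis by (simp add: sqnorm_def)
qed

definition approximable :: "real \<Rightarrow> (real \<Rightarrow> complex) set \<Rightarrow> (real \<Rightarrow> complex) \<Rightarrow> bool" where
  "approximable b D f \<longleftrightarrow> (\<forall>e>0. \<exists>g\<in>D. sqnorm b (\<lambda>x. f x - g x) < e)"

text \<open>
Approximability passes to limits. This allows a density proof in stages: polynomials with a cutoff,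
polynomials, continuous functions, bounded functions, all functions.
\<close>

lemma approximable_limit:
  assumes f: "sq_integrable b f" and D: "\<And>g. g \<in> D \<Longrightarrow> sq_integrable b g"
    and "\<And>e. e > 0 \<Longrightarrow> \<exists>h. sq_integrable b h \<and> approximable b D h \<and> sqnorm b (\<lambda>x. h x - f x) < e"
  shows "approximable b D f"
  unfolding approximable_def
proof (intro allI impI)
  fix e :: real assume "e > 0"
  then obtain h where h: "sq_integrable b h" "approximable b D h" "sqnorm b (\<lambda>x. h x - f x) < e/4"
    using assms(3)[of "e/4"] by auto
  then obtain g where g: "g \<in> D" "sqnorm b (\<lambda>x. h x - g x) < e/4"
    using \<open>e > 0\<close> unfolding approximable_def by (meson divide_pos_pos zero_less_numeral)
  have "sqnorm b (\<lambda>x. (f x - h x) + (h x - g x)) \<le> 2 * sqnorm b (\<lambda>x. f x - h x) + 2 * sqnorm b (\<lambda>x. h x - g x)"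
    by (intro sqnorm_add_le sq_integrable_diff f h D g)
  moreover have "sqnorm b (\<lambda>x. f x - h x) = sqnorm b (\<lambda>x. h x - f x)"
    by (simp add: sqnorm_def norm_minus_commute)
  ultimately have "sqnorm b (\<lambda>x. f x - g x) < e" using h g by simp
  with g show "\<exists>g\<in>D. sqnorm b (\<lambda>x. f x - g x) < e" by blast
qed

lemma sq_integrable_continuous_bounded:
  assumes "continuous_on {0<..<b} f" "\<And>x. x \<in> {0<..<b} \<Longrightarrow> norm (f x) \<le> B"
  shows "sq_integrable b f"
proof (rule sq_integrable_dominated[where g="\<lambda>x. 1" and C=B])
  show "f \<in> borel_measurable (leb b)"
    by (rule continuous_imp_measurable_on_sets_lebesgue[OF assms(1)]) auto
qed (use assms sq_integrable_const in auto)

lemma sq_integrable_continuous: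
  assumes "continuous_on {0..b} f"
  shows "sq_integrable b f"
proof -
  have "compact (f ` {0..b})" by (intro compact_continuous_image assms) auto
  then obtain B where "\<And>x. x \<in> {0..b} \<Longrightarrow> norm (f x) \<le> B"
    by (meson compact_imp_bounded bounded_iff imageI)
  then show ?thesis
    by (intro sq_integrable_continuous_bounded[where B=B]) (auto intro: continuous_on_subset[OF assms])
qed

text \<open>
A polynomial cutoff. The base \<open>1 - 4 x (b - x) / b\<^sup>2\<close> lies in \<open>[0,1)\<close> on \<open>(0,b)\<close> and equals \<open>1\<close> at both
end points. Hence the cutoff tends to \<open>1\<close> on \<open>(0,b)\<close>, while the square makes its value and its derivative
vanish at \<open>0\<close> and \<open>b\<close>. A product with a polynomial therefore lies in the domain of the minimal operator.
\<close>

definition cutoff :: "real \<Rightarrow> nat \<Rightarrow> real \<Rightarrow> real" where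
  "cutoff b n x = (1 - (1 - 4 / b\<^sup>2 * x * (b - x)) ^ n)\<^sup>2"

lemma cutoff_base:
  fixes b x :: real
  assumes "0 < x" "x < b"
  shows "0 \<le> 1 - 4 / b\<^sup>2 * x * (b - x)" "1 - 4 / b\<^sup>2 * x * (b - x) < 1"
proof -
  have e: "1 - 4 / b\<^sup>2 * x * (b - x) = ((b - 2 * x) / b)\<^sup>2"
    using assms by (simp add: field_simps power2_eq_square)
  then show "0 \<le> 1 - 4 / b\<^sup>2 * x * (b - x)" by simp
  show "1 - 4 / b\<^sup>2 * x * (b - x) < 1" using assms by simp
qed

text \<open>
A bounded measurable function is an almost everywhere limit of continuous functions, which can be
truncated to the same bound; a continuous function is a uniform limit of polynomials by the
Stone-Weierstrass theorem. Dominated convergence removes the truncation and the cutoff.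
\<close>

lemma polynomials_with_cutoff_dense:
  assumes "0 < b"
  assumes f: "sq_integrable b f"
  shows "approximable b {\<lambda>x. complex_of_real (cutoff b n x) * p x | n p. polynomial_function p} f"
    (is "approximable b ?D f")
proof -
  have cp: "continuous_on {0..b} p" if "polynomial_function p" for p :: "real \<Rightarrow> complex"
    by (rule continuous_on_polymonial_function[OF that])
  have Dsq: "sq_integrable b g" if gD: "g \<in> ?D" for g
  proof -
    obtain n p where g: "g = (\<lambda>x. complex_of_real (cutoff b n x) * p x)" "polynomial_function p"
      using gD by auto
    show ?thesis unfolding g(1) cutoff_def
      by (intro sq_integrable_continuous continuous_intros cp g(2))
  qed
  have poly: "approximable b ?D p" if p: "polynomial_function p" for p :: "real \<Rightarrow> complex"
  proof -
    have "(\<lambda>n. sqnorm b (\<lambda>x. complex_of_real (cutoff b n x) * p x - p x)) \<longlonglongrightarrow> 0"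
    proof (rule sqnorm_dominated_convergence)
      show psq: "sq_integrable b p" by (rule sq_integrable_continuous[OF cp[OF p]])
      show "(\<lambda>x. complex_of_real (cutoff b n x) * p x) \<in> borel_measurable (leb b)" for n
        by (rule sq_integrable_measurable[OF Dsq]) (use p in auto)
      show "p \<in> borel_measurable (leb b)" by (rule sq_integrable_measurable[OF psq])
      show "AE x in leb b. (\<lambda>n. complex_of_real (cutoff b n x) * p x) \<longlonglongrightarrow> p x"
      proof (rule AE_I2)
        fix x assume "x \<in> space (leb b)"
        then have x: "0 < x" "x < b" by auto
        have "(\<lambda>n. complex_of_real ((1 - (1 - 4 / b\<^sup>2 * x * (b - x)) ^ n)\<^sup>2) * p x) \<longlonglongrightarrow> complex_of_real ((1 - 0)\<^sup>2) * p x"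
          by (intro tendsto_intros LIMSEQ_realpow_zero cutoff_base x)
        then show "(\<lambda>n. complex_of_real (cutoff b n x) * p x) \<longlonglongrightarrow> p x"
          by (simp add: cutoff_def)
      qed
      show "AE x in leb b. norm (complex_of_real (cutoff b n x) * p x - p x) \<le> norm (p x)" for n
      proof (rule AE_I2)
        fix x assume "x \<in> space (leb b)"
        then have x: "0 < x" "x < b" by auto
        let ?t = "(1 - 4 / b\<^sup>2 * x * (b - x)) ^ n"
        have t: "0 \<le> ?t" "?t \<le> 1"
          using cutoff_base[OF x] by (auto intro: power_le_one)
        then have "0 \<le> (1 - ?t)\<^sup>2" "(1 - ?t)\<^sup>2 \<le> 1" by (auto intro: power_le_one)
        then have "\<bar>cutoff b n x - 1\<bar> \<le> 1" by (simp add: cutoff_def)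
        moreover have "complex_of_real (cutoff b n x) * p x - p x = complex_of_real (cutoff b n x - 1) * p x"
          by (simp add: algebra_simps)
        ultimately show "norm (complex_of_real (cutoff b n x) * p x - p x) \<le> norm (p x)"
          by (simp add: norm_mult mult_left_le_one_le del: of_real_diff)
      qed
    qed
    then have "(\<lambda>n. sqnorm b (\<lambda>x. p x - complex_of_real (cutoff b n x) * p x)) \<longlonglongrightarrow> 0"
      by (simp add: sqnorm_def norm_minus_commute)
    then have lim: "\<exists>n. sqnorm b (\<lambda>x. p x - complex_of_real (cutoff b n x) * p x) < e" if "0 < e" for e
      using eventually_happens'[OF sequentially_bot order_tendstoD(2)] that by blast
    show ?thesis
      unfolding approximable_def
    proof (intro allI impI)
      fix e :: real assume "0 < e"
      then obtain n where "sqnorm b (\<lambda>x. p x - complex_of_real (cutoff b n x) * p x) < e"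
        using lim by blast
      then show "\<exists>g\<in>?D. sqnorm b (\<lambda>x. p x - g x) < e"
        using p by (intro bexI[where x="\<lambda>x. complex_of_real (cutoff b n x) * p x"]) auto
    qed
  qed
  have cont: "approximable b ?D g" if g: "continuous_on {0..b} g" for g
  proof (rule approximable_limit[OF sq_integrable_continuous[OF g] Dsq])
    fix e :: real assume e: "e > 0"
    define e' where "e' = sqrt (e / (2 * (1 + sqnorm b (\<lambda>x. 1))))"
    have pos: "e / (2 * (1 + sqnorm b (\<lambda>x. 1))) > 0" using e sqnorm_nonneg[of b "\<lambda>x. 1"] by auto
    then have e': "e' > 0" by (simp add: e'_def)
    obtain p where p: "polynomial_function p" "\<And>x. x \<in> {0..b} \<Longrightarrow> norm (g x - p x) < e'"
      using Stone_Weierstrass_polynomial_function[OF _ g e'] by auto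
    have psq: "sq_integrable b p" by (rule sq_integrable_continuous[OF cp[OF p(1)]])
    have gsq: "sq_integrable b g" by (rule sq_integrable_continuous[OF g])
    have "sqnorm b (\<lambda>x. p x - g x) \<le> sqnorm b (\<lambda>x. complex_of_real e' * 1)"
      unfolding sqnorm_def
    proof (rule integral_mono)
      show "integrable (leb b) (\<lambda>x. (norm (p x - g x))\<^sup>2)"
        using sq_integrable_diff[OF psq gsq] by (simp add: sq_integrable_def)
      show "integrable (leb b) (\<lambda>x. (cmod (complex_of_real e' * 1))\<^sup>2)"
        using sq_integrable_const[of b "complex_of_real e'"] by (simp add: sq_integrable_def)
      show "(cmod (p x - g x))\<^sup>2 \<le> (cmod (complex_of_real e' * 1))\<^sup>2" if "x \<in> space (leb b)" for x
        using p(2)[of x] e' that by (intro power_mono) (auto simp: norm_minus_commute)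
    qed
    also have "\<dots> = e'\<^sup>2 * sqnorm b (\<lambda>x. 1)"
      unfolding sqnorm_def by (simp add: norm_mult power_mult_distrib)
    also have "\<dots> < e"
    proof -
      have "e'\<^sup>2 * (2 * (1 + sqnorm b (\<lambda>x. 1))) = e"
        using pos sqnorm_nonneg[of b "\<lambda>x. 1"] by (simp add: e'_def)
      moreover have "0 \<le> e'\<^sup>2 * sqnorm b (\<lambda>x. 1)" by (simp add: sqnorm_nonneg)
      moreover have "0 < e'\<^sup>2" using e' by simp
      moreover have "e'\<^sup>2 * (2 * (1 + sqnorm b (\<lambda>x. 1))) = 2 * e'\<^sup>2 + 2 * (e'\<^sup>2 * sqnorm b (\<lambda>x. 1))"
        by (simp add: algebra_simps)
      ultimately show ?thesis by linarith
    qed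
    finally show "\<exists>h. sq_integrable b h \<and> approximable b ?D h \<and> sqnorm b (\<lambda>x. h x - g x) < e"
      using psq poly[OF p(1)] by blast
  qed
  have bdd: "approximable b ?D g" if g: "sq_integrable b g" and B: "\<And>x. norm (g x) \<le> B" "0 \<le> B" for g B
  proof (rule approximable_limit[OF g Dsq])
    fix e :: real assume e: "e > 0"
    have "g measurable_on {0<..<b}"
      using sq_integrable_measurable[OF g] by (simp add: measurable_on_iff_borel_measurable)
    then obtain N h where N: "negligible N" and h: "\<And>n. continuous_on UNIV (h n)"
      and lim: "\<And>x. x \<notin> N \<Longrightarrow> (\<lambda>n. h n x) \<longlonglongrightarrow> (if x \<in> {0<..<b} then g x else 0)"
      unfolding measurable_on_def by (meson)
    \<comment> \<open>The projection onto the disc truncates the continuous approximations without destroying continuity.\<close>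
    let ?T = "closest_point (cball (0::complex) B)"
    have T: "continuous_on UNIV ?T" "\<And>z. norm (?T z) \<le> B" "\<And>z. norm z \<le> B \<Longrightarrow> ?T z = z"
    proof -
      show "continuous_on UNIV ?T"
        using B by (intro continuous_on_closest_point) auto
      show "norm (?T z) \<le> B" for z
        using closest_point_in_set[of "cball (0::complex) B" z] B by auto
      show "?T z = z" if "norm z \<le> B" for z
        using that by (intro closest_point_self) auto
    qed
    define k where "k n = (\<lambda>x. ?T (h n x))" for n
    have kc: "continuous_on {0..b} (k n)" for n
      unfolding k_def
      using continuous_on_compose2[OF T(1) continuous_on_subset[OF h]] by auto
    have ksq: "sq_integrable b (k n)" for n by (rule sq_integrable_continuous[OF kc])
    have "(\<lambda>n. sqnorm b (\<lambda>x. k n x - g x)) \<longlonglongrightarrow> 0"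
    proof (rule sqnorm_dominated_convergence)
      show "sq_integrable b (\<lambda>x. complex_of_real (2 * B))" by (rule sq_integrable_const)
      show "k n \<in> borel_measurable (leb b)" for n by (rule sq_integrable_measurable[OF ksq])
      show "g \<in> borel_measurable (leb b)" by (rule sq_integrable_measurable[OF g])
      have "AE x in lebesgue. x \<notin> N"
        using N by (simp add: eventually_ae_filter_negligible) blast
      then show "AE x in leb b. (\<lambda>n. k n x) \<longlonglongrightarrow> g x"
        unfolding AE_restrict_space_iff[of "{0<..<b}" lebesgue, simplified]
      proof eventually_elim
        case (elim x)
        show ?case
        proof
          assume x: "0 < x \<and> x < b"
          have "(\<lambda>n. ?T (h n x)) \<longlonglongrightarrow> ?T (g x)"
            using lim[OF elim] x T(1)
            by (intro continuous_on_tendsto_compose[OF T(1)]) auto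
          then show "(\<lambda>n. k n x) \<longlonglongrightarrow> g x" by (simp add: k_def T(3) B)
        qed
      qed
      show "AE x in leb b. norm (k n x - g x) \<le> norm (complex_of_real (2 * B))" for n
      proof (rule AE_I2)
        fix x
        have "norm (k n x - g x) \<le> norm (k n x) + norm (g x)" by (rule norm_triangle_ineq4)
        also have "\<dots> \<le> B + B" unfolding k_def by (intro add_mono T B)
        finally show "norm (k n x - g x) \<le> norm (complex_of_real (2 * B))" using B by (simp add: norm_mult)
      qed
    qed
    then obtain n where "sqnorm b (\<lambda>x. k n x - g x) < e"
      using eventually_happens'[OF sequentially_bot order_tendstoD(2)[OF _ e]] by blast
    then show "\<exists>h. sq_integrable b h \<and> approximable b ?D h \<and> sqnorm b (\<lambda>x. h x - g x) < e"
      using ksq cont[OF kc] by blast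
  qed
  show ?thesis
  proof (rule approximable_limit[OF f Dsq])
    fix e :: real assume e: "e > 0"
    define k where "k n = (\<lambda>x. if norm (f x) \<le> real n then f x else 0)" for n
    note [measurable] = sq_integrable_measurable[OF f]
    have km: "k n \<in> borel_measurable (leb b)" for n unfolding k_def by measurable
    have ksq: "sq_integrable b (k n)" for n
      by (rule sq_integrable_dominated[OF km f, of _ 1]) (auto simp: k_def)
    have "(\<lambda>n. sqnorm b (\<lambda>x. k n x - f x)) \<longlonglongrightarrow> 0"
    proof (rule sqnorm_dominated_convergence[OF f km])
      show "f \<in> borel_measurable (leb b)" by measurable
      show "AE x in leb b. (\<lambda>n. k n x) \<longlonglongrightarrow> f x"
      proof (rule AE_I2)
        fix x
        obtain m where m: "norm (f x) \<le> real m" using real_arch_simple by blast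
        have "\<forall>\<^sub>F n in sequentially. k n x = f x"
          by (rule eventually_mono[OF eventually_ge_at_top[of m]]) (use m in \<open>auto simp: k_def\<close>)
        then show "(\<lambda>n. k n x) \<longlonglongrightarrow> f x" by (rule tendsto_eventually)
      qed
    qed (auto simp: k_def)
    then obtain n where "sqnorm b (\<lambda>x. k n x - f x) < e"
      using eventually_happens'[OF sequentially_bot order_tendstoD(2)[OF _ e]] by blast
    moreover have "approximable b ?D (k n)"
      by (rule bdd[OF ksq, of _ "real n"]) (auto simp: k_def)
    ultimately show "\<exists>h. sq_integrable b h \<and> approximable b ?D h \<and> sqnorm b (\<lambda>x. h x - f x) < e"
      using ksq by blast
  qed
qed

section \<open>The Hilbert space \<open>L\<^sup>2(0,b)\<close>\<close>

lemma L2_class_self: "sq_integrable b f \<Longrightarrow> f \<in> L2_class b f"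
  by (simp add: L2_class_def)

lemma L2_rep_class:
  assumes "sq_integrable b f"
  shows "sq_integrable b (L2_rep (L2_class b f))" "AE x in leb b. L2_rep (L2_class b f) x = f x"
proof -
  have "L2_rep (L2_class b f) \<in> L2_class b f"
    unfolding L2_rep_def using someI[of "\<lambda>h. h \<in> L2_class b f", OF L2_class_self[OF assms]] .
  then show "sq_integrable b (L2_rep (L2_class b f))" "AE x in leb b. L2_rep (L2_class b f) x = f x"
    by (auto simp: L2_class_def)
qed

lemma L2_class_cong:
  assumes "AE x in leb b. f x = g x"
  shows "L2_class b f = L2_class b g"
proof -
  have "(AE x in leb b. h x = f x) = (AE x in leb b. h x = g x)" for h :: "real \<Rightarrow> complex"
    by (rule eventually_subst, use assms in eventually_elim) simp
  then show ?thesis by (simp add: L2_class_def)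
qed

lemma L2_class_eq_iff:
  assumes "sq_integrable b f"
  shows "L2_class b f = L2_class b g \<longleftrightarrow> (AE x in leb b. f x = g x)"
proof
  assume "L2_class b f = L2_class b g"
  then have "f \<in> L2_class b g" using L2_class_self[OF assms] by simp
  then show "AE x in leb b. f x = g x" by (simp add: L2_class_def)
qed (rule L2_class_cong)

lemma L2_class_cong_Ioo:
  assumes "\<And>x. 0 < x \<Longrightarrow> x < b \<Longrightarrow> f x = g x"
  shows "L2_class b f = L2_class b g"
  by (rule L2_class_cong, rule AE_I2) (use assms in auto)

lemma L2_class_in_carrier [simp]: "sq_integrable b f \<Longrightarrow> L2_class b f \<in> vcarrier (L2_space b)"
  by (simp add: L2_space_def)

lemma L2_carrierE:
  assumes "F \<in> vcarrier (L2_space b)"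
  obtains f where "sq_integrable b f" "F = L2_class b f"
  using assms by (auto simp: L2_space_def)

lemma L2_carrier_ex: "F \<in> vcarrier (L2_space b) \<Longrightarrow> \<exists>f. sq_integrable b f \<and> F = L2_class b f"
  by (auto simp: L2_space_def)

lemma vzero_L2: "vzero (L2_space b) = L2_class b (\<lambda>x. 0)"
  by (simp add: L2_space_def)

lemma vadd_L2:
  assumes "sq_integrable b f" "sq_integrable b g"
  shows "vadd (L2_space b) (L2_class b f) (L2_class b g) = L2_class b (\<lambda>x. f x + g x)"
proof -
  have "AE x in leb b. L2_rep (L2_class b f) x + L2_rep (L2_class b g) x = f x + g x"
    using L2_rep_class(2)[OF assms(1)] L2_rep_class(2)[OF assms(2)] by eventually_elim simp
  then show ?thesis by (simp add: L2_space_def L2_class_cong)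
qed

lemma vscale_L2:
  assumes "sq_integrable b f"
  shows "vscale (L2_space b) c (L2_class b f) = L2_class b (\<lambda>x. c * f x)"
proof -
  have "AE x in leb b. c * L2_rep (L2_class b f) x = c * f x"
    using L2_rep_class(2)[OF assms] by eventually_elim simp
  then show ?thesis by (simp add: L2_space_def L2_class_cong)
qed

lemma vinner_L2:
  assumes "sq_integrable b f" "sq_integrable b g"
  shows "vinner (L2_space b) (L2_class b f) (L2_class b g) = sqinner b f g"
proof -
  note [measurable] = sq_integrable_measurable[OF assms(1)] sq_integrable_measurable[OF assms(2)]
    sq_integrable_measurable[OF sq_integrable_cnj[OF assms(2)]]
    sq_integrable_measurable[OF L2_rep_class(1)[OF assms(1)]]
    sq_integrable_measurable[OF sq_integrable_cnj[OF L2_rep_class(1)[OF assms(2)]]]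
  have "(LINT x|leb b. L2_rep (L2_class b f) x * cnj (L2_rep (L2_class b g) x)) = (LINT x|leb b. f x * cnj (g x))"
  proof (rule integral_cong_AE)
    show "AE x in leb b. L2_rep (L2_class b f) x * cnj (L2_rep (L2_class b g) x) = f x * cnj (g x)"
      using L2_rep_class(2)[OF assms(1)] L2_rep_class(2)[OF assms(2)]
      by eventually_elim simp
  qed measurable
  then show ?thesis by (simp add: L2_space_def sqinner_def)
qed

lemma vdiff_L2:
  assumes "sq_integrable b f" "sq_integrable b g"
  shows "vdiff (L2_space b) (L2_class b f) (L2_class b g) = L2_class b (\<lambda>x. f x - g x)"
  using vadd_L2[OF assms(1) sq_integrable_scale[OF assms(2), of "-1"]]
  by (simp add: vdiff_def vscale_L2 assms)

lemma vnorm_L2: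
  assumes "sq_integrable b f"
  shows "vnorm (L2_space b) (L2_class b f) = sqrt (sqnorm b f)"
  using assms by (simp add: vnorm_def vinner_L2 sqinner_self)

lemmas L2_ops = vadd_L2 vscale_L2 vinner_L2 vdiff_L2 vnorm_L2 vzero_L2

lemmas sq_intros = sq_integrable_add sq_integrable_scale sq_integrable_diff sq_integrable_zero

text \<open>
The algebraic axioms are identities between functions once the chosen representatives have been replaced by
functions that agree with them almost everywhere; completeness is the Riesz-Fischer theorem.
\<close>

lemma hilbert_space_L2: "hilbert_space (L2_space b)"
proof
  let ?X = "L2_space b"
  show "vzero ?X \<in> vcarrier ?X" by (simp add: vzero_L2 sq_integrable_zero)
  show "vadd ?X f g \<in> vcarrier ?X" if "f \<in> vcarrier ?X" "g \<in> vcarrier ?X" for f g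
    using that by (elim L2_carrierE) (simp add: L2_ops sq_intros)
  show "vscale ?X c f \<in> vcarrier ?X" if "f \<in> vcarrier ?X" for f c
    using that by (elim L2_carrierE) (simp add: L2_ops sq_intros)
  show "vadd ?X (vadd ?X f g) h = vadd ?X f (vadd ?X g h)"
    if "f \<in> vcarrier ?X" "g \<in> vcarrier ?X" "h \<in> vcarrier ?X" for f g h
    using that by (elim L2_carrierE) (simp add: L2_ops sq_intros add.assoc)
  show "vadd ?X f g = vadd ?X g f" if "f \<in> vcarrier ?X" "g \<in> vcarrier ?X" for f g
    using that by (elim L2_carrierE) (simp add: L2_ops sq_intros add.commute)
  show "vadd ?X f (vzero ?X) = f" if "f \<in> vcarrier ?X" for f
    using that by (elim L2_carrierE) (simp add: L2_ops sq_intros)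
  show "vadd ?X f (vscale ?X (-1) f) = vzero ?X" if fX: "f \<in> vcarrier ?X" for f
  proof -
    obtain g where g: "sq_integrable b g" "f = L2_class b g" using fX by (rule L2_carrierE)
    show ?thesis
      using vdiff_L2[OF g(1) g(1)] by (simp add: vdiff_def g vzero_L2)
  qed
  show "vscale ?X 1 f = f" if "f \<in> vcarrier ?X" for f
    using that by (elim L2_carrierE) (simp add: L2_ops sq_intros)
  show "vscale ?X c (vscale ?X d f) = vscale ?X (c * d) f" if "f \<in> vcarrier ?X" for f c d
    using that by (elim L2_carrierE) (simp add: L2_ops sq_intros mult.assoc)
  show "vscale ?X c (vadd ?X f g) = vadd ?X (vscale ?X c f) (vscale ?X c g)"
    if "f \<in> vcarrier ?X" "g \<in> vcarrier ?X" for f g c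
    using that by (elim L2_carrierE) (simp add: L2_ops sq_intros distrib_left)
  show "vscale ?X (c + d) f = vadd ?X (vscale ?X c f) (vscale ?X d f)" if "f \<in> vcarrier ?X" for f c d
    using that by (elim L2_carrierE) (simp add: L2_ops sq_intros distrib_right)
  show "vinner ?X (vadd ?X f g) h = vinner ?X f h + vinner ?X g h"
    if "f \<in> vcarrier ?X" "g \<in> vcarrier ?X" "h \<in> vcarrier ?X" for f g h
    using that by (elim L2_carrierE) (simp add: L2_ops sq_intros sqinner_add)
  show "vinner ?X (vscale ?X c f) g = c * vinner ?X f g"
    if "f \<in> vcarrier ?X" "g \<in> vcarrier ?X" for f g c
    using that by (elim L2_carrierE) (simp add: L2_ops sq_intros sqinner_scale)
  show "vinner ?X g f = cnj (vinner ?X f g)"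
    if "f \<in> vcarrier ?X" "g \<in> vcarrier ?X" for f g
    using that by (elim L2_carrierE) (simp add: L2_ops sq_intros, rule sqinner_commute)
  show "0 \<le> Re (vinner ?X f f)" if "f \<in> vcarrier ?X" for f
    using that by (elim L2_carrierE) (simp add: L2_ops sqinner_self sqnorm_nonneg)
  show "f = vzero ?X" if fX: "f \<in> vcarrier ?X" and f0: "vinner ?X f f = 0" for f
  proof -
    obtain g where g: "sq_integrable b g" "f = L2_class b g" using fX by (rule L2_carrierE)
    then have "AE x in leb b. g x = 0" using f0 by (simp add: vinner_L2 sqinner_self sqnorm_eq_0)
    then show ?thesis unfolding g(2) vzero_L2 by (rule L2_class_cong)
  qed
  show "\<exists>f\<in>vcarrier ?X. vconverges ?X s f" if s: "range s \<subseteq> vcarrier ?X" and c: "vcauchy ?X s" for s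
  proof -
    have "\<forall>n. \<exists>g. sq_integrable b g \<and> s n = L2_class b g"
    proof
      fix n
      have "s n \<in> vcarrier ?X" using s by auto
      then show "\<exists>g. sq_integrable b g \<and> s n = L2_class b g" by (rule L2_carrier_ex)
    qed
    then obtain g where g: "\<And>n. sq_integrable b (g n)" "\<And>n. s n = L2_class b (g n)" by metis
    have "\<exists>N. \<forall>m\<ge>N. \<forall>n\<ge>N. sqnorm b (\<lambda>x. g m x - g n x) < e" if epos: "e > 0" for e
    proof -
      obtain N where "\<forall>m\<ge>N. \<forall>n\<ge>N. vnorm ?X (vdiff ?X (s m) (s n)) < sqrt e"
        using c real_sqrt_gt_zero[OF epos] unfolding vcauchy_def by meson
      then show ?thesis by (auto simp: g L2_ops sq_intros)
    qed
    from sq_integrable_complete[OF g(1) this] obtain f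
      where f: "sq_integrable b f" "(\<lambda>n. sqnorm b (\<lambda>x. g n x - f x)) \<longlonglongrightarrow> 0" by blast
    have "(\<lambda>n. sqrt (sqnorm b (\<lambda>x. g n x - f x))) \<longlonglongrightarrow> sqrt 0"
      by (intro tendsto_intros f)
    then have "vconverges ?X s (L2_class b f)"
      by (simp add: vconverges_def g f L2_ops sq_intros)
    then show ?thesis using f(1) by (intro bexI[of _ "L2_class b f"]) auto
  qed
qed

lemma hilbert_space_complex: "hilbert_space complex_space"
proof
  show "\<exists>f\<in>vcarrier complex_space. vconverges complex_space s f"
    if "vcauchy complex_space s" for s
  proof -
    have n: "vnorm complex_space (vdiff complex_space z w) = dist z w" for z w
    proof -
      have "vnorm complex_space (vdiff complex_space z w) = sqrt (Re ((z - w) * cnj (z - w)))"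
        by (simp add: vnorm_def vdiff_def complex_space_def)
      also have "\<dots> = dist z w"
        by (simp only: complex_norm_square[symmetric] Re_complex_of_real real_sqrt_abs abs_norm_cancel dist_norm)
      finally show ?thesis .
    qed
    have "Cauchy s"
      by (rule metric_CauchyI) (use that in \<open>simp add: vcauchy_def n\<close>)
    then obtain l where "s \<longlonglongrightarrow> l" using convergent_eq_Cauchy by blast
    then have "vconverges complex_space s l"
      unfolding vconverges_def n by (rule iffD1[OF tendsto_dist_iff])
    then show ?thesis by (intro bexI[of _ l]) (simp_all add: complex_space_def)
  qed
qed (auto simp: complex_space_def distrib_left distrib_right)

text \<open>
The relation that defines the adjoint is preserved under limits, since the inner product is continuous
in its second argument.
\<close>

lemma closed_adjoint_L2:
  assumes T: "T \<subseteq> vcarrier (L2_space b) \<times> vcarrier (L2_space b)"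
  shows "closed_operator (L2_space b) (adjoint_op (L2_space b) T)"
  unfolding closed_operator_def
proof (intro allI ballI impI)
  let ?X = "L2_space b"
  fix s t F H
  assume F: "F \<in> vcarrier ?X" and H: "H \<in> vcarrier ?X"
    and a: "(\<forall>n. (s n, t n) \<in> adjoint_op ?X T) \<and> vconverges ?X s F \<and> vconverges ?X t H"
  have conv1: "vconverges ?X s F" and conv2: "vconverges ?X t H" using a by auto
  obtain f where f: "sq_integrable b f" "F = L2_class b f" using F by (rule L2_carrierE)
  obtain h where h: "sq_integrable b h" "H = L2_class b h" using H by (rule L2_carrierE)
  have *: "\<forall>n. \<exists>g. sq_integrable b g \<and> s n = L2_class b g" "\<forall>n. \<exists>g. sq_integrable b g \<and> t n = L2_class b g"
  proof -
    have "s n \<in> vcarrier ?X \<and> t n \<in> vcarrier ?X" for n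
      using a by (auto simp: adjoint_op_def)
    then show "\<forall>n. \<exists>g. sq_integrable b g \<and> s n = L2_class b g" "\<forall>n. \<exists>g. sq_integrable b g \<and> t n = L2_class b g"
      using L2_carrier_ex by blast+
  qed
  from *(1) obtain sf where sf: "\<And>n. sq_integrable b (sf n)" "\<And>n. s n = L2_class b (sf n)" by metis
  from *(2) obtain tf where tf: "\<And>n. sq_integrable b (tf n)" "\<And>n. t n = L2_class b (tf n)" by metis
  have cont: "(\<lambda>n. sqinner b p (q n)) \<longlonglongrightarrow> sqinner b p q0"
    if "sq_integrable b p" "\<And>n. sq_integrable b (q n)" "sq_integrable b q0"
      "(\<lambda>n. sqrt (sqnorm b (\<lambda>x. q n x - q0 x))) \<longlonglongrightarrow> 0" for p q q0
  proof -
    have "(\<lambda>n. sqinner b p (q n) - sqinner b p q0) \<longlonglongrightarrow> 0"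
    proof (rule Lim_null_comparison)
      show "\<forall>\<^sub>F n in sequentially. norm (sqinner b p (q n) - sqinner b p q0)
           \<le> sqrt (sqnorm b p) * sqrt (sqnorm b (\<lambda>x. q n x - q0 x))"
      proof (rule always_eventually, rule allI)
        fix n
        show "norm (sqinner b p (q n) - sqinner b p q0) \<le> sqrt (sqnorm b p) * sqrt (sqnorm b (\<lambda>x. q n x - q0 x))"
          using norm_sqinner_le[OF that(1) sq_integrable_diff[OF that(2) that(3)], of n]
          by (simp add: sqinner_diff_right that)
      qed
      show "(\<lambda>n. sqrt (sqnorm b p) * sqrt (sqnorm b (\<lambda>x. q n x - q0 x))) \<longlonglongrightarrow> 0"
        by (rule tendsto_mult_right_zero[OF that(4)])
    qed
    then show ?thesis by (simp add: LIM_zero_iff)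
  qed
  show "(F, H) \<in> adjoint_op ?X T"
    unfolding adjoint_op_def
  proof (safe intro!: F H)
    fix P P' assume P: "(P, P') \<in> T"
    then have "P \<in> vcarrier ?X" "P' \<in> vcarrier ?X" using T by auto
    then obtain p p' where p: "sq_integrable b p" "P = L2_class b p" "sq_integrable b p'" "P' = L2_class b p'"
      using L2_carrier_ex by blast
    have "sqinner b p' (sf n) = sqinner b p (tf n)" for n
    proof -
      have "(s n, t n) \<in> adjoint_op ?X T" using a by blast
      then have "vinner ?X P' (s n) = vinner ?X P (t n)" using P by (auto simp: adjoint_op_def)
      then show ?thesis by (simp add: p sf tf vinner_L2)
    qed
    moreover have "(\<lambda>n. sqinner b p' (sf n)) \<longlonglongrightarrow> sqinner b p' f"
      by (rule cont[OF p(3) sf(1) f(1)]) (use conv1 in \<open>simp add: vconverges_def sf f L2_ops sq_intros\<close>)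
    moreover have "(\<lambda>n. sqinner b p (tf n)) \<longlonglongrightarrow> sqinner b p h"
      by (rule cont[OF p(1) tf(1) h(1)]) (use conv2 in \<open>simp add: vconverges_def tf h L2_ops sq_intros\<close>)
    ultimately have "sqinner b p' f = sqinner b p h"
      using LIMSEQ_unique by simp
    then show "vinner ?X P' F = vinner ?X P H" by (simp add: p f h vinner_L2)
  qed
qed

section \<open>Hardy's inequality\<close>

lemma nn_integral_leb_Ioo:
  fixes f :: "real \<Rightarrow> real"
  assumes "\<And>x. x \<in> {c<..<d} \<Longrightarrow> 0 \<le> f x" "(f has_integral r) {c..d}" "0 \<le> c" "d \<le> b"
  shows "(\<integral>\<^sup>+x. ennreal (f x) * indicator {c<..<d} x \<partial>leb b) = ennreal r"
proof -
  have "(\<integral>\<^sup>+x. ennreal (f x) * indicator {c<..<d} x \<partial>leb b)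
    = (\<integral>\<^sup>+x. ennreal (f x) * indicator {c<..<d} x * indicator {0<..<b} x \<partial>lebesgue)"
    by (rule nn_integral_restrict_space) auto
  also have "\<dots> = (\<integral>\<^sup>+x. ennreal (f x) * indicator {c<..<d} x \<partial>lebesgue)"
    by (rule nn_integral_cong) (use assms in \<open>auto simp: indicator_def\<close>)
  also have "\<dots> = (\<integral>\<^sup>+x. ennreal (f x) * indicator {c<..<d} x \<partial>lborel)"
    by (rule nn_integral_completion)
  also have "\<dots> = ennreal r"
    by (rule nn_integral_has_integral_lebesgue') (use assms in \<open>auto simp: has_integral_Icc_iff_Ioo\<close>)
  finally show ?thesis .
qed

lemma powr_measurable_leb [measurable]: "(\<lambda>x. x powr p) \<in> borel_measurable (leb b)"
  by (intro measurable_restrict_space1 measurable_completion) measurable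

lemma sq_integrable_powr:
  fixes p :: real
  assumes "p > -1/2" "0 < b"
  shows "sq_integrable b (\<lambda>x. complex_of_real (x powr p))"
proof -
  have "(\<lambda>x. x powr (2 * p)) integrable_on {0..b}"
    by (rule integrable_on_powr_from_0) (use assms in auto)
  then have "(\<lambda>x. x powr (2 * p)) absolutely_integrable_on {0..b}"
    by (rule nonnegative_absolutely_integrable_1) auto
  then have "(\<lambda>x. x powr (2 * p)) absolutely_integrable_on {0<..<b}"
    using absolutely_integrable_on_open_interval[where f="\<lambda>x. x powr (2 * p)" and a=0 and b=b] by simp
  then have "integrable (leb b) (\<lambda>x. x powr (2 * p))"
    by (simp add: integrable_restrict_space set_integrable_def)
  then have "integrable (leb b) (\<lambda>x. (norm (complex_of_real (x powr p)))\<^sup>2)"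
    by (rule iffD1[OF Bochner_Integration.integrable_cong, rotated -1])
      (auto simp: power2_eq_square powr_add[symmetric])
  then show ?thesis
    by (simp add: sq_integrable_def)
qed

lemma powr_mult_sq_integrable:
  assumes "p > -1/2" "0 < b" "sq_integrable b h" "0 \<le> x" "x \<le> b"
  shows "(\<lambda>t. t powr p * norm (h t)) integrable_on {0..x}"
proof -
  have "(\<lambda>t. complex_of_real (t powr p) * h t) absolutely_integrable_on {0..b}"
    by (intro absolutely_integrable_mult_sq sq_integrable_powr assms)
  then have "(\<lambda>t. complex_of_real (t powr p) * h t) absolutely_integrable_on {0..x}"
    by (rule absolutely_integrable_on_subinterval) (use assms in auto)
  then have "(\<lambda>t. norm (complex_of_real (t powr p) * h t)) integrable_on {0..x}"
    by (simp add: absolutely_integrable_on_def)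
  then show ?thesis by (simp add: norm_mult)
qed

text \<open>
The integral over \<open>x\<close> that remains in Hardy's inequality after the order of integration is exchanged.
\<close>

lemma nn_integral_power_tail:
  assumes "a < 1" "0 < t" "t < b"
  shows "(\<integral>\<^sup>+x. ennreal (x powr (a - 2)) * indicator {t<..<b} x \<partial>leb b) \<le> ennreal (t powr (a - 1) / (1 - a))"
proof -
  have "((\<lambda>x. x powr (a - 2)) has_integral (b powr (a - 1) / (a - 1) - t powr (a - 1) / (a - 1))) {t..b}"
  proof (rule fundamental_theorem_of_calculus)
    show "((\<lambda>x. x powr (a - 1) / (a - 1)) has_vector_derivative x powr (a - 2)) (at x within {t..b})"
      if "x \<in> {t..b}" for x
    proof -
      have "((\<lambda>x. x powr (a - 1) / (a - 1)) has_real_derivative (a - 1) * x powr (a - 1 - 1) / (a - 1)) (at x)"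
        by (intro DERIV_cdivide has_real_derivative_powr) (use that assms in auto)
      then have "((\<lambda>x. x powr (a - 1) / (a - 1)) has_real_derivative x powr (a - 2)) (at x)"
        using assms by simp
      then show ?thesis
        unfolding has_real_derivative_iff_has_vector_derivative[symmetric]
        by (rule has_field_derivative_at_within)
    qed
  qed (use assms in auto)
  then have "(\<integral>\<^sup>+x. ennreal (x powr (a - 2)) * indicator {t<..<b} x \<partial>leb b)
     = ennreal (b powr (a - 1) / (a - 1) - t powr (a - 1) / (a - 1))"
    by (intro nn_integral_leb_Ioo) (use assms in auto)
  also have "\<dots> \<le> ennreal (t powr (a - 1) / (1 - a))"
  proof (rule ennreal_leI)
    have "b powr (a - 1) / (a - 1) \<le> 0" using assms by (simp add: divide_nonneg_neg)
    moreover have "- (t powr (a - 1) / (a - 1)) = t powr (a - 1) / (1 - a)"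
      by (metis minus_diff_eq minus_divide_right)
    ultimately show "b powr (a - 1) / (a - 1) - t powr (a - 1) / (a - 1) \<le> t powr (a - 1) / (1 - a)" by simp
  qed
  finally show ?thesis .
qed

text \<open>
The kernel \<open>x\<^sup>a\<^sup>-\<^sup>3\<^sup>/\<^sup>2 t\<^sup>1\<^sup>/\<^sup>2\<^sup>-\<^sup>a\<close> on \<open>t < x\<close> is homogeneous of degree \<open>-1\<close>, so Schur's test applies. The
Cauchy-Schwarz inequality with weight \<open>t\<^sup>-\<^sup>a\<close> bounds the square of the inner integral by
\<open>x\<^sup>1\<^sup>-\<^sup>a / (1 - a)\<close> times the integral of \<open>t\<^sup>1\<^sup>-\<^sup>a \<bar>h\<bar>\<^sup>2\<close>; exchanging the integrations then leaves a
convergent power integral in \<open>x\<close>. Both integrals of powers converge exactly because \<open>a < 1\<close>.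
\<close>

lemma hardy_inequality:
  fixes a b C :: real
  assumes a: "a < 1" and b: "0 < b" and h: "sq_integrable b h"
    and fm: "f \<in> borel_measurable (leb b)"
    and bound: "\<And>x. 0 < x \<Longrightarrow> x < b \<Longrightarrow>
      norm (f x) \<le> C * (x powr (a - 3/2) * integral {0..x} (\<lambda>t. t powr (1/2 - a) * norm (h t)))"
  shows "sq_integrable b f"
proof -
  let ?M = "leb b"
  interpret F: finite_measure ?M by (rule finite_measure_leb)
  interpret P: pair_sigma_finite ?M ?M ..
  note [measurable] = sq_integrable_measurable[OF h] fm
  have id [measurable]: "(\<lambda>x::real. x) \<in> borel_measurable ?M"
    by (intro measurable_restrict_space1 measurable_completion) measurable
  define H where "H x = integral {0..x} (\<lambda>t. t powr (1/2 - a) * norm (h t))" for x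
  \<comment> \<open>The weight that remains next to \<open>\<bar>h\<bar>\<^sup>2\<close> after the Cauchy-Schwarz inequality with \<open>t\<^sup>-\<^sup>a\<close>.\<close>
  define w where "w t = ennreal (t powr (1 - a)) * (ennreal (norm (h t)))\<^sup>2" for t
  have wm [measurable]: "w \<in> borel_measurable ?M" unfolding w_def by measurable
  have Hm [measurable]: "H \<in> borel_measurable ?M"
  proof -
    have "continuous_on {0..b} H"
      unfolding H_def
      by (intro indefinite_integral_continuous_1 powr_mult_sq_integrable) (use a b h in auto)
    then have "continuous_on {0<..<b} H" by (rule continuous_on_subset) auto
    then show ?thesis by (rule continuous_imp_measurable_on_sets_lebesgue) auto
  qed
  have H0: "0 \<le> H x" if "0 < x" "x < b" for x
    unfolding H_def
    by (rule integral_nonneg[OF powr_mult_sq_integrable]) (use a b h that in auto)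
  have Hsq: "ennreal ((H x)\<^sup>2) \<le> ennreal (x powr (1 - a) / (1 - a)) * (\<integral>\<^sup>+t. w t * indicator {..<x} t \<partial>?M)"
    if x: "0 < x" "x < b" for x
  proof -
    let ?i = "indicator {0<..<x} :: real \<Rightarrow> ennreal"
    have "((\<lambda>t. t powr (1/2 - a) * norm (h t)) has_integral H x) {0..x}"
      unfolding H_def
      by (rule integrable_integral[OF powr_mult_sq_integrable]) (use a b h x in auto)
    then have "ennreal (H x) = (\<integral>\<^sup>+t. ennreal (t powr (1/2 - a) * norm (h t)) * ?i t \<partial>?M)"
      by (subst nn_integral_leb_Ioo) (use x in auto)
    also have "\<dots> = (\<integral>\<^sup>+t. (ennreal (t powr (-a/2)) * ?i t) * (ennreal (t powr ((1 - a)/2) * norm (h t)) * ?i t) \<partial>?M)"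
    proof (rule nn_integral_cong)
      fix t
      have "1/2 - a = -a/2 + (1 - a)/2" by (simp add: field_simps)
      then have "t powr (1/2 - a) = t powr (-a/2) * t powr ((1 - a)/2)"
        by (simp only: powr_add)
      then show "ennreal (t powr (1/2 - a) * norm (h t)) * ?i t =
         (ennreal (t powr (-a/2)) * ?i t) * (ennreal (t powr ((1 - a)/2) * norm (h t)) * ?i t)"
        by (simp add: indicator_def ennreal_mult mult.assoc)
    qed
    finally have "(ennreal (H x))\<^sup>2 \<le> (\<integral>\<^sup>+t. (ennreal (t powr (-a/2)) * ?i t)\<^sup>2 \<partial>?M) *
        (\<integral>\<^sup>+t. (ennreal (t powr ((1 - a)/2) * norm (h t)) * ?i t)\<^sup>2 \<partial>?M)"
      using Cauchy_Schwarz_nn_integral[of "\<lambda>t. ennreal (t powr (-a/2)) * ?i t" ?M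
          "\<lambda>t. ennreal (t powr ((1 - a)/2) * norm (h t)) * ?i t"]
      by simp
    also have "(\<integral>\<^sup>+t. (ennreal (t powr (-a/2)) * ?i t)\<^sup>2 \<partial>?M) = (\<integral>\<^sup>+t. ennreal (t powr (-a)) * ?i t \<partial>?M)"
      by (rule nn_integral_cong)
        (auto simp: indicator_def ennreal_power power2_eq_square powr_add[symmetric] ennreal_mult[symmetric])
    also have "\<dots> = ennreal (x powr (1 - a) / (1 - a))"
      using has_integral_powr_from_0[of "-a" x] a x by (intro nn_integral_leb_Ioo) auto
    also have "(\<integral>\<^sup>+t. (ennreal (t powr ((1 - a)/2) * norm (h t)) * ?i t)\<^sup>2 \<partial>?M) = (\<integral>\<^sup>+t. w t * indicator {..<x} t \<partial>?M)"
    proof (rule nn_integral_cong)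
      fix t assume "t \<in> space ?M"
      then have "t > 0" by simp
      moreover have "(t powr ((1 - a)/2))\<^sup>2 = t powr (1 - a)"
        by (simp add: power2_eq_square powr_add[symmetric])
      ultimately show "(ennreal (t powr ((1 - a)/2) * norm (h t)) * ?i t)\<^sup>2 = w t * indicator {..<x} t"
        by (simp add: indicator_def w_def ennreal_power power_mult_distrib ennreal_mult)
    qed
    finally show ?thesis using H0[OF x] by (simp add: ennreal_power)
  qed
  define F where "F = (\<lambda>x t. ennreal (x powr (a - 2)) * (w t * indicator {..<x} t))"
  have Fm: "(\<lambda>z. F (fst z) (snd z)) \<in> borel_measurable (?M \<Otimes>\<^sub>M ?M)"
  proof -
    have [measurable]: "(\<lambda>z. fst z) \<in> borel_measurable (?M \<Otimes>\<^sub>M ?M)" "(\<lambda>z. snd z) \<in> borel_measurable (?M \<Otimes>\<^sub>M ?M)"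
      by (rule measurable_compose[OF measurable_fst id], rule measurable_compose[OF measurable_snd id])
    have [measurable]: "(\<lambda>z. w (snd z)) \<in> borel_measurable (?M \<Otimes>\<^sub>M ?M)"
      by (rule measurable_compose[OF measurable_snd wm])
    have "(\<lambda>z. ennreal (fst z powr (a - 2)) * (w (snd z) * (if snd z < fst z then 1 else 0))) \<in> borel_measurable (?M \<Otimes>\<^sub>M ?M)"
      by measurable
    then show ?thesis by (simp add: F_def indicator_def)
  qed
  have pw: "(x powr (a - 3/2))\<^sup>2 * (x powr (1 - a)) = x powr (a - 2)" for x
    by (simp add: power2_eq_square powr_add[symmetric])
  have "(\<integral>\<^sup>+x. ennreal ((x powr (a - 3/2) * H x)\<^sup>2) \<partial>?M)
      \<le> (\<integral>\<^sup>+x. ennreal (1 / (1 - a)) * (\<integral>\<^sup>+t. F x t \<partial>?M) \<partial>?M)"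
  proof (rule nn_integral_mono)
    fix x assume "x \<in> space ?M"
    then have x: "0 < x" "x < b" by auto
    have "ennreal ((x powr (a - 3/2) * H x)\<^sup>2) = ennreal ((x powr (a - 3/2))\<^sup>2) * ennreal ((H x)\<^sup>2)"
      by (simp add: power_mult_distrib ennreal_mult)
    also have "\<dots> \<le> ennreal ((x powr (a - 3/2))\<^sup>2) * (ennreal (x powr (1 - a) / (1 - a)) * (\<integral>\<^sup>+t. w t * indicator {..<x} t \<partial>?M))"
      by (intro mult_left_mono Hsq x) auto
    also have "\<dots> = (ennreal ((x powr (a - 3/2))\<^sup>2 * x powr (1 - a)) * ennreal (1 / (1 - a))) * (\<integral>\<^sup>+t. w t * indicator {..<x} t \<partial>?M)"
      using a by (simp add: ennreal_mult[symmetric] mult.assoc[symmetric])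
    also have "\<dots> = ennreal (1 / (1 - a)) * (ennreal (x powr (a - 2)) * (\<integral>\<^sup>+t. w t * indicator {..<x} t \<partial>?M))"
      unfolding pw by (simp add: ac_simps)
    also have "ennreal (x powr (a - 2)) * (\<integral>\<^sup>+t. w t * indicator {..<x} t \<partial>?M) =
       (\<integral>\<^sup>+t. F x t \<partial>?M)"
      unfolding F_def by (rule nn_integral_cmult[symmetric]) measurable
    finally show "ennreal ((x powr (a - 3/2) * H x)\<^sup>2) \<le>
      ennreal (1 / (1 - a)) * (\<integral>\<^sup>+t. F x t \<partial>?M)" .
  qed
  also have "\<dots> = ennreal (1 / (1 - a)) * (\<integral>\<^sup>+x. (\<integral>\<^sup>+t. F x t \<partial>?M) \<partial>?M)"
    using F.borel_measurable_nn_integral[of "\<lambda>x t. F x t" ?M] Fm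
    by (intro nn_integral_cmult) (simp add: case_prod_beta')
  also have "(\<integral>\<^sup>+x. (\<integral>\<^sup>+t. F x t \<partial>?M) \<partial>?M)
     = (\<integral>\<^sup>+t. (\<integral>\<^sup>+x. F x t \<partial>?M) \<partial>?M)"
    using P.Fubini'[of F] Fm by (simp add: case_prod_beta')
  also have "\<dots> \<le> (\<integral>\<^sup>+t. ennreal (1 / (1 - a)) * (ennreal (norm (h t)))\<^sup>2 \<partial>?M)"
  proof (rule nn_integral_mono)
    fix t assume "t \<in> space ?M"
    then have t: "0 < t" "t < b" by auto
    have "(\<integral>\<^sup>+x. F x t \<partial>?M)
       = (\<integral>\<^sup>+x. w t * (ennreal (x powr (a - 2)) * indicator {t<..<b} x) \<partial>?M)"
      by (rule nn_integral_cong) (auto simp: F_def indicator_def mult.commute)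
    also have "\<dots> = w t * (\<integral>\<^sup>+x. ennreal (x powr (a - 2)) * indicator {t<..<b} x \<partial>?M)"
      by (rule nn_integral_cmult) measurable
    also have "\<dots> \<le> w t * ennreal (t powr (a - 1) / (1 - a))"
      by (intro mult_left_mono nn_integral_power_tail a t) auto
    also have "\<dots> = (ennreal (t powr (1 - a) * (t powr (a - 1) / (1 - a)))) * (ennreal (norm (h t)))\<^sup>2"
      unfolding w_def using a
      by (subst ennreal_mult[of "t powr (1 - a)" "t powr (a - 1) / (1 - a)"]) (auto simp: ac_simps)
    also have "t powr (1 - a) * (t powr (a - 1) / (1 - a)) = 1 / (1 - a)"
      using t by (simp add: powr_add[symmetric])
    finally show "(\<integral>\<^sup>+x. F x t \<partial>?M)
       \<le> ennreal (1 / (1 - a)) * (ennreal (norm (h t)))\<^sup>2" .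
  qed
  also have "\<dots> = ennreal (1 / (1 - a)) * ennreal (sqnorm b h)"
    by (subst nn_integral_cmult) (auto simp: nn_sqnorm[OF h])
  finally have "(\<integral>\<^sup>+x. ennreal ((x powr (a - 3/2) * H x)\<^sup>2) \<partial>?M) \<le>
     ennreal (1 / (1 - a)) * (ennreal (1 / (1 - a)) * ennreal (sqnorm b h))"
    by (simp add: mult_left_mono)
  also have "\<dots> < \<infinity>" by (simp add: ennreal_mult_less_top)
  finally have fin: "(\<integral>\<^sup>+x. ennreal ((x powr (a - 3/2) * H x)\<^sup>2) \<partial>?M) < \<infinity>" .
  have "(\<integral>\<^sup>+x. ennreal ((norm (f x))\<^sup>2) \<partial>?M) \<le> (\<integral>\<^sup>+x. ennreal (C\<^sup>2 * (x powr (a - 3/2) * H x)\<^sup>2) \<partial>?M)"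
  proof (intro nn_integral_mono ennreal_leI)
    fix x assume "x \<in> space ?M"
    then have "norm (f x) \<le> C * (x powr (a - 3/2) * H x)" using bound[of x] by (auto simp: H_def)
    then have "(norm (f x))\<^sup>2 \<le> (C * (x powr (a - 3/2) * H x))\<^sup>2" by (intro power_mono) auto
    then show "(norm (f x))\<^sup>2 \<le> C\<^sup>2 * (x powr (a - 3/2) * H x)\<^sup>2" by (simp only: power_mult_distrib)
  qed
  also have "\<dots> = ennreal (C\<^sup>2) * (\<integral>\<^sup>+x. ennreal ((x powr (a - 3/2) * H x)\<^sup>2) \<partial>?M)"
    by (subst nn_integral_cmult[symmetric]) (auto simp: ennreal_mult)
  also have "\<dots> < \<infinity>" using fin by (simp add: ennreal_mult_less_top)
  finally have "integrable ?M (\<lambda>x. (norm (f x))\<^sup>2)"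
    by (intro integrableI_nonneg) auto
  then show ?thesis using fm by (simp add: sq_integrable_def)
qed

section \<open>The solutions of the homogeneous equation\<close>

locale bessel_setting =
  fixes \<nu> b :: real
  assumes nu_nonneg: "0 \<le> \<nu>" and nu_less: "\<nu> < 1" and b_pos: "0 < b"
begin

abbreviation "X \<equiv> L2_space b"
abbreviation "Amin \<equiv> bessel_operator \<nu> b"
abbreviation "Amax \<equiv> adjoint_op X Amin"
abbreviation "\<Gamma>0 \<equiv> bessel_Gamma0 \<nu> b"
abbreviation "\<Gamma>1 \<equiv> bessel_Gamma1 \<nu> b"

text \<open>
Two solutions of \<open>f'' = q f\<close> and their derivatives. The factor \<open>- 1 / (2 \<nu>)\<close> in \<open>solv\<close> makes the Wronskian
equal to \<open>1\<close> in both cases, and with it the second boundary map is the bracket with \<open>solv\<close> for every \<open>\<nu>\<close>.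
\<close>

definition solu :: "real \<Rightarrow> real" where "solu x = x powr (1/2 + \<nu>)"
definition solu' :: "real \<Rightarrow> real" where "solu' x = (1/2 + \<nu>) * x powr (\<nu> - 1/2)"
definition solv :: "real \<Rightarrow> real" where
  "solv x = (if \<nu> = 0 then x powr (1/2) * ln x else - (x powr (1/2 - \<nu>) / (2 * \<nu>)))"
definition solv' :: "real \<Rightarrow> real" where
  "solv' x = (if \<nu> = 0 then x powr (-1/2) * (ln x / 2 + 1) else - ((1/2 - \<nu>) * x powr (-1/2 - \<nu>) / (2 * \<nu>)))"
definition pot :: "real \<Rightarrow> real" where "pot x = (\<nu>\<^sup>2 - 1/4) / x\<^sup>2"
text \<open>
An exponent with \<open>solv(x) = O(x\<^sup>1\<^sup>/\<^sup>2\<^sup>-\<^sup>s)\<close> for \<open>s = sing\<close>. For \<open>\<nu> = 0\<close> any small positive number absorbs the logarithm;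
\<open>1/4\<close> is a choice below \<open>1/2\<close>.
\<close>

definition sing :: real where "sing = (if \<nu> = 0 then 1/4 else \<nu>)"

lemma sing_bounds: "0 < sing" "sing < 1" "sing < 1/2 + \<nu>" "\<nu> \<le> sing"
  using nu_nonneg nu_less by (auto simp: sing_def)

lemma solu_deriv:
  assumes "0 < x" shows "(solu has_real_derivative solu' x) (at x)"
proof -
  have "((\<lambda>x. x powr (1/2 + \<nu>)) has_real_derivative (1/2 + \<nu>) * x powr (1/2 + \<nu> - 1)) (at x)"
    using assms by (rule has_real_derivative_powr)
  moreover have "1/2 + \<nu> - 1 = \<nu> - 1/2" by simp
  ultimately show ?thesis by (simp only: solu_def[abs_def] solu'_def)
qed

lemma solu'_deriv:
  assumes "0 < x" shows "(solu' has_real_derivative pot x * solu x) (at x)"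
proof -
  have "((\<lambda>x. (1/2 + \<nu>) * x powr (\<nu> - 1/2)) has_real_derivative (1/2 + \<nu>) * ((\<nu> - 1/2) * x powr (\<nu> - 1/2 - 1))) (at x)"
    using assms by (intro DERIV_cmult has_real_derivative_powr)
  moreover have "(1/2 + \<nu>) * ((\<nu> - 1/2) * x powr (\<nu> - 1/2 - 1)) = pot x * solu x"
  proof -
    have "\<nu> - 1/2 - 1 = (1/2 + \<nu>) - 2" by simp
    then have "x powr (\<nu> - 1/2 - 1) = x powr (1/2 + \<nu>) / x\<^sup>2"
      using assms by (simp only: powr_diff powr_numeral)
    moreover have "(1/2 + \<nu>) * (\<nu> - 1/2) = \<nu>\<^sup>2 - 1/4" by (simp add: power2_eq_square algebra_simps)
    ultimately show ?thesis by (simp add: pot_def solu_def mult.assoc[symmetric])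
  qed
  ultimately show ?thesis by (simp only: solu'_def[abs_def])
qed

lemma powr_half_ln_deriv:
  fixes x :: real
  assumes "0 < x"
  shows "((\<lambda>x. x powr (1/2) * ln x) has_real_derivative x powr (-1/2) * (ln x / 2 + 1)) (at x)"
    "((\<lambda>x. x powr (-1/2) * (ln x / 2 + 1)) has_real_derivative (-1/4) / x\<^sup>2 * (x powr (1/2) * ln x)) (at x)"
proof -
  have h: "((\<lambda>x. x powr (1/2)) has_real_derivative (1/2) * x powr (1/2 - 1)) (at x)"
    "((\<lambda>x. x powr (-1/2)) has_real_derivative (-1/2) * x powr (-1/2 - 1)) (at x)"
    "(ln has_real_derivative 1 / x) (at x)"
    by (rule has_real_derivative_powr[OF assms], rule has_real_derivative_powr[OF assms], rule DERIV_ln_divide[OF assms])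
  have p: "x powr (1/2) / x = x powr (-1/2)" "x powr (-1/2) / x = x powr (-3/2)" "x powr (1/2) / x\<^sup>2 = x powr (-3/2)"
    using assms powr_diff[of x "1/2" 1] powr_diff[of x "-1/2" 1] powr_diff[of x "1/2" 2]
    by (auto simp: powr_numeral)
  have "((\<lambda>x. x powr (1/2) * ln x) has_real_derivative ((1/2) * x powr (1/2 - 1)) * ln x + (1 / x) * x powr (1/2)) (at x)"
    by (rule DERIV_mult[OF h(1) h(3)])
  moreover have "((1/2) * x powr (1/2 - 1)) * ln x + (1 / x) * x powr (1/2) = x powr (-1/2) * (ln x / 2 + 1)"
    using p by (simp add: algebra_simps)
  ultimately show "((\<lambda>x. x powr (1/2) * ln x) has_real_derivative x powr (-1/2) * (ln x / 2 + 1)) (at x)" by simp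
  have "((\<lambda>x. ln x / 2 + 1) has_real_derivative (1 / x) / 2 + 0) (at x)"
    by (intro DERIV_add DERIV_cdivide h DERIV_const)
  from DERIV_mult[OF h(2) this]
  have "((\<lambda>x. x powr (-1/2) * (ln x / 2 + 1)) has_real_derivative
     (-1/2) * x powr (-1/2 - 1) * (ln x / 2 + 1) + ((1 / x) / 2 + 0) * x powr (-1/2)) (at x)" .
  moreover have "(-1/2) * x powr (-1/2 - 1) * (ln x / 2 + 1) + ((1 / x) / 2 + 0) * x powr (-1/2) = (-1/4) / x\<^sup>2 * (x powr (1/2) * ln x)"
  proof -
    have "(1 / x) / 2 * x powr (-1/2) = x powr (-3/2) / 2" using p(2) by (simp add: field_simps)
    moreover have "(-1/4) / x\<^sup>2 * (x powr (1/2) * ln x) = (-1/4) * ln x * (x powr (1/2) / x\<^sup>2)" by simp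
    ultimately show ?thesis unfolding p(3) by (simp add: algebra_simps)
  qed
  ultimately show "((\<lambda>x. x powr (-1/2) * (ln x / 2 + 1)) has_real_derivative (-1/4) / x\<^sup>2 * (x powr (1/2) * ln x)) (at x)"
    by simp
qed

lemma solv_deriv:
  assumes "0 < x" shows "(solv has_real_derivative solv' x) (at x)"
proof (cases "\<nu> = 0")
  case True
  then show ?thesis using powr_half_ln_deriv(1)[OF assms] unfolding solv_def[abs_def] solv'_def by simp
next
  case False
  have "((\<lambda>x. - (x powr (1/2 - \<nu>) / (2 * \<nu>))) has_real_derivative - ((1/2 - \<nu>) * x powr (1/2 - \<nu> - 1) / (2 * \<nu>))) (at x)"
    using assms by (intro DERIV_minus DERIV_cdivide has_real_derivative_powr)
  moreover have "1/2 - \<nu> - 1 = -1/2 - \<nu>" by simp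
  ultimately show ?thesis using False by (simp only: solv_def[abs_def] solv'_def if_False)
qed

lemma solv'_deriv:
  assumes "0 < x" shows "(solv' has_real_derivative pot x * solv x) (at x)"
proof (cases "\<nu> = 0")
  case True
  then show ?thesis using powr_half_ln_deriv(2)[OF assms] unfolding solv_def solv'_def[abs_def] pot_def by simp
next
  case False
  have "((\<lambda>x. - ((1/2 - \<nu>) * x powr (-1/2 - \<nu>) / (2 * \<nu>))) has_real_derivative
     - ((1/2 - \<nu>) * ((-1/2 - \<nu>) * x powr (-1/2 - \<nu> - 1)) / (2 * \<nu>))) (at x)"
    using assms by (intro DERIV_minus DERIV_cdivide DERIV_cmult has_real_derivative_powr)
  moreover have "- ((1/2 - \<nu>) * ((-1/2 - \<nu>) * x powr (-1/2 - \<nu> - 1)) / (2 * \<nu>)) = pot x * solv x"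
  proof -
    have "-1/2 - \<nu> - 1 = (1/2 - \<nu>) - 2" by simp
    then have "x powr (-1/2 - \<nu> - 1) = x powr (1/2 - \<nu>) / x\<^sup>2"
      using assms by (simp only: powr_diff powr_numeral)
    moreover have "(1/2 - \<nu>) * (-1/2 - \<nu>) = \<nu>\<^sup>2 - 1/4" by (simp add: power2_eq_square algebra_simps)
    ultimately show ?thesis using False by (simp add: pot_def solv_def mult.assoc[symmetric])
  qed
  ultimately show ?thesis using False by (simp only: solv'_def[abs_def] if_False)
qed

lemma wronskian:
  assumes "0 < x" shows "solu x * solv' x - solu' x * solv x = 1"
proof (cases "\<nu> = 0")
  case True
  have "x powr (1/2) * x powr (-1/2) = 1" using assms by (simp add: powr_add[symmetric])
  have "x powr (1/2) * (x powr (-1/2) * (ln x / 2 + 1)) - (1/2 * x powr (-1/2)) * (x powr (1/2) * ln x) = 1"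
  proof -
    have "P * (Q * (L / 2 + 1)) - (1/2 * Q) * (P * L) = P * Q" for P Q L :: real
      by (simp add: algebra_simps)
    then show ?thesis using \<open>x powr (1/2) * x powr (-1/2) = 1\<close> by presburger
  qed
  then show ?thesis using True unfolding solu_def solu'_def solv_def solv'_def by simp
next
  case False
  have 1: "x powr (1/2 + \<nu>) * x powr (-1/2 - \<nu>) = 1" "x powr (\<nu> - 1/2) * x powr (1/2 - \<nu>) = 1"
    using assms by (simp_all add: powr_add[symmetric])
  have "solu x * solv' x - solu' x * solv x =
    (- (1/2 - \<nu>) * (x powr (1/2 + \<nu>) * x powr (-1/2 - \<nu>)) + (1/2 + \<nu>) * (x powr (\<nu> - 1/2) * x powr (1/2 - \<nu>))) / (2 * \<nu>)"
    using False by (simp add: solu_def solu'_def solv_def solv'_def field_simps)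
  also have "\<dots> = 1" unfolding 1 using False by simp
  finally show ?thesis .
qed

lemma abs_ln_le: "\<bar>ln x\<bar> \<le> 4 * (x powr (1/4) + x powr (-1/4))" if "0 < x" for x :: real
proof (cases "1 \<le> x")
  case True
  then have "ln x \<le> x powr (1/4) / (1/4)" by (intro ln_powr_bound) auto
  then show ?thesis using True by (simp add: add_increasing2)
next
  case False
  then have "ln (1/x) \<le> (1/x) powr (1/4) / (1/4)" using that by (intro ln_powr_bound) auto
  also have "(1/x) powr (1/4) = x powr (-1/4)" using that by (simp add: powr_divide powr_minus_divide)
  finally show ?thesis using False that by (simp add: ln_div add_increasing)
qed

lemma powr_le_powr_b:
  assumes "0 < x" "x \<le> b" "p \<le> q"
  shows "x powr q \<le> b powr (q - p) * x powr p"
proof -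
  have "x powr q = x powr (q - p) * x powr p" by (simp add: powr_add[symmetric])
  also have "\<dots> \<le> b powr (q - p) * x powr p"
    using assms by (intro mult_right_mono powr_mono2) auto
  finally show ?thesis .
qed

lemma abs_ln_le_b:
  assumes "0 < x" "x \<le> b"
  shows "\<bar>ln x\<bar> \<le> (4 * b powr (1/2) + 4) * x powr (-1/4)"
  using abs_ln_le[OF assms(1)] powr_le_powr_b[OF assms, of "-1/4" "1/4"]
  by (simp add: algebra_simps)

lemma solv_bound: "\<exists>C\<ge>0. \<forall>x. 0 < x \<longrightarrow> x \<le> b \<longrightarrow> \<bar>solv x\<bar> \<le> C * x powr (1/2 - sing)"
proof (cases "\<nu> = 0")
  case True
  show ?thesis
  proof (intro exI conjI allI impI)
    fix x assume x: "0 < x" "x \<le> b"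
    have "\<bar>solv x\<bar> = x powr (1/2) * \<bar>ln x\<bar>" using True unfolding solv_def by (simp add: abs_mult)
    also have "\<dots> \<le> x powr (1/2) * ((4 * b powr (1/2) + 4) * x powr (-1/4))"
      by (intro mult_left_mono abs_ln_le_b x) auto
    also have "\<dots> = (4 * b powr (1/2) + 4) * (x powr (1/2) * x powr (-1/4))" by simp
    also have "x powr (1/2) * x powr (-1/4) = x powr (1/2 - sing)"
      using True unfolding sing_def by (simp add: powr_add[symmetric])
    finally show "\<bar>solv x\<bar> \<le> (4 * b powr (1/2) + 4) * x powr (1/2 - sing)" .
  qed auto
next
  case False
  show ?thesis
    by (rule exI[of _ "1 / (2 * \<nu>)"]) (use False nu_nonneg in \<open>auto simp: solv_def sing_def\<close>)
qed

lemma solv'_bound: "\<exists>C\<ge>0. \<forall>x. 0 < x \<longrightarrow> x \<le> b \<longrightarrow> \<bar>solv' x\<bar> \<le> C * x powr (- 1/2 - sing)"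
proof (cases "\<nu> = 0")
  case True
  let ?C = "2 * b powr (1/2) + 2 + b powr (1/4)"
  show ?thesis
  proof (intro exI conjI allI impI)
    fix x assume x: "0 < x" "x \<le> b"
    have "\<bar>solv' x\<bar> = x powr (-1/2) * \<bar>ln x / 2 + 1\<bar>" using True unfolding solv'_def by (simp add: abs_mult)
    also have "\<bar>ln x / 2 + 1\<bar> \<le> \<bar>ln x\<bar> / 2 + 1" by linarith
    also have "\<dots> \<le> ?C * x powr (-1/4)"
      using abs_ln_le_b[OF x] powr_le_powr_b[OF x, of "-1/4" 0] x by (simp add: algebra_simps)
    finally have "\<bar>solv' x\<bar> \<le> x powr (-1/2) * (?C * x powr (-1/4))" by (simp add: mult_left_mono)
    also have "\<dots> = ?C * (x powr (-1/2) * x powr (-1/4))" by simp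
    also have "x powr (-1/2) * x powr (-1/4) = x powr (-1/2 - sing)"
      using True unfolding sing_def by (simp add: powr_add[symmetric])
    finally show "\<bar>solv' x\<bar> \<le> ?C * x powr (- 1/2 - sing)" .
  qed auto
next
  case False
  show ?thesis
    by (rule exI[of _ "\<bar>1/2 - \<nu>\<bar> / (2 * \<nu>)"])
      (use False nu_nonneg in \<open>auto simp: solv'_def sing_def abs_mult\<close>)
qed

lemma solu_bound: "\<bar>solu x\<bar> = x powr (1/2 + \<nu>)" "\<bar>solu' x\<bar> \<le> 2 * x powr (\<nu> - 1/2)"
proof -
  show "\<bar>solu x\<bar> = x powr (1/2 + \<nu>)" by (simp add: solu_def)
  have "\<bar>solu' x\<bar> = (1/2 + \<nu>) * x powr (\<nu> - 1/2)" using nu_nonneg by (simp add: solu'_def abs_mult)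
  also have "\<dots> \<le> 2 * x powr (\<nu> - 1/2)" using nu_less by (intro mult_right_mono) auto
  finally show "\<bar>solu' x\<bar> \<le> 2 * x powr (\<nu> - 1/2)" .
qed

text \<open>
This is the Volterra kernel, bounded in the form required by Hardy's inequality. Bounding its two
products separately would lose the homogeneity in the logarithmic case, where
the difference is \<open>- x\<^sup>1\<^sup>/\<^sup>2 t\<^sup>1\<^sup>/\<^sup>2 ln (x / t)\<close>.
\<close>

lemma kernel_bound:
  "\<exists>C\<ge>0. \<forall>x t. 0 < t \<longrightarrow> t \<le> x \<longrightarrow>
     \<bar>solu x * solv t - solv x * solu t\<bar> \<le> C * x powr (1/2 + sing) * t powr (1/2 - sing)"
proof (cases "\<nu> = 0")
  case True
  show ?thesis
  proof (intro exI conjI allI impI)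
    fix x t :: real assume xt: "0 < t" "t \<le> x"
    have "solu x * solv t - solv x * solu t = - (x powr (1/2) * t powr (1/2) * ln (x / t))"
      using True xt unfolding solu_def solv_def by (simp add: ln_div algebra_simps)
    moreover have "0 \<le> ln (x / t)" using xt by simp
    ultimately have "\<bar>solu x * solv t - solv x * solu t\<bar> = x powr (1/2) * t powr (1/2) * ln (x / t)"
      by (simp add: abs_mult)
    also have "\<dots> \<le> x powr (1/2) * t powr (1/2) * ((x / t) powr (1/4) / (1/4))"
      using xt by (intro mult_left_mono ln_powr_bound) auto
    also have "\<dots> = 4 * (x powr (1/2) * x powr (1/4)) * (t powr (1/2) / t powr (1/4))"
      using xt by (simp add: powr_divide)
    also have "\<dots> = 4 * x powr (1/2 + sing) * t powr (1/2 - sing)"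
      using True unfolding sing_def by (simp add: powr_add[symmetric] powr_diff[symmetric])
    finally show "\<bar>solu x * solv t - solv x * solu t\<bar> \<le> 4 * x powr (1/2 + sing) * t powr (1/2 - sing)" .
  qed auto
next
  case False
  then have nu: "\<nu> > 0" using nu_nonneg by simp
  show ?thesis
  proof (intro exI conjI allI impI)
    fix x t :: real assume xt: "0 < t" "t \<le> x"
    have "x powr (1/2 - \<nu>) * t powr (1/2 + \<nu>) = x powr (1/2 + \<nu>) * t powr (1/2 - \<nu>) * ((t powr (2 * \<nu>)) / x powr (2 * \<nu>))"
    proof -
      have "x powr (1/2 - \<nu>) = x powr (1/2 + \<nu>) / x powr (2 * \<nu>)" "t powr (1/2 + \<nu>) = t powr (1/2 - \<nu>) * t powr (2 * \<nu>)"
        by (simp_all add: powr_diff[symmetric] powr_add[symmetric] add.commute)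
      then show ?thesis by simp
    qed
    also have "\<dots> \<le> x powr (1/2 + \<nu>) * t powr (1/2 - \<nu>) * 1"
      using xt nu by (intro mult_left_mono) (auto intro: powr_mono2)
    finally have le: "x powr (1/2 - \<nu>) * t powr (1/2 + \<nu>) \<le> x powr (1/2 + \<nu>) * t powr (1/2 - \<nu>)" by simp
    have "solu x * solv t - solv x * solu t =
      - ((x powr (1/2 + \<nu>) * t powr (1/2 - \<nu>) - x powr (1/2 - \<nu>) * t powr (1/2 + \<nu>)) / (2 * \<nu>))"
      using False by (simp add: solu_def solv_def diff_divide_distrib)
    then have "\<bar>solu x * solv t - solv x * solu t\<bar> =
      (x powr (1/2 + \<nu>) * t powr (1/2 - \<nu>) - x powr (1/2 - \<nu>) * t powr (1/2 + \<nu>)) / (2 * \<nu>)"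
      using le nu by simp
    also have "\<dots> \<le> (x powr (1/2 + \<nu>) * t powr (1/2 - \<nu>)) / (2 * \<nu>)"
      using nu by (intro divide_right_mono) auto
    finally show "\<bar>solu x * solv t - solv x * solu t\<bar> \<le> 1 / (2 * \<nu>) * x powr (1/2 + sing) * t powr (1/2 - sing)"
      using False by (simp add: sing_def)
  qed (use nu in auto)
qed

end

section \<open>The two Volterra operators\<close>

text \<open>
The Cauchy-Schwarz inequality on \<open>(0,x)\<close>; it provides the rates at which integrals of an \<open>L\<^sup>2\<close> function
vanish at the singular end point.
\<close>

lemma integral_powr_sq_le:
  assumes p: "p > -1/2" and h: "sq_integrable b h" and x: "0 < x" "x \<le> b"
  shows "integral {0..x} (\<lambda>t. t powr p * norm (h t)) \<le>
    sqrt (sqnorm b h) / sqrt (2 * p + 1) * x powr (p + 1/2)"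
proof -
  have b: "0 < b" using x by simp
  have "((\<lambda>t. t powr p * norm (h t)) has_integral integral {0..x} (\<lambda>t. t powr p * norm (h t))) {0..x}"
    by (rule integrable_integral[OF powr_mult_sq_integrable]) (use p h x b in auto)
  then have 1: "ennreal (integral {0..x} (\<lambda>t. t powr p * norm (h t))) =
     (\<integral>\<^sup>+t. ennreal (t powr p * norm (h t)) * indicator {0<..<x} t \<partial>leb b)"
    by (subst nn_integral_leb_Ioo) (use x in auto)
  define w where "w t = complex_of_real (t powr p * indicator {0<..<x} t)" for t
  have wsq: "sq_integrable b w"
  proof (rule sq_integrable_dominated[OF _ sq_integrable_powr[OF p b], of _ 1])
    show "w \<in> borel_measurable (leb b)"
    proof -
      have [measurable]: "(\<lambda>t::real. indicator {0<..<x} t :: real) \<in> borel_measurable (leb b)"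
        by (intro measurable_restrict_space1 measurable_completion) measurable
      show ?thesis unfolding w_def by measurable
    qed
  qed (auto simp: w_def indicator_def)
  have "ennreal (sqnorm b w) = (\<integral>\<^sup>+t. ennreal (t powr (2 * p)) * indicator {0<..<x} t \<partial>leb b)"
    unfolding nn_sqnorm[OF wsq, symmetric]
    by (rule nn_integral_cong) (auto simp: w_def indicator_def ennreal_power power2_eq_square powr_add[symmetric] ennreal_mult[symmetric])
  also have "\<dots> = ennreal (x powr (2 * p + 1) / (2 * p + 1))"
    using has_integral_powr_from_0[of "2 * p" x] p x by (intro nn_integral_leb_Ioo) auto
  finally have wn: "sqnorm b w = x powr (2 * p + 1) / (2 * p + 1)"
    using sqnorm_nonneg[of b w] p by simp
  have int: "integrable (leb b) (\<lambda>t. norm (w t * h t))"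
    using integrable_mult_sq[OF wsq h] by simp
  have "(\<integral>\<^sup>+t. ennreal (t powr p * norm (h t)) * indicator {0<..<x} t \<partial>leb b) = (\<integral>\<^sup>+t. ennreal (norm (w t * h t)) \<partial>leb b)"
    by (rule nn_integral_cong) (auto simp: w_def indicator_def norm_mult)
  also have "\<dots> = ennreal (LINT t|leb b. norm (w t * h t))"
    by (rule nn_integral_eq_integral[OF int]) auto
  also have "\<dots> \<le> ennreal (sqrt (sqnorm b w) * sqrt (sqnorm b h))"
    by (rule ennreal_leI[OF Cauchy_Schwarz_sq[OF wsq h]])
  finally have "integral {0..x} (\<lambda>t. t powr p * norm (h t)) \<le> sqrt (sqnorm b w) * sqrt (sqnorm b h)"
    unfolding 1[symmetric] by (simp add: sqnorm_nonneg)
  also have "sqrt (sqnorm b w) = x powr (p + 1/2) / sqrt (2 * p + 1)"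
  proof -
    have "sqrt (x powr (2 * p + 1)) = x powr (p + 1/2)"
      using x by (simp add: powr_half_sqrt[symmetric] powr_powr algebra_simps)
    then show ?thesis by (simp add: wn real_sqrt_divide)
  qed
  finally show ?thesis by (simp add: mult.commute)
qed

lemma sq_integrable_mult_continuous:
  assumes f: "sq_integrable b f" and g: "continuous_on {0..b} g"
  shows "sq_integrable b (\<lambda>x. g x * f x)"
proof -
  have "compact (g ` {0..b})" by (intro compact_continuous_image g) auto
  then obtain B where B: "\<And>x. x \<in> {0..b} \<Longrightarrow> norm (g x) \<le> B"
    by (meson compact_imp_bounded bounded_iff imageI)
  note [measurable] = sq_integrable_measurable[OF f] sq_integrable_measurable[OF sq_integrable_continuous[OF g]]
  show ?thesis
  proof (rule sq_integrable_dominated[OF _ f, of _ B])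
    show "(\<lambda>x. g x * f x) \<in> borel_measurable (leb b)" by measurable
    show "norm (g x * f x) \<le> B * norm (f x)" if "0 < x" "x < b" for x
      using B[of x] that by (simp add: norm_mult mult_right_mono)
  qed
qed

context bessel_setting
begin

definition lower :: "(real \<Rightarrow> real) \<Rightarrow> (real \<Rightarrow> complex) \<Rightarrow> real \<Rightarrow> complex" where
  "lower w h x = integral {0..x} (\<lambda>t. of_real (w t) * h t)"

definition upper :: "(real \<Rightarrow> real) \<Rightarrow> (real \<Rightarrow> complex) \<Rightarrow> real \<Rightarrow> complex" where
  "upper w h x = integral {x..b} (\<lambda>t. of_real (w t) * h t)"

text \<open>
Variation of parameters for \<open>\<tau> f = h\<close>: \<open>Vol0 h\<close> has zero data at \<open>0\<close> and \<open>Volb h\<close> has zero data at \<open>b\<close>.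
They are adjoint to each other in \<open>L\<^sup>2(0,b)\<close>.
\<close>

definition Vol0 :: "(real \<Rightarrow> complex) \<Rightarrow> real \<Rightarrow> complex" where
  "Vol0 h x = of_real (solu x) * lower solv h x - of_real (solv x) * lower solu h x"

definition Volb :: "(real \<Rightarrow> complex) \<Rightarrow> real \<Rightarrow> complex" where
  "Volb h x = of_real (solv x) * upper solu h x - of_real (solu x) * upper solv h x"

text \<open>
The solution of \<open>\<tau> f = 0\<close> with \<open>f b = 0\<close> and \<open>f' b = - 1\<close>.
\<close>

definition phi :: "real \<Rightarrow> complex" where
  "phi x = of_real (solv b * solu x - solu b * solv x)"

lemma continuous_on_sol:
  "continuous_on {0<..} solu" "continuous_on {0<..} solv" "continuous_on {0<..} solu'" "continuous_on {0<..} solv'"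
  using solu_deriv solv_deriv solu'_deriv solv'_deriv
  by (auto intro!: continuous_at_imp_continuous_on DERIV_isCont)

lemma measurable_continuous_leb:
  fixes f :: "real \<Rightarrow> complex"
  assumes "continuous_on {0<..} f"
  shows "f \<in> borel_measurable (leb b)"
  by (rule continuous_imp_measurable_on_sets_lebesgue) (auto intro: continuous_on_subset[OF assms])

lemma sq_solu: "sq_integrable b (\<lambda>x. complex_of_real (solu x))"
proof (rule sq_integrable_dominated[OF _ sq_integrable_powr[of "1/2 + \<nu>" b], of _ 1])
  show "(\<lambda>x. complex_of_real (solu x)) \<in> borel_measurable (leb b)"
    by (intro measurable_continuous_leb continuous_on_of_real continuous_on_sol)
qed (use nu_nonneg b_pos in \<open>auto simp: solu_def\<close>)

lemma sq_solv: "sq_integrable b (\<lambda>x. complex_of_real (solv x))"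
proof -
  obtain C where C: "\<And>x. 0 < x \<Longrightarrow> x \<le> b \<Longrightarrow> \<bar>solv x\<bar> \<le> C * x powr (1/2 - sing)"
    using solv_bound by blast
  show ?thesis
  proof (rule sq_integrable_dominated[OF _ sq_integrable_powr[of "1/2 - sing" b], of _ C])
    show "(\<lambda>x. complex_of_real (solv x)) \<in> borel_measurable (leb b)"
      by (intro measurable_continuous_leb continuous_on_of_real continuous_on_sol)
  qed (use C sing_bounds b_pos in auto)
qed

lemma sq_phi: "sq_integrable b phi"
proof -
  have "sq_integrable b (\<lambda>x. complex_of_real (solv b) * of_real (solu x) - of_real (solu b) * of_real (solv x))"
    by (intro sq_integrable_diff sq_integrable_scale sq_solu sq_solv)
  then show ?thesis by (simp add: phi_def[abs_def])
qed

definition sq_weight :: "(real \<Rightarrow> real) \<Rightarrow> bool" where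
  "sq_weight w \<longleftrightarrow> sq_integrable b (\<lambda>x. complex_of_real (w x))"

lemma sq_weight_sol: "sq_weight solu" "sq_weight solv"
  using sq_solu sq_solv by (auto simp: sq_weight_def)

lemma abs_int_weight:
  assumes "sq_weight w" "sq_integrable b h" "0 \<le> c" "d \<le> b"
  shows "(\<lambda>t. of_real (w t) * h t) absolutely_integrable_on {c..d}"
  by (rule absolutely_integrable_on_subinterval[OF absolutely_integrable_mult_sq])
    (use assms in \<open>auto simp: sq_weight_def\<close>)

lemma int_weight:
  assumes "sq_weight w" "sq_integrable b h" "0 \<le> c" "d \<le> b"
  shows "(\<lambda>t. of_real (w t) * h t) integrable_on {c..d}"
  using abs_int_weight[OF assms] set_lebesgue_integral_eq_integral(1) by blast

lemma lower_split:
  assumes "sq_weight w" "sq_integrable b h" "0 \<le> c" "c \<le> x" "x \<le> b"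
  shows "lower w h x = lower w h c + integral {c..x} (\<lambda>t. of_real (w t) * h t)"
  unfolding lower_def
  by (rule Henstock_Kurzweil_Integration.integral_combine[symmetric]) (use assms in \<open>auto intro: int_weight\<close>)

lemma upper_split:
  assumes "sq_weight w" "sq_integrable b h" "0 \<le> c" "c \<le> x" "x \<le> b"
  shows "upper w h c = integral {c..x} (\<lambda>t. of_real (w t) * h t) + upper w h x"
  unfolding upper_def
  by (rule Henstock_Kurzweil_Integration.integral_combine[symmetric]) (use assms in \<open>auto intro: int_weight\<close>)

lemma lower_upper:
  assumes "sq_weight w" "sq_integrable b h" "0 \<le> x" "x \<le> b"
  shows "lower w h b = lower w h x + upper w h x"
  using lower_split[OF assms(1-4)] assms by (simp add: upper_def)

lemma upper_0: "upper w h 0 = lower w h b"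
  by (simp add: upper_def lower_def)

lemma lower_0 [simp]: "lower w h 0 = 0" and upper_b [simp]: "upper w h b = 0"
  by (simp_all add: lower_def upper_def)

lemma continuous_lower:
  assumes "sq_weight w" "sq_integrable b h"
  shows "continuous_on {0..b} (lower w h)"
  unfolding lower_def by (rule indefinite_integral_continuous_1) (use assms int_weight in auto)

lemma continuous_upper:
  assumes "sq_weight w" "sq_integrable b h"
  shows "continuous_on {0..b} (upper w h)"
proof -
  have "continuous_on {0..b} (\<lambda>x. lower w h b - lower w h x)"
    by (intro continuous_intros continuous_lower assms)
  then show ?thesis
    by (rule continuous_on_eq) (use lower_upper[OF assms] in auto)
qed

lemma lower_add:
  assumes "sq_weight w" "sq_integrable b h" "sq_integrable b k" "0 \<le> x" "x \<le> b"
  shows "lower w (\<lambda>t. h t + k t) x = lower w h x + lower w k x"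
  unfolding lower_def distrib_left
  by (rule Henstock_Kurzweil_Integration.integral_add) (use assms int_weight in auto)

lemma upper_add:
  assumes "sq_weight w" "sq_integrable b h" "sq_integrable b k" "0 \<le> x" "x \<le> b"
  shows "upper w (\<lambda>t. h t + k t) x = upper w h x + upper w k x"
  unfolding upper_def distrib_left
  by (rule Henstock_Kurzweil_Integration.integral_add) (use assms int_weight in auto)

lemma lower_scale: "lower w (\<lambda>t. c * h t) x = c * lower w h x"
  unfolding lower_def by (simp add: mult.left_commute)

lemma upper_scale: "upper w (\<lambda>t. c * h t) x = c * upper w h x"
  unfolding upper_def by (simp add: mult.left_commute)

lemma cnj_lower: "cnj (lower w h x) = lower w (\<lambda>t. cnj (h t)) x"
  unfolding lower_def by (simp add: Henstock_Kurzweil_Integration.integral_cnj)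

lemma cnj_upper: "cnj (upper w h x) = upper w (\<lambda>t. cnj (h t)) x"
  unfolding upper_def by (simp add: Henstock_Kurzweil_Integration.integral_cnj)

lemma lower_bound:
  assumes w: "\<And>t. 0 < t \<Longrightarrow> t \<le> b \<Longrightarrow> \<bar>w t\<bar> \<le> C * t powr p" and p: "p > -1/2"
    and aw: "sq_weight w" and h: "sq_integrable b h" and C: "0 \<le> C"
  shows "\<exists>D\<ge>0. \<forall>x. 0 < x \<longrightarrow> x \<le> b \<longrightarrow> norm (lower w h x) \<le> D * x powr (p + 1/2)"
proof (intro exI conjI allI impI)
  let ?D = "C * (sqrt (sqnorm b h) / sqrt (2 * p + 1))"
  show "0 \<le> ?D" using C p by (simp add: sqnorm_nonneg)
  fix x assume x: "0 < x" "x \<le> b"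
  have "norm (lower w h x) = norm (integral {0<..<x} (\<lambda>t. of_real (w t) * h t))"
    unfolding lower_def by (simp add: integral_open_interval_real)
  also have "\<dots> \<le> integral {0<..<x} (\<lambda>t. C * (t powr p * norm (h t)))"
  proof (rule integral_norm_bound_integral)
    show "(\<lambda>t. of_real (w t) * h t) integrable_on {0<..<x}"
      using int_weight[OF aw h, of 0 x] x by (simp add: integrable_on_Icc_iff_Ioo)
    show "(\<lambda>t. C * (t powr p * norm (h t))) integrable_on {0<..<x}"
      using powr_mult_sq_integrable[OF p b_pos h, of x] x
      by (intro integrable_on_mult_right) (simp add: integrable_on_Icc_iff_Ioo)
    show "norm (of_real (w t) * h t) \<le> C * (t powr p * norm (h t))" if "t \<in> {0<..<x}" for t
      using w[of t] that x by (simp add: norm_mult mult.assoc[symmetric] mult_right_mono)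
  qed
  also have "\<dots> = C * integral {0..x} (\<lambda>t. t powr p * norm (h t))"
    by (simp add: integral_open_interval_real)
  also have "\<dots> \<le> C * (sqrt (sqnorm b h) / sqrt (2 * p + 1) * x powr (p + 1/2))"
    by (intro mult_left_mono integral_powr_sq_le C p h x)
  finally show "norm (lower w h x) \<le> ?D * x powr (p + 1/2)" by (simp add: mult.assoc)
qed

lemma lower_solu_bound:
  assumes "sq_integrable b h"
  shows "\<exists>D\<ge>0. \<forall>x. 0 < x \<longrightarrow> x \<le> b \<longrightarrow> norm (lower solu h x) \<le> D * x powr (1 + \<nu>)"
  using lower_bound[of solu 1 "1/2 + \<nu>", OF _ _ sq_weight_sol(1) assms] nu_nonneg
  by (simp add: solu_bound add.commute)

lemma lower_solv_bound:
  assumes "sq_integrable b h"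
  shows "\<exists>D\<ge>0. \<forall>x. 0 < x \<longrightarrow> x \<le> b \<longrightarrow> norm (lower solv h x) \<le> D * x powr (1 - sing)"
proof -
  obtain C where C: "0 \<le> C" "\<And>x. 0 < x \<Longrightarrow> x \<le> b \<Longrightarrow> \<bar>solv x\<bar> \<le> C * x powr (1/2 - sing)"
    using solv_bound by blast
  show ?thesis
    using lower_bound[of solv C "1/2 - sing", OF C(2) _ sq_weight_sol(2) assms C(1)] sing_bounds by simp
qed

lemma continuous_Vol0: "sq_integrable b h \<Longrightarrow> continuous_on {0<..b} (Vol0 h)"
  unfolding Vol0_def
  by (intro continuous_intros continuous_on_of_real continuous_on_subset[OF continuous_on_sol(1)]
      continuous_on_subset[OF continuous_on_sol(2)] continuous_on_subset[OF continuous_lower] sq_weight_sol) auto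

lemma Vol0_eq_kernel:
  assumes "sq_integrable b h" "0 \<le> x" "x \<le> b"
  shows "Vol0 h x = integral {0..x} (\<lambda>t. of_real (solu x * solv t - solv x * solu t) * h t)"
proof -
  have "integral {0..x} (\<lambda>t. of_real (solu x * solv t - solv x * solu t) * h t) =
    integral {0..x} (\<lambda>t. of_real (solu x) * (of_real (solv t) * h t) - of_real (solv x) * (of_real (solu t) * h t))"
    by (simp add: algebra_simps)
  also have "\<dots> = Vol0 h x"
    unfolding Vol0_def lower_def
    using int_weight[OF sq_weight_sol(1) assms(1), of 0 x] int_weight[OF sq_weight_sol(2) assms(1), of 0 x] assms
    by (subst integral_diff) (auto intro: integrable_on_mult_right)
  finally show ?thesis by simp
qed

text \<open>
Hardy's inequality in the form that keeps \<open>q f\<close> in \<open>L\<^sup>2(0,b)\<close> for \<open>f = Vol0 h\<close>.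
\<close>

lemma sq_Vol0_div:
  assumes h: "sq_integrable b h"
  shows "sq_integrable b (\<lambda>x. Vol0 h x / of_real (x\<^sup>2))"
proof -
  obtain C where C: "0 \<le> C" "\<And>x t. 0 < t \<Longrightarrow> t \<le> x \<Longrightarrow>
     \<bar>solu x * solv t - solv x * solu t\<bar> \<le> C * x powr (1/2 + sing) * t powr (1/2 - sing)"
    using kernel_bound by blast
  have p: "1/2 - sing > -1/2" using sing_bounds by simp
  show ?thesis
  proof (rule hardy_inequality[OF sing_bounds(2) b_pos h, of _ C])
    have "continuous_on {0<..<b} (\<lambda>x. Vol0 h x / of_real (x\<^sup>2))"
      by (intro continuous_intros continuous_on_subset[OF continuous_Vol0[OF h]]) auto
    then show "(\<lambda>x. Vol0 h x / of_real (x\<^sup>2)) \<in> borel_measurable (leb b)"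
      by (rule continuous_imp_measurable_on_sets_lebesgue) auto
    fix x assume x: "0 < x" "x < b"
    let ?k = "\<lambda>t. complex_of_real (solu x * solv t - solv x * solu t) * h t"
    have ki: "?k integrable_on {0..x}"
    proof -
      have "(\<lambda>t. of_real (solu x) * (of_real (solv t) * h t) - of_real (solv x) * (of_real (solu t) * h t)) integrable_on {0..x}"
        using int_weight[OF sq_weight_sol(1) h, of 0 x] int_weight[OF sq_weight_sol(2) h, of 0 x] x
        by (intro integrable_diff integrable_on_mult_right) auto
      then show ?thesis by (simp add: algebra_simps)
    qed
    have "norm (Vol0 h x) = norm (integral {0<..<x} ?k)"
      using Vol0_eq_kernel[OF h] x by (simp add: integral_open_interval_real)
    also have "\<dots> \<le> integral {0<..<x} (\<lambda>t. (C * x powr (1/2 + sing)) * (t powr (1/2 - sing) * norm (h t)))"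
    proof (rule integral_norm_bound_integral)
      show "?k integrable_on {0<..<x}" using ki by (simp add: integrable_on_Icc_iff_Ioo)
      show "(\<lambda>t. (C * x powr (1/2 + sing)) * (t powr (1/2 - sing) * norm (h t))) integrable_on {0<..<x}"
        using powr_mult_sq_integrable[OF p b_pos h, of x] x
        by (intro integrable_on_mult_right) (simp add: integrable_on_Icc_iff_Ioo)
      show "norm (?k t) \<le> (C * x powr (1/2 + sing)) * (t powr (1/2 - sing) * norm (h t))" if "t \<in> {0<..<x}" for t
        using C(2)[of t x] that x
        by (simp add: norm_mult mult.assoc[symmetric] mult_right_mono del: of_real_mult of_real_diff)
    qed
    also have "\<dots> = C * x powr (1/2 + sing) * integral {0..x} (\<lambda>t. t powr (1/2 - sing) * norm (h t))"
      by (simp add: integral_open_interval_real)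
    finally have "norm (Vol0 h x) / x\<^sup>2 \<le> C * x powr (1/2 + sing) * integral {0..x} (\<lambda>t. t powr (1/2 - sing) * norm (h t)) / x\<^sup>2"
      by (rule divide_right_mono) auto
    also have "\<dots> = C * (x powr (1/2 + sing) / x\<^sup>2 * integral {0..x} (\<lambda>t. t powr (1/2 - sing) * norm (h t)))"
      by simp
    also have "x powr (1/2 + sing) / x\<^sup>2 = x powr (sing - 3/2)"
    proof -
      have "sing - 3/2 = (1/2 + sing) - 2" by simp
      then show ?thesis using x by (simp only: powr_diff powr_numeral)
    qed
    finally show "norm (Vol0 h x / of_real (x\<^sup>2)) \<le>
      C * (x powr (sing - 3/2) * integral {0..x} (\<lambda>t. t powr (1/2 - sing) * norm (h t)))"
      by (simp add: norm_divide norm_power)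
  qed
qed

lemma sq_Vol0: "sq_integrable b h \<Longrightarrow> sq_integrable b (Vol0 h)"
proof -
  assume h: "sq_integrable b h"
  have "sq_integrable b (\<lambda>x. of_real (x\<^sup>2) * (Vol0 h x / of_real (x\<^sup>2)))"
    by (intro sq_integrable_mult_continuous sq_Vol0_div h continuous_intros)
  moreover have "Vol0 h \<in> borel_measurable (leb b)"
    by (rule continuous_imp_measurable_on_sets_lebesgue)
      (auto intro: continuous_on_subset[OF continuous_Vol0[OF h]])
  ultimately show ?thesis
    by (rule_tac sq_integrable_dominated[where C=1]) auto
qed

lemma sq_Volb: "sq_integrable b h \<Longrightarrow> sq_integrable b (Volb h)"
  unfolding Volb_def
  using sq_integrable_mult_continuous[OF sq_solv continuous_upper[OF sq_weight_sol(1)], of h]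
    sq_integrable_mult_continuous[OF sq_solu continuous_upper[OF sq_weight_sol(2)], of h]
  by (auto intro: sq_integrable_diff simp: mult.commute)

text \<open>
Each kernel is a difference of products, and each product contributes one triangle integral.
\<close>

lemma Vol0_Volb_duality:
  assumes h: "sq_integrable b h" and k: "sq_integrable b k"
  shows "sqinner b (Vol0 h) k = sqinner b h (Volb k)"
proof -
  let ?k = "\<lambda>x. cnj (k x)"
  have k': "sq_integrable b ?k" by (rule sq_integrable_cnj[OF k])
  note au = abs_int_weight[OF sq_weight_sol(1) _ order_refl order_refl]
  note av = abs_int_weight[OF sq_weight_sol(2) _ order_refl order_refl]
  note f1 = triangle_fubini[OF au[OF k'] av[OF h]]
  note f2 = triangle_fubini[OF av[OF k'] au[OF h]]
  note ints = f1(2,3)[THEN set_lebesgue_integral_eq_integral(1)] f2(2,3)[THEN set_lebesgue_integral_eq_integral(1)]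
  have "sqinner b (Vol0 h) k = integral {0..b} (\<lambda>x. Vol0 h x * ?k x)"
    unfolding sqinner_def by (rule leb_eq_integral[OF integrable_sqinner[OF sq_Vol0[OF h] k]])
  also have "\<dots> = integral {0..b} (\<lambda>x. of_real (solu x) * ?k x * lower solv h x - of_real (solv x) * ?k x * lower solu h x)"
    by (simp add: Vol0_def algebra_simps)
  also have "\<dots> = integral {0..b} (\<lambda>x. of_real (solu x) * ?k x * lower solv h x) - integral {0..b} (\<lambda>x. of_real (solv x) * ?k x * lower solu h x)"
    using ints unfolding lower_def by (intro integral_diff) auto
  also have "\<dots> = integral {0..b} (\<lambda>x. of_real (solv x) * h x * upper solu ?k x) - integral {0..b} (\<lambda>x. of_real (solu x) * h x * upper solv ?k x)"
    using f1(1) f2(1) unfolding lower_def upper_def by simp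
  also have "\<dots> = integral {0..b} (\<lambda>x. of_real (solv x) * h x * upper solu ?k x - of_real (solu x) * h x * upper solv ?k x)"
    using ints unfolding upper_def by (intro integral_diff[symmetric]) auto
  also have "\<dots> = integral {0..b} (\<lambda>x. h x * cnj (Volb k x))"
    by (simp add: Volb_def cnj_upper algebra_simps)
  also have "\<dots> = sqinner b h (Volb k)"
    unfolding sqinner_def by (rule leb_eq_integral[OF integrable_sqinner[OF h sq_Volb[OF k]], symmetric])
  finally show ?thesis .
qed

lemma sqinner_phi:
  assumes h: "sq_integrable b h"
  shows "sqinner b h phi = of_real (solv b) * lower solu h b - of_real (solu b) * lower solv h b"
proof -
  have "sqinner b h phi = integral {0..b} (\<lambda>x. h x * cnj (phi x))"
    unfolding sqinner_def by (rule leb_eq_integral[OF integrable_sqinner[OF h sq_phi]])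
  also have "\<dots> = integral {0..b} (\<lambda>x. of_real (solv b) * (of_real (solu x) * h x) - of_real (solu b) * (of_real (solv x) * h x))"
    by (simp add: phi_def algebra_simps)
  also have "\<dots> = of_real (solv b) * lower solu h b - of_real (solu b) * lower solv h b"
    unfolding lower_def
    using int_weight[OF sq_weight_sol(1) h, of 0 b] int_weight[OF sq_weight_sol(2) h, of 0 b]
    by (subst integral_diff) (auto intro: integrable_on_mult_right)
  finally show ?thesis .
qed

text \<open>
The boundary condition at \<open>b\<close> becomes orthogonality to \<open>phi\<close>.
\<close>

lemma Vol0_b: "sq_integrable b h \<Longrightarrow> Vol0 h b = - sqinner b h phi"
  by (simp add: Vol0_def sqinner_phi)

end

section \<open>Variation of parameters\<close>

lemma AE_eq_continuous_imp_eq: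
  fixes f g :: "real \<Rightarrow> complex"
  assumes "continuous_on {0<..<b} f" "continuous_on {0<..<b} g" "AE x in leb b. f x = g x"
    "0 < x" "x < b"
  shows "f x = g x"
proof -
  have "continuous_on {0<..<b} (\<lambda>x. f x - g x)" by (intro continuous_intros assms)
  then have o: "open ({0<..<b} \<inter> (\<lambda>x. f x - g x) -` (- {0}))"
    by (rule continuous_open_preimage) auto
  have "AE x in lebesgue. x \<in> {0<..<b} \<longrightarrow> f x = g x"
    using assms(3) by (subst (asm) AE_restrict_space_iff) auto
  then have "negligible {x. \<not> (x \<in> {0<..<b} \<longrightarrow> f x = g x)}"
    by (simp add: eventually_ae_filter_negligible) (metis negligible_subset)
  then have "negligible ({0<..<b} \<inter> (\<lambda>x. f x - g x) -` (- {0}))"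
    by (rule negligible_subset) auto
  then have "{0<..<b} \<inter> (\<lambda>x. f x - g x) -` (- {0}) = {}"
    using open_not_negligible[OF o] by blast
  then show ?thesis using assms by auto
qed

lemma tendsto_0_powr_bound:
  fixes F :: "real \<Rightarrow> complex"
  assumes "r > 0" "0 < b" "\<And>x. 0 < x \<Longrightarrow> x \<le> b \<Longrightarrow> norm (F x) \<le> D * x powr r"
  shows "(F \<longlongrightarrow> 0) (at_right 0)"
proof (rule Lim_null_comparison)
  show "\<forall>\<^sub>F x in at_right 0. norm (F x) \<le> D * x powr r"
    unfolding eventually_at_right_field using assms by (intro exI[of _ b]) auto
  have "((\<lambda>x::real. x powr r) \<longlongrightarrow> 0) (at_right 0)"
  proof (rule tendsto_zero_powrI[OF tendsto_ident_at tendsto_const _ assms(1)])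
    show "\<forall>\<^sub>F x::real in at_right 0. 0 \<le> x"
      by (rule eventually_mono[OF eventually_at_right_less]) auto
  qed
  then show "((\<lambda>x. D * x powr r) \<longlongrightarrow> 0) (at_right 0)"
    by (rule tendsto_mult_right_zero)
qed

text \<open>
An increment formula away from the singular point extends to \<open>0\<close> as soon as the limit there is known.
\<close>

lemma indefinite_integral_from_limit:
  fixes F p :: "real \<Rightarrow> complex"
  assumes p: "p absolutely_integrable_on {0..b}"
    and F: "\<And>c x. 0 < c \<Longrightarrow> c \<le> x \<Longrightarrow> x \<le> b \<Longrightarrow> F x = F c + integral {c..x} p"
    and lim: "(F \<longlongrightarrow> l) (at_right 0)" and x: "0 < x" "x \<le> b"
  shows "F x = l + integral {0..x} p"
proof -
  have ip: "p integrable_on {0..b}" using p set_lebesgue_integral_eq_integral(1) by blast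
  let ?P = "\<lambda>c. integral {0..c} p"
  have "continuous_on {0..b} ?P" by (rule indefinite_integral_continuous_1[OF ip])
  then have "(?P \<longlongrightarrow> ?P 0) (at 0 within {0..b})"
    using x unfolding continuous_on_def by (meson atLeastAtMost_iff order_refl order_trans less_imp_le)
  then have P0: "(?P \<longlongrightarrow> 0) (at_right 0)"
    using x by (simp add: at_within_Icc_at_right)
  have ev: "\<forall>\<^sub>F c in at_right 0. F c = F x - (?P x - ?P c)"
    unfolding eventually_at_right_field
  proof (intro exI conjI allI impI)
    show "0 < x" by (rule x)
    fix c assume c: "0 < c" "c < x"
    have "?P c + integral {c..x} p = ?P x"
      by (rule Henstock_Kurzweil_Integration.integral_combine)
        (use c x in \<open>auto intro: integrable_on_subinterval[OF ip]\<close>)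
    then show "F c = F x - (?P x - ?P c)" using F[of c x] c x by (simp add: algebra_simps)
  qed
  have "((\<lambda>c. F x - (?P x - ?P c)) \<longlongrightarrow> F x - (?P x - 0)) (at_right 0)"
    by (intro tendsto_intros P0)
  then have "(F \<longlongrightarrow> F x - ?P x) (at_right 0)"
    using ev by (simp add: tendsto_cong)
  then have "F x - ?P x = l"
    using lim by (intro tendsto_unique) auto
  then show ?thesis by (simp add: algebra_simps)
qed

context bessel_setting
begin

text \<open>
A solution of the homogeneous equation together with its derivative; it serves to treat \<open>solu\<close> and \<open>solv\<close>
at once.
\<close>

definition sol_pair :: "(real \<Rightarrow> real) \<Rightarrow> (real \<Rightarrow> real) \<Rightarrow> bool" where
  "sol_pair w w' \<longleftrightarrow> (\<forall>x>0. (w has_real_derivative w' x) (at x)) \<and> (\<forall>x>0. (w' has_real_derivative pot x * w x) (at x))"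

lemma sol_pairs: "sol_pair solu solu'" "sol_pair solv solv'"
  using solu_deriv solu'_deriv solv_deriv solv'_deriv by (auto simp: sol_pair_def)

lemma FTC_of_real:
  fixes w w' :: "real \<Rightarrow> real" and c x :: real
  assumes "\<And>x. x > 0 \<Longrightarrow> (w has_real_derivative w' x) (at x)" "continuous_on {0<..} w'" "0 < c" "c \<le> x"
  shows "complex_of_real (w x) = of_real (w c) + integral {c..x} (\<lambda>t. of_real (w' t))"
proof -
  have "((\<lambda>t. complex_of_real (w' t)) has_integral (complex_of_real (w x) - of_real (w c))) {c..x}"
  proof (rule fundamental_theorem_of_calculus[OF assms(4)])
    fix t assume "t \<in> {c..x}"
    then have "(w has_vector_derivative w' t) (at t within {c..x})"
      using assms(1)[of t] assms(3)
      by (simp add: has_real_derivative_iff_has_vector_derivative has_vector_derivative_at_within)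
    then show "((\<lambda>t. complex_of_real (w t)) has_vector_derivative of_real (w' t)) (at t within {c..x})"
      by (rule bounded_linear.has_vector_derivative[OF bounded_linear_of_real])
  qed
  then show ?thesis by (simp add: integral_unique)
qed

lemma abs_int_of_real:
  fixes w' :: "real \<Rightarrow> real" and c x :: real
  assumes "continuous_on {0<..} w'" "0 < c"
  shows "(\<lambda>t. complex_of_real (w' t)) absolutely_integrable_on {c..x}"
  by (rule absolutely_integrable_continuous_real)
    (use assms in \<open>auto intro!: continuous_intros continuous_on_subset[OF assms(1)]\<close>)

lemma continuous_pot: "continuous_on {0<..} pot"
  unfolding pot_def by (intro continuous_intros) auto

lemma sol_pair_continuous:
  assumes "sol_pair w w'"
  shows "continuous_on {0<..} w" "continuous_on {0<..} w'" "continuous_on {0<..} (\<lambda>x. pot x * w x)"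
proof -
  show 1: "continuous_on {0<..} w" "continuous_on {0<..} w'"
    using assms by (auto simp: sol_pair_def intro!: continuous_at_imp_continuous_on DERIV_isCont)
  show "continuous_on {0<..} (\<lambda>x. pot x * w x)" by (intro continuous_intros 1 continuous_pot)
qed

text \<open>
An absolutely continuous function times a solution, or times the derivative of a solution. Both are
differences of indefinite integrals on \<open>[c,x]\<close>, away from the singularity.
\<close>

lemma sol_pair_product:
  fixes F p :: "real \<Rightarrow> complex"
  assumes w: "sol_pair w w'" and c: "0 < c" "c \<le> x"
    and p: "p absolutely_integrable_on {c..x}"
    and F0: "\<forall>y\<in>{c..x}. F y = F c + integral {c..y} p"
  shows "F x * of_real (w x) = F c * of_real (w c) + integral {c..x} (\<lambda>t. p t * of_real (w t) + F t * of_real (w' t))"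
    "(\<lambda>t. p t * of_real (w t) + F t * of_real (w' t)) integrable_on {c..x}"
    "F x * of_real (w' x) = F c * of_real (w' c) + integral {c..x} (\<lambda>t. p t * of_real (w' t) + F t * of_real (pot t * w t))"
    "(\<lambda>t. p t * of_real (w' t) + F t * of_real (pot t * w t)) integrable_on {c..x}"
proof -
  note cont = sol_pair_continuous[OF w]
  have F: "\<And>y. y \<in> {c..x} \<Longrightarrow> F y = F c + integral {c..y} p" using F0 by blast
  have d: "\<And>x. x > 0 \<Longrightarrow> (w has_real_derivative w' x) (at x)" "\<And>x. x > 0 \<Longrightarrow> (w' has_real_derivative pot x * w x) (at x)"
    using w by (auto simp: sol_pair_def)
  have f: "complex_of_real (w y) = of_real (w c) + integral {c..y} (\<lambda>t. of_real (w' t))"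
    "complex_of_real (w' y) = of_real (w' c) + integral {c..y} (\<lambda>t. of_real (pot t * w t))" if "y \<in> {c..x}" for y
  proof -
    have y: "c \<le> y" using that by simp
    show "complex_of_real (w y) = of_real (w c) + integral {c..y} (\<lambda>t. of_real (w' t))"
      by (rule FTC_of_real[OF d(1) cont(2) c(1) y])
    show "complex_of_real (w' y) = of_real (w' c) + integral {c..y} (\<lambda>t. of_real (pot t * w t))"
      by (rule FTC_of_real[OF d(2) cont(3) c(1) y])
  qed
  note r1 = ac_product_rule[OF p abs_int_of_real[OF cont(2) c(1)] F f(1) c(2)]
  note r2 = ac_product_rule[OF p abs_int_of_real[OF cont(3) c(1)] F f(2) c(2)]
  show "F x * of_real (w x) = F c * of_real (w c) + integral {c..x} (\<lambda>t. p t * of_real (w t) + F t * of_real (w' t))"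
    "F x * of_real (w' x) = F c * of_real (w' c) + integral {c..x} (\<lambda>t. p t * of_real (w' t) + F t * of_real (pot t * w t))"
    using r1(1) r2(1) by auto
  show "(\<lambda>t. p t * of_real (w t) + F t * of_real (w' t)) integrable_on {c..x}"
    "(\<lambda>t. p t * of_real (w' t) + F t * of_real (pot t * w t)) integrable_on {c..x}"
    using r1(2) r2(2) set_lebesgue_integral_eq_integral(1) by blast+
qed

text \<open>
For \<open>f = \<alpha> u - \<beta> v\<close> with \<open>\<alpha>' = v k\<close> and \<open>\<beta>' = u k\<close> the terms with \<open>k\<close> cancel in \<open>f'\<close>, and in \<open>f''\<close> they
add up to \<open>- k\<close> by the Wronskian. The coefficients are only absolutely continuous, so both statements are
made in integrated form.
\<close>

lemma variation_of_parameters: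
  fixes \<alpha> \<beta> k :: "real \<Rightarrow> complex"
  assumes k: "sq_integrable b k" and c: "0 < c" "c \<le> x" "x \<le> b"
    and \<alpha>: "\<And>y. y \<in> {c..x} \<Longrightarrow> \<alpha> y = \<alpha> c + integral {c..y} (\<lambda>t. of_real (solv t) * k t)"
    and \<beta>: "\<And>y. y \<in> {c..x} \<Longrightarrow> \<beta> y = \<beta> c + integral {c..y} (\<lambda>t. of_real (solu t) * k t)"
  shows "\<alpha> x * of_real (solu x) - \<beta> x * of_real (solv x) = \<alpha> c * of_real (solu c) - \<beta> c * of_real (solv c)
     + integral {c..x} (\<lambda>t. \<alpha> t * of_real (solu' t) - \<beta> t * of_real (solv' t))"
    "\<alpha> x * of_real (solu' x) - \<beta> x * of_real (solv' x) = \<alpha> c * of_real (solu' c) - \<beta> c * of_real (solv' c)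
     + integral {c..x} (\<lambda>t. of_real (pot t) * (\<alpha> t * of_real (solu t) - \<beta> t * of_real (solv t)) - k t)"
proof -
  have "0 \<le> c" using c by simp
  note pv = abs_int_weight[OF sq_weight_sol(2) k this c(3)] and pu = abs_int_weight[OF sq_weight_sol(1) k this c(3)]
  have \<alpha>': "\<forall>y\<in>{c..x}. \<alpha> y = \<alpha> c + integral {c..y} (\<lambda>t. of_real (solv t) * k t)"
    and \<beta>': "\<forall>y\<in>{c..x}. \<beta> y = \<beta> c + integral {c..y} (\<lambda>t. of_real (solu t) * k t)"
    using \<alpha> \<beta> by blast+
  note a = sol_pair_product[OF sol_pairs(1) c(1,2) pv \<alpha>']
  note d = sol_pair_product[OF sol_pairs(2) c(1,2) pu \<beta>']
  have "\<alpha> x * of_real (solu x) - \<beta> x * of_real (solv x) = \<alpha> c * of_real (solu c) - \<beta> c * of_real (solv c)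
     + integral {c..x} (\<lambda>t. (of_real (solv t) * k t * of_real (solu t) + \<alpha> t * of_real (solu' t)) -
          (of_real (solu t) * k t * of_real (solv t) + \<beta> t * of_real (solv' t)))"
    using arg_cong2[where f=minus, OF a(1) d(1), unfolded add_diff_add integral_diff[OF a(2) d(2), symmetric]] by (simp only: add_diff_add)
  also have "integral {c..x} (\<lambda>t. (of_real (solv t) * k t * of_real (solu t) + \<alpha> t * of_real (solu' t)) -
          (of_real (solu t) * k t * of_real (solv t) + \<beta> t * of_real (solv' t)))
     = integral {c..x} (\<lambda>t. \<alpha> t * of_real (solu' t) - \<beta> t * of_real (solv' t))"
    by (rule integral_cong) (simp add: algebra_simps)
  finally show "\<alpha> x * of_real (solu x) - \<beta> x * of_real (solv x) = \<alpha> c * of_real (solu c) - \<beta> c * of_real (solv c)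
     + integral {c..x} (\<lambda>t. \<alpha> t * of_real (solu' t) - \<beta> t * of_real (solv' t))" .
  have "\<alpha> x * of_real (solu' x) - \<beta> x * of_real (solv' x) = \<alpha> c * of_real (solu' c) - \<beta> c * of_real (solv' c)
     + integral {c..x} (\<lambda>t. (of_real (solv t) * k t * of_real (solu' t) + \<alpha> t * of_real (pot t * solu t)) -
          (of_real (solu t) * k t * of_real (solv' t) + \<beta> t * of_real (pot t * solv t)))"
    using arg_cong2[where f=minus, OF a(3) d(3), unfolded add_diff_add integral_diff[OF a(4) d(4), symmetric]] by (simp only: add_diff_add)
  also have "integral {c..x} (\<lambda>t. (of_real (solv t) * k t * of_real (solu' t) + \<alpha> t * of_real (pot t * solu t)) -
          (of_real (solu t) * k t * of_real (solv' t) + \<beta> t * of_real (pot t * solv t)))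
     = integral {c..x} (\<lambda>t. of_real (pot t) * (\<alpha> t * of_real (solu t) - \<beta> t * of_real (solv t)) - k t)"
  proof (rule integral_cong)
    fix t assume "t \<in> {c..x}"
    then have "solu t * solv' t - solu' t * solv t = 1" using wronskian[of t] c by auto
    then have "complex_of_real (solu t) * of_real (solv' t) = 1 + of_real (solu' t) * of_real (solv t)"
      by (metis (no_types, lifting) add_diff_cancel_left' diff_add_cancel of_real_1 of_real_add of_real_mult)
    then show "(of_real (solv t) * k t * of_real (solu' t) + \<alpha> t * of_real (pot t * solu t)) -
          (of_real (solu t) * k t * of_real (solv' t) + \<beta> t * of_real (pot t * solv t))
      = of_real (pot t) * (\<alpha> t * of_real (solu t) - \<beta> t * of_real (solv t)) - k t"
      unfolding of_real_mult by algebra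
  qed
  finally show "\<alpha> x * of_real (solu' x) - \<beta> x * of_real (solv' x) = \<alpha> c * of_real (solu' c) - \<beta> c * of_real (solv' c)
     + integral {c..x} (\<lambda>t. of_real (pot t) * (\<alpha> t * of_real (solu t) - \<beta> t * of_real (solv t)) - k t)" .
qed

text \<open>
The converse of variation of parameters: the bracket of \<open>f\<close> with a solution \<open>w\<close> has the density \<open>w \<tau> f\<close>.
\<close>

lemma lagrange_identity:
  fixes f f1 f2 :: "real \<Rightarrow> complex"
  assumes w: "sol_pair w w'" and c: "0 < c" "c \<le> x"
    and p: "f1 absolutely_integrable_on {c..x}" "f2 absolutely_integrable_on {c..x}"
    and f: "\<And>y. y \<in> {c..x} \<Longrightarrow> f y = f c + integral {c..y} f1"
    and f1: "\<And>y. y \<in> {c..x} \<Longrightarrow> f1 y = f1 c + integral {c..y} f2"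
  shows "f x * of_real (w' x) - f1 x * of_real (w x) = f c * of_real (w' c) - f1 c * of_real (w c)
    + integral {c..x} (\<lambda>t. of_real (w t) * (of_real (pot t) * f t - f2 t))"
proof -
  have f': "\<forall>y\<in>{c..x}. f y = f c + integral {c..y} f1" and f1': "\<forall>y\<in>{c..x}. f1 y = f1 c + integral {c..y} f2"
    using f f1 by blast+
  note a = sol_pair_product[OF w c p(1) f']
  note d = sol_pair_product[OF w c p(2) f1']
  have "f x * of_real (w' x) - f1 x * of_real (w x) = f c * of_real (w' c) - f1 c * of_real (w c)
    + integral {c..x} (\<lambda>t. (f1 t * of_real (w' t) + f t * of_real (pot t * w t)) - (f2 t * of_real (w t) + f1 t * of_real (w' t)))"
    using arg_cong2[where f=minus, OF a(3) d(1), unfolded add_diff_add integral_diff[OF a(4) d(2), symmetric]] by (simp only: add_diff_add)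
  also have "integral {c..x} (\<lambda>t. (f1 t * of_real (w' t) + f t * of_real (pot t * w t)) - (f2 t * of_real (w t) + f1 t * of_real (w' t)))
    = integral {c..x} (\<lambda>t. of_real (w t) * (of_real (pot t) * f t - f2 t))"
    by (rule integral_cong) (simp add: algebra_simps)
  finally show ?thesis .
qed

end

section \<open>The minimal operator and its adjoint\<close>

context bessel_setting
begin

text \<open>
Weaker than \<open>solu_bound\<close>, but of the same form as the bound for \<open>solv\<close>, so that one limit argument
covers both solutions.
\<close>

lemma solu_weak_bound:
  "\<exists>C\<ge>0. \<forall>x. 0 < x \<longrightarrow> x \<le> b \<longrightarrow> \<bar>solu x\<bar> \<le> C * x powr (1/2 - sing) \<and> \<bar>solu' x\<bar> \<le> C * x powr (-1/2 - sing)"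
proof (intro exI conjI allI impI)
  let ?C = "2 * b powr (\<nu> + sing)"
  fix x assume x: "0 < x" "x \<le> b"
  have 1: "x powr (1/2 + \<nu>) \<le> b powr (1/2 + \<nu> - (1/2 - sing)) * x powr (1/2 - sing)"
    by (rule powr_le_powr_b[OF x]) (use sing_bounds nu_nonneg in auto)
  have 2: "x powr (\<nu> - 1/2) \<le> b powr (\<nu> - 1/2 - (-1/2 - sing)) * x powr (-1/2 - sing)"
    by (rule powr_le_powr_b[OF x]) (use sing_bounds nu_nonneg in auto)
  have "0 \<le> b powr (\<nu> + sing) * x powr (1/2 - sing)" by simp
  moreover have "x powr (1/2 + \<nu>) \<le> b powr (\<nu> + sing) * x powr (1/2 - sing)" using 1 by simp
  ultimately show "\<bar>solu x\<bar> \<le> ?C * x powr (1/2 - sing)" unfolding solu_bound(1) by linarith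
  from 2 show "\<bar>solu' x\<bar> \<le> ?C * x powr (-1/2 - sing)" using solu_bound(2)[of x] by simp
qed auto

lemma solv_weak_bound:
  "\<exists>C\<ge>0. \<forall>x. 0 < x \<longrightarrow> x \<le> b \<longrightarrow> \<bar>solv x\<bar> \<le> C * x powr (1/2 - sing) \<and> \<bar>solv' x\<bar> \<le> C * x powr (-1/2 - sing)"
proof -
  obtain C1 C2 where C: "C1 \<ge> 0" "C2 \<ge> 0"
    "\<And>x. 0 < x \<Longrightarrow> x \<le> b \<Longrightarrow> \<bar>solv x\<bar> \<le> C1 * x powr (1/2 - sing)"
    "\<And>x. 0 < x \<Longrightarrow> x \<le> b \<Longrightarrow> \<bar>solv' x\<bar> \<le> C2 * x powr (-1/2 - sing)"
    using solv_bound solv'_bound by blast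
  show ?thesis
  proof (intro exI[of _ "C1 + C2"] conjI allI impI)
    fix x assume x: "0 < x" "x \<le> b"
    have "0 \<le> C2 * x powr (1/2 - sing)" "0 \<le> C1 * x powr (-1/2 - sing)" using C by auto
    then show "\<bar>solv x\<bar> \<le> (C1 + C2) * x powr (1/2 - sing)" "\<bar>solv' x\<bar> \<le> (C1 + C2) * x powr (-1/2 - sing)"
      using C(3,4)[OF x] by (auto simp: distrib_right)
  qed (use C in auto)
qed

text \<open>
Zero data at \<open>0\<close> give \<open>\<bar>f x\<bar> \<le> x\<close> times the integral of \<open>\<bar>f''\<bar>\<close> over \<open>(0,x)\<close>. Hardy's inequality with exponent
\<open>1/2\<close> then yields \<open>q f \<in> L\<^sup>2\<close>, and the same estimate shows that the brackets with both solutions tend to \<open>0\<close> at \<open>0\<close>.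
Hence the brackets are the integrals from \<open>0\<close>, and \<open>f\<close> is recovered from them by the Wronskian.
\<close>

lemma H2_zero_data:
  assumes H2: "sobolev_H2 b f f1 f2" and f0: "f 0 = 0" and f10: "f1 0 = 0"
  shows "sq_integrable b (\<lambda>x. of_real (pot x) * f x - f2 x)"
    "\<And>x. 0 < x \<Longrightarrow> x \<le> b \<Longrightarrow> f x = Vol0 (\<lambda>x. of_real (pot x) * f x - f2 x) x"
proof -
  define M where "M x = integral {0..x} (\<lambda>t. t powr 0 * norm (f2 t))" for x
  have sf2: "sq_integrable b f2" using H2 by (simp add: sobolev_H2_def)
  have f1_eq: "f1 x = integral {0..x} f2" if "x \<in> {0..b}" for x
    using H2 that by (simp add: sobolev_H2_def f10)
  have f_eq: "f x = integral {0..x} f1" if "x \<in> {0..b}" for x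
    using H2 that by (simp add: sobolev_H2_def f0)
  have ai2: "f2 absolutely_integrable_on {0..b}" by (rule sq_integrable_imp_absolutely_integrable[OF sf2])
  then have i2: "f2 integrable_on {0..b}" using set_lebesgue_integral_eq_integral(1) by blast
  have c1: "continuous_on {0..b} f1"
    by (rule continuous_on_eq[OF indefinite_integral_continuous_1[OF i2]]) (use f1_eq in auto)
  then have i1: "f1 integrable_on {0..b}" by (rule integrable_continuous_real)
  have cf: "continuous_on {0..b} f"
    by (rule continuous_on_eq[OF indefinite_integral_continuous_1[OF i1]]) (use f_eq in auto)
  have Mi: "(\<lambda>t. t powr 0 * norm (f2 t)) integrable_on {0..x}" if "0 \<le> x" "x \<le> b" for x
    by (rule powr_mult_sq_integrable[OF _ b_pos sf2]) (use that in auto)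
  have Mmono: "M x \<le> M y" if "0 \<le> x" "x \<le> y" "y \<le> b" for x y
    unfolding M_def by (rule integral_subset_le) (use that Mi in auto)
  have b1: "norm (f1 x) \<le> M x" if x: "0 \<le> x" "x \<le> b" for x
  proof -
    have "norm (f1 x) = norm (integral {0<..<x} f2)"
      using f1_eq x by (simp add: integral_open_interval_real)
    also have "\<dots> \<le> integral {0<..<x} (\<lambda>t. t powr 0 * norm (f2 t))"
    proof (rule integral_norm_bound_integral)
      have "f2 integrable_on {0..x}" by (rule integrable_on_subinterval[OF i2]) (use x in auto)
      then show "f2 integrable_on {0<..<x}" by (simp add: integrable_on_Icc_iff_Ioo)
      show "(\<lambda>t. t powr 0 * norm (f2 t)) integrable_on {0<..<x}"
        using Mi[OF x] by (simp add: integrable_on_Icc_iff_Ioo)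
    qed auto
    finally show ?thesis by (simp add: M_def integral_open_interval_real)
  qed
  have bf: "norm (f x) \<le> x * M x" if x: "0 \<le> x" "x \<le> b" for x
  proof -
    have "norm (f x) = norm (integral {0..x} f1)" using f_eq x by simp
    also have "\<dots> \<le> integral {0..x} (\<lambda>t. M x)"
    proof (rule integral_norm_bound_integral)
      show "f1 integrable_on {0..x}" by (rule integrable_on_subinterval[OF i1]) (use x in auto)
      show "norm (f1 t) \<le> M x" if "t \<in> {0..x}" for t
        using b1[of t] Mmono[of t x] that x by auto
    qed auto
    finally show ?thesis using x by simp
  qed
  define D where "D = sqrt (sqnorm b f2) / sqrt (2 * 0 + 1)"
  have D: "M x \<le> D * x powr (1/2)" if "0 < x" "x \<le> b" for x
    using integral_powr_sq_le[of 0, OF _ sf2 that] by (simp add: M_def D_def)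
  have sqf: "sq_integrable b (\<lambda>x. of_real (pot x) * f x)"
  proof (rule hardy_inequality[of "1/2", OF _ b_pos sf2])
    have "continuous_on {0<..<b} (\<lambda>x. of_real (pot x) * f x)"
      by (intro continuous_intros continuous_on_subset[OF cf] continuous_on_subset[OF continuous_pot]) auto
    then show "(\<lambda>x. of_real (pot x) * f x) \<in> borel_measurable (leb b)"
      by (rule continuous_imp_measurable_on_sets_lebesgue) auto
    fix x assume x: "0 < x" "x < b"
    have "norm (of_real (pot x) * f x) = \<bar>\<nu>\<^sup>2 - 1/4\<bar> / x\<^sup>2 * norm (f x)"
      unfolding norm_mult norm_of_real pot_def by (simp add: abs_divide)
    also have "\<dots> \<le> \<bar>\<nu>\<^sup>2 - 1/4\<bar> / x\<^sup>2 * (x * M x)"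
      using bf[of x] x by (intro mult_left_mono) auto
    also have "\<dots> = \<bar>\<nu>\<^sup>2 - 1/4\<bar> * (x powr (1/2 - 3/2) * M x)"
      using x by (simp add: powr_minus_divide power2_eq_square field_simps)
    finally show "norm (of_real (pot x) * f x) \<le> \<bar>\<nu>\<^sup>2 - 1/4\<bar> * (x powr (1/2 - 3/2) *
       integral {0..x} (\<lambda>t. t powr (1/2 - 1/2) * norm (f2 t)))" by (simp add: M_def)
  qed simp
  let ?g = "\<lambda>x. of_real (pot x) * f x - f2 x"
  show sg: "sq_integrable b ?g" by (rule sq_integrable_diff[OF sqf sf2])
  have key: "f x * of_real (w' x) - f1 x * of_real (w x) = lower w ?g x"
    if w: "sol_pair w w'" and aw: "sq_weight w" and C: "0 \<le> C"
      "\<forall>x. 0 < x \<longrightarrow> x \<le> b \<longrightarrow> \<bar>w x\<bar> \<le> C * x powr (1/2 - sing) \<and> \<bar>w' x\<bar> \<le> C * x powr (-1/2 - sing)"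
      and x: "0 < x" "x \<le> b" for w w' C x
  proof -
    have "f x * of_real (w' x) - f1 x * of_real (w x) = 0 + integral {0..x} (\<lambda>t. of_real (w t) * ?g t)"
    proof (rule indefinite_integral_from_limit[where F="\<lambda>x. f x * of_real (w' x) - f1 x * of_real (w x)", OF _ _ _ x])
      show "(\<lambda>t. of_real (w t) * ?g t) absolutely_integrable_on {0..b}"
        by (rule abs_int_weight[OF aw sg]) auto
      fix c x assume c: "0 < c" "c \<le> x" "x \<le> b"
      show "f x * of_real (w' x) - f1 x * of_real (w x) = f c * of_real (w' c) - f1 c * of_real (w c)
         + integral {c..x} (\<lambda>t. of_real (w t) * ?g t)"
      proof (rule lagrange_identity[OF w c(1,2)])
        show "f1 absolutely_integrable_on {c..x}"
          by (rule absolutely_integrable_continuous_real) (use c in \<open>auto intro: continuous_on_subset[OF c1]\<close>)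
        show "f2 absolutely_integrable_on {c..x}"
          by (rule absolutely_integrable_on_subinterval[OF ai2]) (use c in auto)
        fix y assume y: "y \<in> {c..x}"
        have "integral {0..c} f1 + integral {c..y} f1 = integral {0..y} f1"
          by (rule Henstock_Kurzweil_Integration.integral_combine)
            (use c y in \<open>auto intro: integrable_on_subinterval[OF i1]\<close>)
        then show "f y = f c + integral {c..y} f1" using f_eq c y by auto
        have "integral {0..c} f2 + integral {c..y} f2 = integral {0..y} f2"
          by (rule Henstock_Kurzweil_Integration.integral_combine)
            (use c y in \<open>auto intro: integrable_on_subinterval[OF i2]\<close>)
        then show "f1 y = f1 c + integral {c..y} f2" using f1_eq c y by auto
      qed
    next
      show "((\<lambda>x. f x * of_real (w' x) - f1 x * of_real (w x)) \<longlongrightarrow> 0) (at_right 0)"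
      proof (rule tendsto_0_powr_bound[OF _ b_pos])
        show "0 < 1 - sing" using sing_bounds by simp
        fix x assume x: "0 < x" "x \<le> b"
        have "norm (f x * of_real (w' x) - f1 x * of_real (w x)) \<le> norm (f x) * \<bar>w' x\<bar> + norm (f1 x) * \<bar>w x\<bar>"
          by (rule order_trans[OF norm_triangle_ineq4]) (simp add: norm_mult)
        also have "\<dots> \<le> (x * M x) * (C * x powr (-1/2 - sing)) + M x * (C * x powr (1/2 - sing))"
          using bf[of x] b1[of x] C(2)[rule_format, OF x] x order_trans[OF norm_ge_zero b1[of x]]
          by (intro add_mono mult_mono) auto
        also have "\<dots> = 2 * C * x powr (1/2 - sing) * M x"
        proof -
          have "1/2 - sing = 1 + (-1/2 - sing)" by simp
          then have "x powr (1/2 - sing) = x * x powr (-1/2 - sing)" using x by (simp only: powr_add powr_one)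
          then show ?thesis by (simp add: algebra_simps)
        qed
        also have "\<dots> \<le> 2 * C * x powr (1/2 - sing) * (D * x powr (1/2))"
          using C x by (intro mult_left_mono D) auto
        also have "\<dots> = 2 * C * D * (x powr (1/2 - sing) * x powr (1/2))" by simp
        also have "x powr (1/2 - sing) * x powr (1/2) = x powr (1 - sing)"
          by (simp add: powr_add[symmetric])
        finally show "norm (f x * of_real (w' x) - f1 x * of_real (w x)) \<le> 2 * C * D * x powr (1 - sing)" .
      qed
    qed
    then show ?thesis by (simp add: lower_def)
  qed
  show "f x = Vol0 ?g x" if x: "0 < x" "x \<le> b" for x
  proof -
    obtain C where C: "C \<ge> 0" "\<forall>x. 0 < x \<longrightarrow> x \<le> b \<longrightarrow> \<bar>solu x\<bar> \<le> C * x powr (1/2 - sing) \<and> \<bar>solu' x\<bar> \<le> C * x powr (-1/2 - sing)"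
      using solu_weak_bound by blast
    obtain C' where C': "C' \<ge> 0" "\<forall>x. 0 < x \<longrightarrow> x \<le> b \<longrightarrow> \<bar>solv x\<bar> \<le> C' * x powr (1/2 - sing) \<and> \<bar>solv' x\<bar> \<le> C' * x powr (-1/2 - sing)"
      using solv_weak_bound by blast
    have "Vol0 ?g x = of_real (solu x) * (f x * of_real (solv' x) - f1 x * of_real (solv x))
      - of_real (solv x) * (f x * of_real (solu' x) - f1 x * of_real (solu x))"
      unfolding Vol0_def key[OF sol_pairs(1) sq_weight_sol(1) C x] key[OF sol_pairs(2) sq_weight_sol(2) C' x] ..
    also have "\<dots> = f x * of_real (solu x * solv' x - solu' x * solv x)"
      by (simp add: algebra_simps)
    finally show ?thesis using wronskian[of x] x by simp
  qed
qed

text \<open>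
The integrals of an \<open>L\<^sup>2\<close> function against the two solutions are \<open>O(x\<^sup>1\<^sup>+\<^sup>\<nu>)\<close> and \<open>O(x\<^sup>1\<^sup>-\<^sup>s)\<close> with \<open>s = sing\<close>.
Because \<open>sing < 1/2 + \<nu>\<close>, this is enough for \<open>Vol0 h\<close> and its derivative to vanish at \<open>0\<close>.
\<close>

lemma H2_Vol0:
  assumes h: "sq_integrable b h"
  defines "f1 \<equiv> \<lambda>x. of_real (solu' x) * lower solv h x - of_real (solv' x) * lower solu h x"
  shows "sobolev_H2 b (Vol0 h) f1 (\<lambda>x. of_real (pot x) * Vol0 h x - h x)" "Vol0 h 0 = 0" "f1 0 = 0"
proof -
  let ?f2 = "\<lambda>x. of_real (pot x) * Vol0 h x - h x"
  show K0: "Vol0 h 0 = 0" and f10: "f1 0 = 0" by (simp_all add: Vol0_def f1_def)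
  have "sq_integrable b (\<lambda>x. of_real (\<nu>\<^sup>2 - 1/4) * (Vol0 h x / of_real (x\<^sup>2)))"
    by (intro sq_integrable_scale sq_Vol0_div h)
  then have s2: "sq_integrable b ?f2"
    using h by (intro sq_integrable_diff) (simp_all add: pot_def)
  have ai2: "?f2 absolutely_integrable_on {0..b}" by (rule sq_integrable_imp_absolutely_integrable[OF s2])
  note vp = variation_of_parameters[OF h, of _ _ "lower solv h" "lower solu h"]
  have step: "Vol0 h x = Vol0 h c + integral {c..x} f1" "f1 x = f1 c + integral {c..x} ?f2"
    if c: "0 < c" "c \<le> x" "x \<le> b" for c x
  proof -
    have 1: "lower solv h y = lower solv h c + integral {c..y} (\<lambda>t. of_real (solv t) * h t)" if "y \<in> {c..x}" for y
      by (rule lower_split[OF sq_weight_sol(2) h]) (use that c in auto)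
    have 2: "lower solu h y = lower solu h c + integral {c..y} (\<lambda>t. of_real (solu t) * h t)" if "y \<in> {c..x}" for y
      by (rule lower_split[OF sq_weight_sol(1) h]) (use that c in auto)
    note v = vp[OF c 1 2]
    show "Vol0 h x = Vol0 h c + integral {c..x} f1" "f1 x = f1 c + integral {c..x} ?f2"
      using v by (simp_all add: Vol0_def f1_def mult.commute)
  qed
  obtain Du where Du: "Du \<ge> 0" "\<And>x. 0 < x \<Longrightarrow> x \<le> b \<Longrightarrow> norm (lower solu h x) \<le> Du * x powr (1 + \<nu>)"
    using lower_solu_bound[OF h] by blast
  obtain Dv where Dv: "Dv \<ge> 0" "\<And>x. 0 < x \<Longrightarrow> x \<le> b \<Longrightarrow> norm (lower solv h x) \<le> Dv * x powr (1 - sing)"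
    using lower_solv_bound[OF h] by blast
  obtain C where C: "C \<ge> 0" "\<And>x. 0 < x \<Longrightarrow> x \<le> b \<Longrightarrow> \<bar>solv x\<bar> \<le> C * x powr (1/2 - sing) \<and> \<bar>solv' x\<bar> \<le> C * x powr (-1/2 - sing)"
    using solv_weak_bound by blast
  have lim1: "(f1 \<longlongrightarrow> 0) (at_right 0)"
  proof (rule tendsto_0_powr_bound[OF _ b_pos])
    show "0 < 1/2 + \<nu> - sing" using sing_bounds by simp
    fix x assume x: "0 < x" "x \<le> b"
    have "norm (f1 x) \<le> \<bar>solu' x\<bar> * norm (lower solv h x) + \<bar>solv' x\<bar> * norm (lower solu h x)"
      unfolding f1_def by (rule order_trans[OF norm_triangle_ineq4]) (simp add: norm_mult)
    also have "\<dots> \<le> (2 * x powr (\<nu> - 1/2)) * (Dv * x powr (1 - sing)) + (C * x powr (-1/2 - sing)) * (Du * x powr (1 + \<nu>))"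
      using Du(2)[OF x] Dv(2)[OF x] C(2)[OF x] solu_bound(2)[of x] C(1)
      by (intro add_mono mult_mono) auto
    also have "\<dots> = 2 * Dv * (x powr (\<nu> - 1/2) * x powr (1 - sing)) + C * Du * (x powr (-1/2 - sing) * x powr (1 + \<nu>))"
      by simp
    also have "\<dots> = (2 * Dv + C * Du) * x powr (1/2 + \<nu> - sing)"
      by (simp add: powr_add[symmetric] algebra_simps)
    finally show "norm (f1 x) \<le> (2 * Dv + C * Du) * x powr (1/2 + \<nu> - sing)" .
  qed
  have limK: "(Vol0 h \<longlongrightarrow> 0) (at_right 0)"
  proof (rule tendsto_0_powr_bound[OF _ b_pos])
    show "0 < 3/2 + \<nu> - sing" using sing_bounds by simp
    fix x assume x: "0 < x" "x \<le> b"
    have "norm (Vol0 h x) \<le> \<bar>solu x\<bar> * norm (lower solv h x) + \<bar>solv x\<bar> * norm (lower solu h x)"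
      unfolding Vol0_def by (rule order_trans[OF norm_triangle_ineq4]) (simp add: norm_mult)
    also have "\<dots> \<le> (x powr (1/2 + \<nu>)) * (Dv * x powr (1 - sing)) + (C * x powr (1/2 - sing)) * (Du * x powr (1 + \<nu>))"
      using Du(2)[OF x] Dv(2)[OF x] C(2)[OF x] solu_bound(1)[of x] C(1)
      by (intro add_mono mult_mono) auto
    also have "\<dots> = Dv * (x powr (1/2 + \<nu>) * x powr (1 - sing)) + C * Du * (x powr (1/2 - sing) * x powr (1 + \<nu>))"
      by simp
    also have "\<dots> = (Dv + C * Du) * x powr (3/2 + \<nu> - sing)"
      by (simp add: powr_add[symmetric] algebra_simps)
    finally show "norm (Vol0 h x) \<le> (Dv + C * Du) * x powr (3/2 + \<nu> - sing)" .
  qed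
  have f1_int: "f1 x = 0 + integral {0..x} ?f2" if "0 < x" "x \<le> b" for x
    by (rule indefinite_integral_from_limit[OF ai2 step(2) lim1 that])
  have c1: "continuous_on {0..b} f1"
  proof (rule continuous_on_eq)
    show "continuous_on {0..b} (\<lambda>x. integral {0..x} ?f2)"
      using ai2 set_lebesgue_integral_eq_integral(1) by (intro indefinite_integral_continuous_1) blast
    show "integral {0..x} ?f2 = f1 x" if "x \<in> {0..b}" for x
      using f1_int[of x] f10 that by (cases "x = 0") auto
  qed
  have ai1: "f1 absolutely_integrable_on {0..b}"
    by (rule absolutely_integrable_continuous_real[OF c1])
  have K_int: "Vol0 h x = 0 + integral {0..x} f1" if "0 < x" "x \<le> b" for x
    by (rule indefinite_integral_from_limit[OF ai1 step(1) limK that])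
  show "sobolev_H2 b (Vol0 h) f1 ?f2"
    unfolding sobolev_H2_def
  proof (intro conjI ballI s2)
    fix x assume "x \<in> {0..b}"
    then show "f1 x = f1 0 + integral {0..x} ?f2" "Vol0 h x = Vol0 h 0 + integral {0..x} f1"
      using f1_int[of x] K_int[of x] f10 K0 by (cases "x = 0"; auto)+
  qed
qed

theorem bessel_operator_eq:
  "Amin = {(L2_class b (Vol0 h), L2_class b h) | h. sq_integrable b h \<and> sqinner b h phi = 0}"
  (is "_ = ?R")
proof (intro subset_antisym subsetI)
  fix p assume "p \<in> Amin"
  then obtain f f1 f2 where f: "sobolev_H2 b f f1 f2" "f 0 = 0" "f1 0 = 0" "f b = 0"
    and p: "p = (L2_class b f, L2_class b (\<lambda>x. - f2 x + of_real ((\<nu>\<^sup>2 - 1/4) / x\<^sup>2) * f x))"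
    unfolding bessel_operator_def by blast
  let ?g = "\<lambda>x. of_real (pot x) * f x - f2 x"
  note g = H2_zero_data[OF f(1-3)]
  have "L2_class b f = L2_class b (Vol0 ?g)" by (rule L2_class_cong_Ioo) (use g in auto)
  moreover have "L2_class b (\<lambda>x. - f2 x + of_real ((\<nu>\<^sup>2 - 1/4) / x\<^sup>2) * f x) = L2_class b ?g"
    by (simp add: pot_def)
  moreover have "sqinner b ?g phi = 0" using Vol0_b[OF g(1)] g(2)[of b] b_pos f(4) by simp
  ultimately show "p \<in> ?R" using p g(1) by blast
next
  fix p assume "p \<in> ?R"
  then obtain h where h: "sq_integrable b h" "sqinner b h phi = 0" "p = (L2_class b (Vol0 h), L2_class b h)"
    by blast
  note H = H2_Vol0[OF h(1)]
  have "Vol0 h b = 0" using Vol0_b[OF h(1)] h(2) by simp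
  moreover have "L2_class b h = L2_class b (\<lambda>x. - (of_real (pot x) * Vol0 h x - h x) + of_real ((\<nu>\<^sup>2 - 1/4) / x\<^sup>2) * Vol0 h x)"
    by (simp add: pot_def)
  ultimately show "p \<in> Amin"
    unfolding bessel_operator_def mem_Collect_eq h(3)
    by (intro exI[of _ "Vol0 h"] exI[of _ "\<lambda>x. of_real (solu' x) * lower solv h x - of_real (solv' x) * lower solu h x"]
        exI[of _ "\<lambda>x. of_real (pot x) * Vol0 h x - h x"] conjI H arg_cong2[where f=Pair] refl) assumption+
qed

lemma phi_deriv:
  assumes "0 < x"
  shows "((\<lambda>x. solv b * solu x - solu b * solv x) has_real_derivative (solv b * solu' x - solu b * solv' x)) (at x)"
  by (intro DERIV_diff DERIV_cmult solu_deriv solv_deriv assms)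

lemma continuous_phi: "continuous_on {0<..} phi"
  unfolding phi_def by (intro continuous_intros continuous_on_sol)

text \<open>
A vanishing norm would force \<open>phi = 0\<close> on \<open>(0,b)\<close>, but \<open>phi\<close> vanishes at \<open>b\<close> with slope \<open>- 1\<close>.
\<close>

lemma sqnorm_phi_pos: "0 < sqnorm b phi"
proof (rule ccontr)
  assume "\<not> 0 < sqnorm b phi"
  then have "sqnorm b phi = 0" using sqnorm_nonneg[of b phi] by simp
  then have AE: "AE x in leb b. phi x = 0" by (simp add: sqnorm_eq_0[OF sq_phi])
  have z: "phi x = 0" if "0 < x" "x < b" for x
    by (rule AE_eq_continuous_imp_eq[OF _ _ AE that])
      (auto intro: continuous_on_subset[OF continuous_phi] continuous_intros)
  let ?f = "\<lambda>x. solv b * solu x - solu b * solv x"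
  have "(?f has_real_derivative -1) (at b)"
    using phi_deriv[OF b_pos] wronskian[OF b_pos] by (simp add: algebra_simps)
  from DERIV_neg_dec_left[OF this] obtain d where d: "d > 0" "\<And>h. 0 < h \<Longrightarrow> h < d \<Longrightarrow> ?f b < ?f (b - h)"
    by auto
  define h where "h = min d b / 2"
  have h: "0 < h" "h < d" "h < b" using d(1) b_pos by (auto simp: h_def)
  have "0 < ?f (b - h)" using d(2)[OF h(1,2)] by simp
  moreover have "?f (b - h) = 0" using z[of "b - h"] h by (simp add: phi_def del: of_real_diff of_real_mult)
  ultimately show False by simp
qed

end

section \<open>Density, symmetry and the adjoint\<close>

lemma orthogonal_dense_imp_zero:
  assumes d: "sq_integrable b d" and D: "\<And>g. g \<in> D \<Longrightarrow> sq_integrable b g \<and> sqinner b d g = 0"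
    and dense: "approximable b D d"
  shows "AE x in leb b. d x = 0"
proof -
  have "sqnorm b d \<le> 0"
  proof (rule ccontr)
    assume "\<not> sqnorm b d \<le> 0"
    then have pos: "0 < sqnorm b d" by simp
    then obtain g where g: "g \<in> D" "sqnorm b (\<lambda>x. d x - g x) < sqnorm b d"
      using dense unfolding approximable_def by blast
    have gs: "sq_integrable b g" "sqinner b d g = 0" using D[OF g(1)] by auto
    have "of_real (sqnorm b d) = sqinner b d (\<lambda>x. d x - g x)"
      by (simp add: sqinner_diff_right d gs sqinner_self)
    then have "sqnorm b d = norm (sqinner b d (\<lambda>x. d x - g x))"
      using pos by (metis abs_of_pos norm_of_real)
    also have "\<dots> \<le> sqrt (sqnorm b d) * sqrt (sqnorm b (\<lambda>x. d x - g x))"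
      by (intro norm_sqinner_le sq_integrable_diff d gs)
    also have "\<dots> < sqrt (sqnorm b d) * sqrt (sqnorm b d)"
      using pos g(2) by (intro mult_strict_left_mono) auto
    also have "\<dots> = sqnorm b d" using pos by simp
    finally show False by simp
  qed
  then show ?thesis using sqnorm_nonneg[of b d] sqnorm_eq_0[OF d] by simp
qed

context bessel_setting
begin

lemma cutoff_polynomial_H2:
  fixes p :: "real \<Rightarrow> complex"
  assumes p: "polynomial_function p"
  obtains f1 f2 where "sobolev_H2 b (\<lambda>x. of_real (cutoff b n x) * p x) f1 f2" "f1 0 = 0"
proof -
  define f where "f = (\<lambda>x. complex_of_real (cutoff b n x) * p x)"
  have rp: "real_polynomial_function (cutoff b n)"
    unfolding cutoff_def[abs_def]
    by (intro real_polynomial_function_power real_polynomial_function_diff real_polynomial_function.intros(2-)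
        real_polynomial_function.intros(1) bounded_linear_ident)
  then have "polynomial_function (\<lambda>x. cutoff b n x *\<^sub>R p x)"
    using p by (intro polynomial_function_mult) (auto simp: real_polynomial_function_eq)
  then have fp: "polynomial_function f" by (simp add: f_def scaleR_conv_of_real)
  obtain f1 where f1: "polynomial_function f1" "\<And>x. (f has_vector_derivative f1 x) (at x)"
    using has_vector_derivative_polynomial_function[OF fp] by blast
  obtain f2 where f2: "polynomial_function f2" "\<And>x. (f1 has_vector_derivative f2 x) (at x)"
    using has_vector_derivative_polynomial_function[OF f1(1)] by blast
  obtain p' where p': "\<And>x. (p has_vector_derivative p' x) (at x)"
    using has_vector_derivative_polynomial_function[OF p] by blast
  define k where "k x = 1 - (1 - 4 / b\<^sup>2 * x * (b - x)) ^ n" for x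
  have "k differentiable (at 0)" unfolding k_def[abs_def] by (intro derivative_intros)
  then obtain D where D: "(k has_real_derivative D) (at 0)" by (auto simp: real_differentiable_def)
  have "((\<lambda>x. (k x)\<^sup>2) has_real_derivative (2 * (D * k 0 ^ (2 - 1)))) (at 0)"
    using DERIV_power[OF D, of 2] by simp
  then have "(cutoff b n has_real_derivative 0) (at 0)"
    by (simp add: k_def cutoff_def[abs_def])
  then have c': "((\<lambda>x. complex_of_real (cutoff b n x)) has_vector_derivative of_real 0) (at 0)"
    by (intro bounded_linear.has_vector_derivative[OF bounded_linear_of_real])
      (simp add: has_real_derivative_iff_has_vector_derivative)
  have "(f has_vector_derivative (of_real (cutoff b n 0) * p' 0 + of_real 0 * p 0)) (at 0)"
    unfolding f_def by (rule has_vector_derivative_mult[OF c' p'])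
  then have "(f has_vector_derivative 0) (at 0)" by (simp add: cutoff_def)
  then have f10: "f1 0 = 0" using vector_derivative_unique_at f1(2) by blast
  have "sobolev_H2 b f f1 f2"
    unfolding sobolev_H2_def
  proof (intro conjI ballI)
    show "sq_integrable b f2"
      by (intro sq_integrable_continuous continuous_on_polymonial_function f2)
    fix x assume x: "x \<in> {0..b}"
    have "(f2 has_integral (f1 x - f1 0)) {0..x}" "(f1 has_integral (f x - f 0)) {0..x}"
      using x f1(2) f2(2)
      by (auto intro!: fundamental_theorem_of_calculus intro: has_vector_derivative_at_within)
    then show "f1 x = f1 0 + integral {0..x} f2" "f x = f 0 + integral {0..x} f1"
      by (simp_all add: integral_unique)
  qed
  then show ?thesis using that f10 by (simp add: f_def)
qed

lemma cutoff_ends: "cutoff b n 0 = 0" "cutoff b n b = 0"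
  by (simp_all add: cutoff_def)

definition dom_funs :: "(real \<Rightarrow> complex) set" where
  "dom_funs = {Vol0 h | h. sq_integrable b h \<and> sqinner b h phi = 0}"

lemma Domain_bessel_operator: "Domain Amin = L2_class b ` dom_funs"
  unfolding bessel_operator_eq dom_funs_def by auto

lemma dom_funs_dense:
  assumes f: "sq_integrable b f"
  shows "approximable b dom_funs f"
  unfolding approximable_def
proof (intro allI impI)
  fix e :: real assume "e > 0"
  then obtain g where "g \<in> {\<lambda>x. complex_of_real (cutoff b n x) * p x | n p. polynomial_function p}"
    and ge: "sqnorm b (\<lambda>x. f x - g x) < e"
    using polynomials_with_cutoff_dense[OF b_pos f] unfolding approximable_def by blast
  then obtain n p where p: "polynomial_function p" and g: "g = (\<lambda>x. complex_of_real (cutoff b n x) * p x)" by auto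
  obtain f1 f2 where H: "sobolev_H2 b g f1 f2" "f1 0 = 0" using cutoff_polynomial_H2[OF p] g by blast
  have g0: "g 0 = 0" "g b = 0" by (simp_all add: g cutoff_ends)
  let ?h = "\<lambda>x. of_real (pot x) * g x - f2 x"
  note h = H2_zero_data[OF H(1) g0(1) H(2)]
  have "sqinner b ?h phi = 0" using Vol0_b[OF h(1)] h(2)[of b] b_pos g0 by simp
  then have "Vol0 ?h \<in> dom_funs" using h(1) by (auto simp: dom_funs_def)
  moreover have "sqnorm b (\<lambda>x. f x - Vol0 ?h x) = sqnorm b (\<lambda>x. f x - g x)"
    unfolding sqnorm_def by (rule Bochner_Integration.integral_cong) (use h(2) in auto)
  ultimately show "\<exists>g\<in>dom_funs. sqnorm b (\<lambda>x. f x - g x) < e"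
    using ge by (intro bexI[of _ "Vol0 ?h"]) simp_all
qed

lemma densely_defined_bessel: "densely_defined X Amin"
  unfolding densely_defined_def Domain_bessel_operator
proof (intro ballI allI impI)
  fix F and e :: real assume F: "F \<in> vcarrier X" and e: "0 < e"
  obtain f where f: "sq_integrable b f" "F = L2_class b f" using F by (rule L2_carrierE)
  obtain g where g: "g \<in> dom_funs" "sqnorm b (\<lambda>x. f x - g x) < e\<^sup>2"
    using dom_funs_dense[OF f(1)] e unfolding approximable_def by (meson zero_less_power)
  have gs: "sq_integrable b g" using g(1) sq_Vol0 by (auto simp: dom_funs_def)
  have "vnorm X (vdiff X F (L2_class b g)) = sqrt (sqnorm b (\<lambda>x. f x - g x))"
    by (simp add: f gs L2_ops sq_intros)
  also have "\<dots> < e" using g(2) e by (intro real_less_lsqrt) (auto simp: sqnorm_nonneg)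
  finally show "\<exists>G\<in>L2_class b ` dom_funs. vnorm X (vdiff X F G) < e"
    using g(1) by blast
qed

text \<open>
The two solutions of \<open>\<tau> f = h\<close> differ by a homogeneous solution; for \<open>h\<close> orthogonal to \<open>phi\<close> both vanish at \<open>b\<close>,
so the difference is a multiple of \<open>phi\<close>.
\<close>

lemma Vol0_minus_Volb:
  assumes h: "sq_integrable b h" "sqinner b h phi = 0" and x: "0 \<le> x" "x \<le> b"
  shows "Vol0 h x = Volb h x + lower solu h b / of_real (solu b) * phi x"
proof -
  have ub: "complex_of_real (solu b) \<noteq> 0" using b_pos by (simp add: solu_def)
  have e: "of_real (solv b) * lower solu h b = of_real (solu b) * lower solv h b"
    using h by (simp add: sqinner_phi)
  have "Vol0 h x - Volb h x = of_real (solu x) * lower solv h b - of_real (solv x) * lower solu h b"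
    unfolding Vol0_def Volb_def lower_upper[OF sq_weight_sol(1) h(1) x] lower_upper[OF sq_weight_sol(2) h(1) x]
    by (simp add: algebra_simps)
  also have "\<dots> = lower solu h b / of_real (solu b) * phi x"
    using ub e unfolding phi_def of_real_diff of_real_mult
    by (simp add: field_simps)
  finally show ?thesis by (simp add: algebra_simps)
qed

lemma Vol0_symmetric:
  assumes h: "sq_integrable b h" "sqinner b h phi = 0" and g: "sq_integrable b g" "sqinner b g phi = 0"
  shows "sqinner b (Vol0 h) g = sqinner b h (Vol0 g)"
proof -
  have "sqinner b h (Vol0 g) = sqinner b h (\<lambda>x. Volb g x + lower solu g b / of_real (solu b) * phi x)"
    unfolding sqinner_def
    by (rule Bochner_Integration.integral_cong) (use Vol0_minus_Volb[OF g] in auto)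
  also have "\<dots> = sqinner b h (Volb g) + sqinner b h (\<lambda>x. lower solu g b / of_real (solu b) * phi x)"
    by (intro sqinner_add_right sq_Volb sq_integrable_scale sq_phi h g)
  also have "\<dots> = sqinner b h (Volb g)" by (simp only: sqinner_scale_right h(2)) simp
  finally show ?thesis using Vol0_Volb_duality[OF h(1) g(1)] by simp
qed

lemma symmetric_bessel: "symmetric_operator X Amin"
  unfolding symmetric_operator_def bessel_operator_eq
  by (auto simp: vinner_L2 sq_Vol0 Vol0_symmetric)

lemma Vol0_add:
  assumes "sq_integrable b h" "sq_integrable b k" "0 \<le> x" "x \<le> b"
  shows "Vol0 (\<lambda>t. h t + k t) x = Vol0 h x + Vol0 k x"
  unfolding Vol0_def lower_add[OF sq_weight_sol(1) assms] lower_add[OF sq_weight_sol(2) assms]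
  by (simp add: algebra_simps)

lemma Vol0_scale: "Vol0 (\<lambda>t. c * h t) x = c * Vol0 h x"
  unfolding Vol0_def lower_scale by (simp add: algebra_simps)

lemma Volb_scale: "Volb (\<lambda>t. c * h t) x = c * Volb h x"
  unfolding Volb_def upper_scale by (simp add: algebra_simps)

lemma Volb_add:
  assumes "sq_integrable b h" "sq_integrable b k" "0 \<le> x" "x \<le> b"
  shows "Volb (\<lambda>t. h t + k t) x = Volb h x + Volb k x"
  unfolding Volb_def upper_add[OF sq_weight_sol(1) assms] upper_add[OF sq_weight_sol(2) assms]
  by (simp add: algebra_simps)

text \<open>
Only single-valuedness is not formal: that \<open>Vol0 h\<close> determines \<open>h\<close> follows because, by symmetry, the difference of two
candidates is orthogonal to the dense domain.
\<close>

lemma linear_bessel: "linear_operator X Amin"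
  unfolding linear_operator_def
proof (intro conjI)
  let ?X = "X" and ?A = "Amin"
  show "?A \<subseteq> vcarrier ?X \<times> vcarrier ?X"
    unfolding bessel_operator_eq by (auto simp: sq_Vol0)
  have mem: "(L2_class b (Vol0 h), L2_class b h) \<in> ?A" if "sq_integrable b h" "sqinner b h phi = 0" for h
    using that unfolding bessel_operator_eq by blast
  have "(L2_class b (Vol0 (\<lambda>x. 0)), L2_class b (\<lambda>x. 0)) \<in> ?A"
    by (rule mem) (simp_all add: sq_integrable_zero sqinner_def)
  moreover have "Vol0 (\<lambda>x. 0) = (\<lambda>x. 0)" by (simp add: Vol0_def lower_def fun_eq_iff)
  ultimately show "(vzero ?X, vzero ?X) \<in> ?A" by (simp add: vzero_L2)
  show "\<forall>(f, f')\<in>?A. \<forall>(g, g')\<in>?A. (vadd ?X f g, vadd ?X f' g') \<in> ?A"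
  proof (clarify)
    fix F F' G G' assume "(F, F') \<in> ?A" "(G, G') \<in> ?A"
    then obtain h g where h: "sq_integrable b h" "sqinner b h phi = 0" "F = L2_class b (Vol0 h)" "F' = L2_class b h"
      and g: "sq_integrable b g" "sqinner b g phi = 0" "G = L2_class b (Vol0 g)" "G' = L2_class b g"
      unfolding bessel_operator_eq by blast
    have "L2_class b (\<lambda>x. Vol0 h x + Vol0 g x) = L2_class b (Vol0 (\<lambda>x. h x + g x))"
      by (rule L2_class_cong_Ioo) (simp add: Vol0_add h g)
    moreover have "(L2_class b (Vol0 (\<lambda>x. h x + g x)), L2_class b (\<lambda>x. h x + g x)) \<in> ?A"
      by (rule mem) (simp_all add: sq_integrable_add h g sqinner_add sq_phi)
    ultimately show "(vadd ?X F G, vadd ?X F' G') \<in> ?A"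
      by (simp add: h(1,3,4) g(1,3,4) vadd_L2 sq_Vol0)
  qed
  show "\<forall>c. \<forall>(f, f')\<in>?A. (vscale ?X c f, vscale ?X c f') \<in> ?A"
  proof (clarify)
    fix c F F' assume "(F, F') \<in> ?A"
    then obtain h where h: "sq_integrable b h" "sqinner b h phi = 0" "F = L2_class b (Vol0 h)" "F' = L2_class b h"
      unfolding bessel_operator_eq by blast
    have "(L2_class b (Vol0 (\<lambda>x. c * h x)), L2_class b (\<lambda>x. c * h x)) \<in> ?A"
      by (rule mem) (simp_all add: sq_integrable_scale h sqinner_scale)
    moreover have "Vol0 (\<lambda>x. c * h x) = (\<lambda>x. c * Vol0 h x)" by (simp add: Vol0_scale fun_eq_iff)
    ultimately show "(vscale ?X c F, vscale ?X c F') \<in> ?A"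
      by (simp add: h(1,3,4) vscale_L2 sq_Vol0)
  qed
  show "single_valued ?A"
    unfolding single_valued_def
  proof (intro allI impI)
    fix F F' G' assume "(F, F') \<in> ?A" "(F, G') \<in> ?A"
    then obtain h g where h: "sq_integrable b h" "sqinner b h phi = 0" "F = L2_class b (Vol0 h)" "F' = L2_class b h"
      and g: "sq_integrable b g" "sqinner b g phi = 0" "F = L2_class b (Vol0 g)" "G' = L2_class b g"
      unfolding bessel_operator_eq by blast
    let ?d = "\<lambda>x. h x - g x"
    have d: "sq_integrable b ?d" by (intro sq_integrable_diff h g)
    have AE: "AE x in leb b. Vol0 h x = Vol0 g x"
    proof -
      have "L2_class b (Vol0 h) = L2_class b (Vol0 g)" using h(3) g(3) by simp
      then show ?thesis using L2_class_eq_iff[OF sq_Vol0[OF h(1)]] by blast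
    qed
    have "sqinner b ?d k = 0 \<and> sq_integrable b k" if "k \<in> dom_funs" for k
    proof -
      obtain l where l: "k = Vol0 l" "sq_integrable b l" "sqinner b l phi = 0"
        using \<open>k \<in> dom_funs\<close> by (auto simp: dom_funs_def)
      have "sqinner b (Vol0 h) l = sqinner b (Vol0 g) l"
        unfolding sqinner_def
      proof (rule integral_cong_AE)
        show "AE x in leb b. Vol0 h x * cnj (l x) = Vol0 g x * cnj (l x)"
          using AE by eventually_elim simp
      qed (use integrable_sqinner[OF sq_Vol0[OF h(1)] l(2)] integrable_sqinner[OF sq_Vol0[OF g(1)] l(2)] in auto)
      then have "sqinner b h (Vol0 l) = sqinner b g (Vol0 l)"
        by (simp add: Vol0_symmetric h(1,2) g(1,2) l(2,3))
      then show ?thesis by (simp add: l sqinner_diff h(1) g(1) sq_Vol0)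
    qed
    then have "AE x in leb b. ?d x = 0"
      by (intro orthogonal_dense_imp_zero[OF d _ dom_funs_dense[OF d]]) auto
    then have "AE x in leb b. h x = g x" by eventually_elim simp
    then show "F' = G'" unfolding h(4) g(4) by (rule L2_class_cong)
  qed
qed

text \<open>
The general solution of \<open>\<tau> f = k\<close> with \<open>f b = 0\<close>.
\<close>

definition adj_fun :: "(real \<Rightarrow> complex) \<Rightarrow> complex \<Rightarrow> real \<Rightarrow> complex" where
  "adj_fun k c x = Volb k x + c * phi x"

lemma sq_adj_fun: "sq_integrable b k \<Longrightarrow> sq_integrable b (adj_fun k c)"
  unfolding adj_fun_def by (intro sq_integrable_add sq_Volb sq_integrable_scale sq_phi)

lemma sqinner_adj_fun:
  assumes "sq_integrable b h" "sq_integrable b k"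
  shows "sqinner b h (adj_fun k c) = sqinner b (Vol0 h) k + cnj c * sqinner b h phi"
  unfolding adj_fun_def
  using assms by (simp add: sqinner_add_right sq_Volb sq_integrable_scale sq_phi sqinner_scale_right Vol0_Volb_duality)

text \<open>
Every \<open>(g, k)\<close> in the adjoint satisfies \<open>(h, g - Volb k) = 0\<close> for all \<open>h\<close> orthogonal to \<open>phi\<close>, so that \<open>g - Volb k\<close>
is a multiple of \<open>phi\<close>.
\<close>

theorem adjoint_bessel_eq:
  "Amax = {(L2_class b (adj_fun k c), L2_class b k) | k c. sq_integrable b k}"
  (is "?L = ?R")
proof (intro subset_antisym subsetI)
  fix P assume "P \<in> ?L"
  then obtain G H where P: "P = (G, H)" "G \<in> vcarrier X" "H \<in> vcarrier X"
    and orth: "\<forall>(f, f')\<in>Amin. vinner X f' G = vinner X f H"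
    unfolding adjoint_op_def by auto
  obtain g where g: "sq_integrable b g" "G = L2_class b g" using P(2) by (rule L2_carrierE)
  obtain k where k: "sq_integrable b k" "H = L2_class b k" using P(3) by (rule L2_carrierE)
  let ?w = "\<lambda>x. g x - Volb k x"
  have w: "sq_integrable b ?w" by (intro sq_integrable_diff sq_Volb g k)
  have perp: "sqinner b h ?w = 0" if h: "sq_integrable b h" "sqinner b h phi = 0" for h
  proof -
    have "(L2_class b (Vol0 h), L2_class b h) \<in> Amin"
      using h unfolding bessel_operator_eq by blast
    then have "sqinner b h g = sqinner b (Vol0 h) k"
      using orth by (auto simp: g k h vinner_L2 sq_Vol0)
    then show ?thesis
      by (simp add: sqinner_diff_right g k h sq_Volb Vol0_Volb_duality)
  qed
  \<comment> \<open>Subtracting the projection onto \<open>phi\<close> yields an admissible test function, which is then tested against itself.\<close>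
  define c where "c = sqinner b ?w phi / of_real (sqnorm b phi)"
  let ?h = "\<lambda>x. ?w x - c * phi x"
  have h: "sq_integrable b ?h" by (rule sq_integrable_diff[OF w sq_integrable_scale[OF sq_phi]])
  have "sqinner b ?h phi = sqinner b ?w phi - c * of_real (sqnorm b phi)"
    by (simp add: sqinner_diff[OF w sq_integrable_scale[OF sq_phi] sq_phi] sqinner_scale sqinner_self sq_phi)
  then have hp: "sqinner b ?h phi = 0" using sqnorm_phi_pos by (simp add: c_def)
  have "sqinner b ?h ?h = sqinner b ?h ?w - sqinner b ?h (\<lambda>x. c * phi x)"
    by (rule sqinner_diff_right[OF w sq_integrable_scale[OF sq_phi] h])
  also have "\<dots> = 0" by (simp only: perp[OF h hp] sqinner_scale_right hp) simp
  finally have "sqnorm b ?h = 0" using sqinner_self[OF h] by simp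
  then have "AE x in leb b. ?h x = 0" using sqnorm_eq_0[OF h] by simp
  then have "AE x in leb b. g x = adj_fun k c x"
    by eventually_elim (simp add: adj_fun_def algebra_simps)
  then have "G = L2_class b (adj_fun k c)" unfolding g(2) by (rule L2_class_cong)
  then show "P \<in> ?R" using P(1) k by blast
next
  fix P assume "P \<in> ?R"
  then obtain k c where k: "sq_integrable b k" "P = (L2_class b (adj_fun k c), L2_class b k)" by blast
  show "P \<in> ?L"
    unfolding adjoint_op_def bessel_operator_eq k(2)
    using k(1) by (auto simp: sq_adj_fun vinner_L2 sq_Vol0 sqinner_adj_fun)
qed

text \<open>
Adjoints are closed, so this identity gives the closedness of the minimal operator.
\<close>

lemma bessel_operator_eq_biadjoint:
  "Amin = adjoint_op X Amax"
  (is "?A = adjoint_op ?X ?B")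
proof (intro subset_antisym subsetI)
  fix P assume "P \<in> ?A"
  then obtain h where h: "sq_integrable b h" "sqinner b h phi = 0" "P = (L2_class b (Vol0 h), L2_class b h)"
    unfolding bessel_operator_eq by blast
  have "sqinner b k (Vol0 h) = sqinner b (adj_fun k c) h" if "sq_integrable b k" for k c
    using sqinner_adj_fun[OF h(1) that, of c] h(2)
    by (simp add: sqinner_commute[of b k "Vol0 h"] sqinner_commute[of b "adj_fun k c" h])
  then show "P \<in> adjoint_op ?X ?B"
    unfolding adjoint_op_def[of _ ?B] unfolding adjoint_bessel_eq h(3)
    by (auto simp: h(1) sq_Vol0 vinner_L2 sq_adj_fun)
next
  fix P assume "P \<in> adjoint_op ?X ?B"
  then obtain F H where P: "P = (F, H)" "F \<in> vcarrier ?X" "H \<in> vcarrier ?X"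
    and orth: "\<forall>(f, f')\<in>?B. vinner ?X f' F = vinner ?X f H"
    unfolding adjoint_op_def[of _ ?B] by auto
  obtain f where f: "sq_integrable b f" "F = L2_class b f" using P(2) by (rule L2_carrierE)
  obtain h where h: "sq_integrable b h" "H = L2_class b h" using P(3) by (rule L2_carrierE)
  have o: "sqinner b k f = sqinner b (adj_fun k c) h" if k: "sq_integrable b k" for k c
  proof -
    have "(L2_class b (adj_fun k c), L2_class b k) \<in> ?B" using k unfolding adjoint_bessel_eq by blast
    then show ?thesis using orth by (auto simp: f h k vinner_L2 sq_adj_fun)
  qed
  have o': "sqinner b f k = sqinner b (Vol0 h) k + cnj c * sqinner b h phi" if k: "sq_integrable b k" for k c
  proof -
    have "sqinner b f k = cnj (sqinner b k f)" by (rule sqinner_commute)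
    also have "\<dots> = cnj (sqinner b (adj_fun k c) h)" by (simp only: o[OF k, of c])
    also have "\<dots> = sqinner b h (adj_fun k c)" by (rule sqinner_commute[symmetric])
    also have "\<dots> = sqinner b (Vol0 h) k + cnj c * sqinner b h phi" by (rule sqinner_adj_fun[OF h(1) k])
    finally show ?thesis .
  qed
  have hp: "sqinner b h phi = 0" using o'[OF sq_phi, of 0] o'[OF sq_phi, of 1] by simp
  let ?d = "\<lambda>x. f x - Vol0 h x"
  have d: "sq_integrable b ?d" by (intro sq_integrable_diff f h sq_Vol0)
  have "sqinner b ?d ?d = sqinner b f ?d - sqinner b (Vol0 h) ?d"
    by (rule sqinner_diff[OF f(1) sq_Vol0[OF h(1)] d])
  then have "sqnorm b ?d = 0" using o'[OF d, of 0] sqinner_self[OF d] by simp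
  then have "AE x in leb b. ?d x = 0" using sqnorm_eq_0[OF d] by simp
  then have "AE x in leb b. f x = Vol0 h x" by eventually_elim simp
  then have "F = L2_class b (Vol0 h)" unfolding f(2) by (rule L2_class_cong)
  then show "P \<in> ?A" unfolding bessel_operator_eq using P(1) h hp by blast
qed

lemma closed_bessel: "closed_operator X Amin"
proof -
  have "Amax \<subseteq> vcarrier X \<times> vcarrier X"
    by (auto simp: adjoint_op_def)
  from closed_adjoint_L2[OF this] show ?thesis
    using bessel_operator_eq_biadjoint by simp
qed

end

section \<open>Boundary values\<close>

context bessel_setting
begin

text \<open>
The coefficients \<open>\<alpha>\<close> and \<open>\<beta>\<close> in \<open>adj_fun k c = \<alpha> u - \<beta> v\<close>. They coincide with the brackets of \<open>adj_fun k c\<close> with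
\<open>v\<close> and with \<open>u\<close>, which is why their values at \<open>0\<close> are the boundary values.
\<close>

definition coefu :: "(real \<Rightarrow> complex) \<Rightarrow> complex \<Rightarrow> real \<Rightarrow> complex" where
  "coefu k c x = c * of_real (solv b) - upper solv k x"

definition coefv :: "(real \<Rightarrow> complex) \<Rightarrow> complex \<Rightarrow> real \<Rightarrow> complex" where
  "coefv k c x = c * of_real (solu b) - upper solu k x"

definition adj_fun' :: "(real \<Rightarrow> complex) \<Rightarrow> complex \<Rightarrow> real \<Rightarrow> complex" where
  "adj_fun' k c x = coefu k c x * of_real (solu' x) - coefv k c x * of_real (solv' x)"

lemma adj_fun_coef: "adj_fun k c x = coefu k c x * of_real (solu x) - coefv k c x * of_real (solv x)"
  by (simp add: adj_fun_def Volb_def phi_def coefu_def coefv_def algebra_simps)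

lemma continuous_coef:
  assumes "sq_integrable b k"
  shows "continuous_on {0..b} (coefu k c)" "continuous_on {0..b} (coefv k c)"
  unfolding coefu_def coefv_def
  by (intro continuous_intros continuous_upper sq_weight_sol assms)+

text \<open>
The coefficients are not differentiable, but their contributions to the derivative cancel: the function is the
integral of a continuous function.
\<close>

lemma adj_fun_deriv:
  assumes k: "sq_integrable b k" and x: "0 < x" "x < b"
  shows "(adj_fun k c has_vector_derivative adj_fun' k c x) (at x)"
proof -
  let ?c = "x / 2"
  have c1: "continuous_on {?c..b} (adj_fun' k c)"
    unfolding adj_fun'_def
    by (intro continuous_intros continuous_on_of_real continuous_on_subset[OF continuous_coef(1)[OF k]]
        continuous_on_subset[OF continuous_coef(2)[OF k]] continuous_on_subset[OF continuous_on_sol(3)]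
        continuous_on_subset[OF continuous_on_sol(4)]) (use x in auto)
  have eq: "adj_fun k c y = adj_fun k c ?c + integral {?c..y} (adj_fun' k c)" if y: "y \<in> {?c..b}" for y
  proof -
    have 1: "coefu k c t = coefu k c ?c + integral {?c..t} (\<lambda>t. of_real (solv t) * k t)" if "t \<in> {?c..y}" for t
      using upper_split[OF sq_weight_sol(2) k, of ?c t] that y x by (simp add: coefu_def)
    have 2: "coefv k c t = coefv k c ?c + integral {?c..t} (\<lambda>t. of_real (solu t) * k t)" if "t \<in> {?c..y}" for t
      using upper_split[OF sq_weight_sol(1) k, of ?c t] that y x by (simp add: coefv_def)
    show ?thesis
      using variation_of_parameters(1)[OF k, of ?c y "coefu k c" "coefv k c", OF _ _ _ 1 2] x y
      by (simp add: adj_fun_coef adj_fun'_def[abs_def])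
  qed
  have "((\<lambda>y. adj_fun k c ?c + integral {?c..y} (adj_fun' k c)) has_vector_derivative adj_fun' k c x) (at x within {?c..b})"
    using has_vector_derivative_add[OF has_vector_derivative_const integral_has_vector_derivative[OF c1, of x]] x
    by simp
  then have "(adj_fun k c has_vector_derivative adj_fun' k c x) (at x within {?c..b})"
  proof (rule has_vector_derivative_transform[rotated -1])
    show "x \<in> {?c..b}" using x by simp
    show "adj_fun k c y = adj_fun k c ?c + integral {?c..y} (adj_fun' k c)" if "y \<in> {?c..b}" for y
      by (rule eq[OF that])
  qed
  then have "(adj_fun k c has_vector_derivative adj_fun' k c x) (at x within {?c<..<b})"
    by (rule has_vector_derivative_within_subset) auto
  then show ?thesis
    using x by (simp add: has_vector_derivative_within_open[of x "{x/2<..<b}"])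
qed

lemma adj_fun_differentiable:
  assumes "sq_integrable b k" shows "adj_fun k c differentiable_on {0<..<b}"
  unfolding differentiable_on_def
proof
  fix x assume "x \<in> {0<..<b}"
  then show "adj_fun k c differentiable at x within {0<..<b}"
    using has_vector_derivative_at_within[OF adj_fun_deriv[OF assms]] by (auto intro: differentiableI_vector)
qed

text \<open>
Two continuous functions that agree almost everywhere agree, so the chosen differentiable representative is
the explicit one.
\<close>

lemma diff_rep_eq:
  assumes k: "sq_integrable b k" and x: "0 < x" "x < b"
  shows "diff_rep b (L2_class b (adj_fun k c)) x = adj_fun k c x"
    "(diff_rep b (L2_class b (adj_fun k c)) has_vector_derivative adj_fun' k c x) (at x)"
proof -
  let ?F = "L2_class b (adj_fun k c)"
  have "\<exists>f. f \<in> ?F \<and> f differentiable_on {0<..<b}"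
    using L2_class_self[OF sq_adj_fun[OF k]] adj_fun_differentiable[OF k] by blast
  then have d: "diff_rep b ?F \<in> ?F" "diff_rep b ?F differentiable_on {0<..<b}"
    unfolding diff_rep_def by (metis (mono_tags, lifting) someI_ex)+
  have AE: "AE x in leb b. diff_rep b ?F x = adj_fun k c x"
    using d(1) by (simp add: L2_class_def)
  have eq: "diff_rep b ?F y = adj_fun k c y" if "0 < y" "y < b" for y
    by (rule AE_eq_continuous_imp_eq[OF differentiable_imp_continuous_on[OF d(2)]
          differentiable_imp_continuous_on[OF adj_fun_differentiable[OF k]] AE that])
  show "diff_rep b ?F x = adj_fun k c x" by (rule eq[OF x])
  show "(diff_rep b ?F has_vector_derivative adj_fun' k c x) (at x)"
    by (rule has_vector_derivative_transform_within_open[OF adj_fun_deriv[OF k x], of "{0<..<b}"])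
      (use eq x in auto)
qed

lemma bracket_adj:
  assumes k: "sq_integrable b k" and x: "0 < x" "x < b"
    and w: "\<And>y. 0 < y \<Longrightarrow> (g has_vector_derivative of_real (g' y)) (at y)" "\<And>y. 0 < y \<Longrightarrow> g y = of_real (g0 y)"
  shows "bracket (diff_rep b (L2_class b (adj_fun k c))) g x
    = adj_fun k c x * of_real (g' x) - adj_fun' k c x * of_real (g0 x)"
  unfolding bracket_def
  using diff_rep_eq[OF k x, of c] w[OF x(1)] by (simp add: vector_derivative_at)

lemma has_vector_derivative_of_real_lift:
  fixes w :: "real \<Rightarrow> real"
  assumes "(w has_real_derivative d) (at y)"
  shows "((\<lambda>y. complex_of_real (w y)) has_vector_derivative of_real d) (at y)"
  using assms bounded_linear.has_vector_derivative[OF bounded_linear_of_real]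
  by (simp add: has_real_derivative_iff_has_vector_derivative)

lemma u_plus_eq: "u_plus \<nu> = (\<lambda>x. of_real (solu x))"
  by (simp add: u_plus_def solu_def fun_eq_iff)

text \<open>
The factor \<open>- 2 \<nu>\<close> cancels the normalisation of \<open>solv\<close> and the factor \<open>- 1 / (2 \<nu>)\<close> in the definition of the second
boundary map.
\<close>

lemma u_minus_eq: "u_minus \<nu> = (\<lambda>x. of_real ((if \<nu> = 0 then 1 else - 2 * \<nu>) * solv x))"
  unfolding u_minus_def solv_def by (auto simp: fun_eq_iff)

lemma wronskian_complex:
  assumes "0 < x"
  shows "complex_of_real (solu x) * of_real (solv' x) - of_real (solu' x) * of_real (solv x) = 1"
  using wronskian[OF assms] by (metis of_real_1 of_real_diff of_real_mult)

lemma bracket_u_plus: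
  assumes k: "sq_integrable b k" and x: "0 < x" "x < b"
  shows "bracket (diff_rep b (L2_class b (adj_fun k c))) (u_plus \<nu>) x = coefv k c x"
proof -
  have "bracket (diff_rep b (L2_class b (adj_fun k c))) (u_plus \<nu>) x
    = adj_fun k c x * of_real (solu' x) - adj_fun' k c x * of_real (solu x)"
    unfolding u_plus_eq
    by (rule bracket_adj[OF k x]) (auto intro: has_vector_derivative_of_real_lift solu_deriv)
  also have "\<dots> = coefv k c x * (of_real (solu x) * of_real (solv' x) - of_real (solu' x) * of_real (solv x))"
    by (simp add: adj_fun_coef adj_fun'_def algebra_simps)
  finally show ?thesis using wronskian_complex[OF x(1)] by simp
qed

lemma bracket_u_minus:
  assumes k: "sq_integrable b k" and x: "0 < x" "x < b"
  shows "bracket (diff_rep b (L2_class b (adj_fun k c))) (u_minus \<nu>) x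
    = of_real (if \<nu> = 0 then 1 else - 2 * \<nu>) * coefu k c x"
proof -
  let ?m = "(if \<nu> = 0 then 1 else - 2 * \<nu>) :: real"
  have "bracket (diff_rep b (L2_class b (adj_fun k c))) (u_minus \<nu>) x
    = adj_fun k c x * of_real (?m * solv' x) - adj_fun' k c x * of_real (?m * solv x)"
    unfolding u_minus_eq
    by (rule bracket_adj[OF k x]) (intro has_vector_derivative_of_real_lift DERIV_cmult solv_deriv, auto)
  also have "\<dots> = of_real ?m * coefu k c x * (of_real (solu x) * of_real (solv' x) - of_real (solu' x) * of_real (solv x))"
    unfolding of_real_mult adj_fun_coef adj_fun'_def by (simp only: algebra_simps)
  finally show ?thesis using wronskian_complex[OF x(1)] by simp
qed

lemma coef_limits:
  assumes k: "sq_integrable b k"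
  shows "(coefu k c \<longlongrightarrow> coefu k c 0) (at_right 0)" "(coefv k c \<longlongrightarrow> coefv k c 0) (at_right 0)"
proof -
  have "0 \<in> {0..b}" using b_pos by simp
  then show "(coefu k c \<longlongrightarrow> coefu k c 0) (at_right 0)" "(coefv k c \<longlongrightarrow> coefv k c 0) (at_right 0)"
    using continuous_coef[OF k, of c] at_within_Icc_at_right[OF b_pos] unfolding continuous_on_def by metis+
qed

lemma bracket_limits:
  assumes k: "sq_integrable b k"
  shows "(bracket (diff_rep b (L2_class b (adj_fun k c))) (u_plus \<nu>) \<longlongrightarrow> coefv k c 0) (at_right 0)"
    "(bracket (diff_rep b (L2_class b (adj_fun k c))) (u_minus \<nu>)
      \<longlongrightarrow> of_real (if \<nu> = 0 then 1 else - 2 * \<nu>) * coefu k c 0) (at_right 0)"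
proof -
  have ev: "\<forall>\<^sub>F x in at_right 0. 0 < x \<and> x < b"
    unfolding eventually_at_right_field using b_pos by blast
  show "(bracket (diff_rep b (L2_class b (adj_fun k c))) (u_plus \<nu>) \<longlongrightarrow> coefv k c 0) (at_right 0)"
    by (rule Lim_transform_eventually[OF coef_limits(2)[OF k]])
      (use ev in eventually_elim, simp add: bracket_u_plus[OF k])
  show "(bracket (diff_rep b (L2_class b (adj_fun k c))) (u_minus \<nu>)
      \<longlongrightarrow> of_real (if \<nu> = 0 then 1 else - 2 * \<nu>) * coefu k c 0) (at_right 0)"
    by (rule Lim_transform_eventually[OF tendsto_mult[OF tendsto_const coef_limits(1)[OF k]]])
      (use ev in eventually_elim, simp only: bracket_u_minus[OF k])
qed

lemma Gamma0_eq:
  assumes "sq_integrable b k"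
  shows "\<Gamma>0 (L2_class b (adj_fun k c)) = c * of_real (solu b) - lower solu k b"
  unfolding bessel_Gamma0_def bracket0_def
  using tendsto_Lim[OF trivial_limit_at_right_real bracket_limits(1)[OF assms]]
  by (simp add: coefv_def upper_0)

lemma Gamma1_eq:
  assumes "sq_integrable b k"
  shows "\<Gamma>1 (L2_class b (adj_fun k c)) = c * of_real (solv b) - lower solv k b"
proof -
  have "bracket0 (diff_rep b (L2_class b (adj_fun k c))) (u_minus \<nu>)
    = of_real (if \<nu> = 0 then 1 else - 2 * \<nu>) * (c * of_real (solv b) - lower solv k b)"
    unfolding bracket0_def
    using tendsto_Lim[OF trivial_limit_at_right_real bracket_limits(2)[OF assms]]
    by (simp only: coefu_def upper_0)
  then show ?thesis unfolding bessel_Gamma1_def by auto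
qed

lemma adj_fun_add:
  assumes "sq_integrable b k" "sq_integrable b l" "0 \<le> x" "x \<le> b"
  shows "adj_fun (\<lambda>x. k x + l x) (c + d) x = adj_fun k c x + adj_fun l d x"
  using Volb_add[OF assms] by (simp add: adj_fun_def algebra_simps)

lemma adj_fun_scale: "adj_fun (\<lambda>x. d * k x) (d * c) x = d * adj_fun k c x"
  by (simp add: adj_fun_def Volb_scale algebra_simps)

lemma vadd_adj_fun:
  assumes "sq_integrable b k" "sq_integrable b l"
  shows "vadd X (L2_class b (adj_fun k c)) (L2_class b (adj_fun l d)) = L2_class b (adj_fun (\<lambda>x. k x + l x) (c + d))"
  unfolding vadd_L2[OF sq_adj_fun[OF assms(1)] sq_adj_fun[OF assms(2)]]
  by (rule L2_class_cong_Ioo) (simp add: adj_fun_add assms)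

lemma vscale_adj_fun:
  assumes "sq_integrable b k"
  shows "vscale X d (L2_class b (adj_fun k c)) = L2_class b (adj_fun (\<lambda>x. d * k x) (d * c))"
  unfolding vscale_L2[OF sq_adj_fun[OF assms]] by (simp only: adj_fun_scale[symmetric])

lemma linear_on_domain_adj:
  assumes w: "sq_weight w"
    and G: "\<And>k c. sq_integrable b k \<Longrightarrow> G (L2_class b (adj_fun k c)) = c * of_real (w b) - lower w k b"
  shows "linear_on_domain X (Domain Amax) complex_space G"
  unfolding linear_on_domain_def
proof (intro conjI ballI allI)
  fix F assume "F \<in> Domain Amax"
  then obtain k c where k: "sq_integrable b k" "F = L2_class b (adj_fun k c)"
    unfolding adjoint_bessel_eq by blast
  show "G (vscale X d F) = vscale complex_space d (G F)" for d
    using k by (simp add: vscale_adj_fun G sq_integrable_scale lower_scale complex_space_def algebra_simps)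
  fix H assume "H \<in> Domain Amax"
  then obtain l d where l: "sq_integrable b l" "H = L2_class b (adj_fun l d)"
    unfolding adjoint_bessel_eq by blast
  have b: "0 \<le> b" "b \<le> b" using b_pos by auto
  show "G (vadd X F H) = vadd complex_space (G F) (G H)"
    using k l by (simp add: vadd_adj_fun G sq_integrable_add lower_add[OF w _ _ b] complex_space_def algebra_simps)
qed (simp add: complex_space_def)

lemma linear_Gamma:
  "linear_on_domain X (Domain Amax) complex_space \<Gamma>0"
  "linear_on_domain X (Domain Amax) complex_space \<Gamma>1"
  by (rule linear_on_domain_adj[OF sq_weight_sol(1) Gamma0_eq], assumption)
    (rule linear_on_domain_adj[OF sq_weight_sol(2) Gamma1_eq], assumption)

text \<open>
The difference \<open>Vol0 k - Volb k\<close> is a combination of the two solutions with coefficients given by integrals over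
\<open>(0,b)\<close>. This makes Green's identity an identity between finitely many numbers.
\<close>

lemma green_adj:
  assumes k: "sq_integrable b k" and l: "sq_integrable b l"
  shows "sqinner b k (adj_fun l d) - sqinner b (adj_fun k c) l =
    (c * of_real (solv b) - lower solv k b) * cnj (d * of_real (solu b) - lower solu l b)
    - (c * of_real (solu b) - lower solu k b) * cnj (d * of_real (solv b) - lower solv l b)"
proof -
  let ?u = "\<lambda>x. complex_of_real (solu x)" and ?v = "\<lambda>x. complex_of_real (solv x)"
  have diff: "Vol0 k x - Volb k x = lower solv k b * ?u x - lower solu k b * ?v x" if "0 < x" "x < b" for x
  proof -
    have x: "0 \<le> x" "x \<le> b" using that by auto
    show ?thesis
      unfolding Vol0_def Volb_def lower_upper[OF sq_weight_sol(1) k x] lower_upper[OF sq_weight_sol(2) k x]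
      by (simp add: algebra_simps)
  qed
  have low: "sqinner b (\<lambda>x. complex_of_real (w x)) l = cnj (lower w l b)" if "sq_weight w" for w
  proof -
    have "sqinner b (\<lambda>x. complex_of_real (w x)) l = integral {0..b} (\<lambda>x. of_real (w x) * cnj (l x))"
      unfolding sqinner_def
      by (rule leb_eq_integral[OF integrable_sqinner]) (use that l in \<open>auto simp: sq_weight_def\<close>)
    then show ?thesis unfolding cnj_lower unfolding lower_def .
  qed
  have K1: "sqinner b (Vol0 k) l - sqinner b (Volb k) l = lower solv k b * cnj (lower solu l b) - lower solu k b * cnj (lower solv l b)"
  proof -
    have "sqinner b (Vol0 k) l - sqinner b (Volb k) l = sqinner b (\<lambda>x. Vol0 k x - Volb k x) l"
      by (rule sqinner_diff[OF sq_Vol0[OF k] sq_Volb[OF k] l, symmetric])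
    also have "\<dots> = sqinner b (\<lambda>x. lower solv k b * ?u x - lower solu k b * ?v x) l"
      unfolding sqinner_def by (rule Bochner_Integration.integral_cong) (use diff in auto)
    also have "\<dots> = sqinner b (\<lambda>x. lower solv k b * ?u x) l - sqinner b (\<lambda>x. lower solu k b * ?v x) l"
      by (intro sqinner_diff sq_integrable_scale sq_solu sq_solv l)
    also have "\<dots> = lower solv k b * cnj (lower solu l b) - lower solu k b * cnj (lower solv l b)"
      by (simp only: sqinner_scale low[OF sq_weight_sol(1)] low[OF sq_weight_sol(2)])
    finally show ?thesis .
  qed
  have p: "sqinner b phi l = cnj (of_real (solv b) * lower solu l b - of_real (solu b) * lower solv l b)"
    using sqinner_phi[OF l] sqinner_commute[of b phi l] by simp
  have "sqinner b k (adj_fun l d) - sqinner b (adj_fun k c) l =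
    (sqinner b (Vol0 k) l + cnj d * sqinner b k phi) - (sqinner b (Volb k) l + c * sqinner b phi l)"
  proof -
    have "sqinner b (adj_fun k c) l = sqinner b (Volb k) l + c * sqinner b phi l"
      unfolding adj_fun_def
      by (simp add: sqinner_add sq_Volb sq_integrable_scale sq_phi k l sqinner_scale)
    then show ?thesis by (simp add: sqinner_adj_fun[OF k l])
  qed
  also have "\<dots> = (lower solv k b * cnj (lower solu l b) - lower solu k b * cnj (lower solv l b))
     + cnj d * (of_real (solv b) * lower solu k b - of_real (solu b) * lower solv k b)
     - c * cnj (of_real (solv b) * lower solu l b - of_real (solu b) * lower solv l b)"
    unfolding p sqinner_phi[OF k] K1[symmetric] by (simp add: algebra_simps)
  also have "\<dots> = (c * of_real (solv b) - lower solv k b) * cnj (d * of_real (solu b) - lower solu l b)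
    - (c * of_real (solu b) - lower solu k b) * cnj (d * of_real (solv b) - lower solv l b)"
    by (simp add: algebra_simps)
  finally show ?thesis .
qed

text \<open>
With \<open>k = t phi\<close> the boundary values are linear in \<open>(c, t)\<close>, and the determinant is the squared norm of \<open>phi\<close>.
\<close>

lemma Gamma_surjective:
  "\<exists>F\<in>Domain Amax. \<Gamma>0 F = h0 \<and> \<Gamma>1 F = h1"
proof -
  define N where "N = complex_of_real (sqnorm b phi)"
  have N: "N \<noteq> 0" using sqnorm_phi_pos by (simp add: N_def)
  define U V where "U = lower solu phi b" and "V = lower solv phi b"
  have Neq: "N = of_real (solv b) * U - of_real (solu b) * V"
    using sqinner_phi[OF sq_phi] sqinner_self[OF sq_phi] by (simp add: N_def U_def V_def)
  \<comment> \<open>Cramer's rule for the two boundary values as functions of \<open>c\<close> and \<open>t\<close>.\<close>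
  define t where "t = (of_real (solu b) * h1 - of_real (solv b) * h0) / N"
  define c where "c = (U * h1 - V * h0) / N"
  let ?F = "L2_class b (adj_fun (\<lambda>x. t * phi x) c)"
  have s: "sq_integrable b (\<lambda>x. t * phi x)" by (rule sq_integrable_scale[OF sq_phi])
  have "?F \<in> Domain Amax"
    unfolding adjoint_bessel_eq using s by blast
  moreover have "\<Gamma>0 ?F = h0"
  proof -
    have "\<Gamma>0 ?F * N = (c * N) * of_real (solu b) - (t * N) * U"
      by (simp add: Gamma0_eq[OF s] lower_scale U_def algebra_simps)
    also have "\<dots> = h0 * N" using N by (simp add: c_def t_def Neq) (simp add: algebra_simps)
    finally show ?thesis using N by simp
  qed
  moreover have "\<Gamma>1 ?F = h1"
  proof -
    have "\<Gamma>1 ?F * N = (c * N) * of_real (solv b) - (t * N) * V"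
      by (simp add: Gamma1_eq[OF s] lower_scale V_def algebra_simps)
    also have "\<dots> = h1 * N" using N by (simp add: c_def t_def Neq) (simp add: algebra_simps)
    finally show ?thesis using N by simp
  qed
  ultimately show ?thesis by blast
qed

end

section \<open>Eigenfunctions as Frobenius series\<close>

lemma summable_nat_ratio:
  fixes f :: "nat \<Rightarrow> complex"
  assumes "\<And>k. norm (f (Suc k)) * of_nat k \<le> C * norm (f k)"
  shows "summable f"
proof -
  obtain N where N: "2 * C \<le> real N" "1 \<le> N"
    using real_arch_simple[of "max 1 (2 * C)"] by (metis max.bounded_iff of_nat_1 of_nat_le_iff)
  show ?thesis
  proof (rule summable_ratio_test[of "1/2" N])
    fix k assume k: "N \<le> k"
    then have k': "2 * C \<le> real k" "0 < real k" using N by auto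
    have "norm (f (Suc k)) * real k \<le> (real k / 2) * norm (f k)"
    proof (rule order_trans[OF assms mult_right_mono])
      show "C \<le> real k / 2" using k' by simp
    qed simp
    then have "real k * norm (f (Suc k)) \<le> real k * (1/2 * norm (f k))" by (simp add: algebra_simps)
    then show "norm (f (Suc k)) \<le> 1/2 * norm (f k)" using k'(2) by (rule mult_left_le_imp_le)
  qed simp
qed

definition pser :: "(nat \<Rightarrow> complex) \<Rightarrow> complex \<Rightarrow> complex" where
  "pser a y = (\<Sum>k. a k * y ^ k)"

definition entire_coeffs :: "(nat \<Rightarrow> complex) \<Rightarrow> bool" where
  "entire_coeffs a \<longleftrightarrow> (\<forall>y. summable (\<lambda>k. a k * y ^ k))"

lemma entire_coeffs_diffs: "entire_coeffs a \<Longrightarrow> entire_coeffs (diffs a)"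
  unfolding entire_coeffs_def by (intro allI termdiff_converges_all) auto

lemma pser_deriv: "entire_coeffs a \<Longrightarrow> (pser a has_field_derivative pser (diffs a) y) (at y)"
  unfolding entire_coeffs_def pser_def[abs_def]
  by (rule termdiffs_strong_converges_everywhere) auto

lemma pser_0: "pser a 0 = a 0"
  unfolding pser_def by (simp add: powser_zero)

text \<open>
The equation that remains for the power series in \<open>y = x\<^sup>2\<close> after the factors \<open>u\<close> and \<open>v\<close> have been split off;
the term with \<open>e\<close> is the contribution of the logarithm.
\<close>

lemma frobenius_ode:
  assumes a: "entire_coeffs a" and c: "entire_coeffs c"
    and rec: "\<And>k. of_nat (Suc k) * (of_nat k + \<kappa>) * a (Suc k) + e * (of_nat (Suc k) * c (Suc k)) + w * a k = 0"
  shows "y * pser (diffs (diffs a)) y + \<kappa> * pser (diffs a) y + e * pser (diffs c) y + w * pser a y = 0"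
proof -
  have s: "(\<lambda>k. d k * y ^ k) sums pser d y" if "entire_coeffs d" for d
    using that unfolding entire_coeffs_def pser_def by (auto intro: summable_sums)
  have "(\<lambda>k. y * (diffs (diffs a) k * y ^ k)) sums (y * pser (diffs (diffs a)) y)"
    by (intro sums_mult s entire_coeffs_diffs a)
  then have "(\<lambda>k. (of_nat (Suc k) * diffs a (Suc k)) * y ^ Suc k) sums (y * pser (diffs (diffs a)) y)"
    by (simp add: diffs_def algebra_simps)
  then have 2: "(\<lambda>k. (of_nat k * diffs a k) * y ^ k) sums (y * pser (diffs (diffs a)) y)"
    using sums_Suc_iff[of "\<lambda>k. (of_nat k * diffs a k) * y ^ k" "y * pser (diffs (diffs a)) y"] by simp
  have "(\<lambda>k. (of_nat k * diffs a k) * y ^ k + \<kappa> * (diffs a k * y ^ k) + e * (diffs c k * y ^ k) + w * (a k * y ^ k))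
    sums (y * pser (diffs (diffs a)) y + \<kappa> * pser (diffs a) y + e * pser (diffs c) y + w * pser a y)"
    by (intro sums_add sums_mult s entire_coeffs_diffs a c 2)
  moreover have "(of_nat k * diffs a k) * y ^ k + \<kappa> * (diffs a k * y ^ k) + e * (diffs c k * y ^ k) + w * (a k * y ^ k) = 0" for k
  proof -
    have "(of_nat k * diffs a k) * y ^ k + \<kappa> * (diffs a k * y ^ k) + e * (diffs c k * y ^ k) + w * (a k * y ^ k)
      = (of_nat (Suc k) * (of_nat k + \<kappa>) * a (Suc k) + e * (of_nat (Suc k) * c (Suc k)) + w * a k) * y ^ k"
      by (simp add: diffs_def algebra_simps)
    then show ?thesis by (simp only: rec mult_zero_left)
  qed
  ultimately have "(\<lambda>k. 0) sums (y * pser (diffs (diffs a)) y + \<kappa> * pser (diffs a) y + e * pser (diffs c) y + w * pser a y)"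
    by simp
  then show ?thesis using sums_unique2[OF _ sums_zero] by blast
qed

context bessel_setting
begin

text \<open>
A classical solution of \<open>\<tau> S = z S\<close> with \<open>S b = 0\<close> is the element \<open>adj_fun\<close> for \<open>k = z S\<close> and \<open>c = - S' b\<close>: its
brackets with the homogeneous solutions have the densities \<open>z S v\<close> and \<open>z S u\<close>. Its boundary values
are the limits of the brackets.
\<close>

lemma ode_solution_eigen:
  fixes S S' :: "real \<Rightarrow> complex"
  assumes S: "\<And>x. 0 < x \<Longrightarrow> (S has_vector_derivative S' x) (at x)"
    and S': "\<And>x. 0 < x \<Longrightarrow> (S' has_vector_derivative (of_real (pot x) - z) * S x) (at x)"
    and sq: "sq_integrable b S" and Sb: "S b = 0"
    and l0: "((\<lambda>x. S x * of_real (solu' x) - S' x * of_real (solu x)) \<longlongrightarrow> l0) (at_right 0)"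
    and l1: "((\<lambda>x. S x * of_real (solv' x) - S' x * of_real (solv x)) \<longlongrightarrow> l1) (at_right 0)"
  shows "L2_class b S \<in> eigenspace X Amax z"
    "\<Gamma>0 (L2_class b S) = l0" "\<Gamma>1 (L2_class b S) = l1"
proof -
  let ?k = "\<lambda>x. z * S x" and ?c = "- S' b"
  have k: "sq_integrable b ?k" by (rule sq_integrable_scale[OF sq])
  have key: "S x * of_real (w' x) - S' x * of_real (w x) = ?c * of_real (w b) - upper w ?k x"
    if w: "sol_pair w w'" and x: "0 < x" "x \<le> b" for w w' x
  proof -
    let ?A = "\<lambda>x. S x * of_real (w' x) - S' x * of_real (w x)"
    have "((\<lambda>x. of_real (w x) * ?k x) has_integral (?A b - ?A x)) {x..b}"
    proof (rule fundamental_theorem_of_calculus[OF x(2)])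
      fix t assume "t \<in> {x..b}"
      then have t: "0 < t" using x by simp
      have wd: "((\<lambda>x. complex_of_real (w x)) has_vector_derivative of_real (w' t)) (at t)"
        "((\<lambda>x. complex_of_real (w' x)) has_vector_derivative of_real (pot t * w t)) (at t)"
        using w t by (auto simp: sol_pair_def intro!: has_vector_derivative_of_real_lift simp del: of_real_mult)
      have "(?A has_vector_derivative
        (S t * of_real (pot t * w t) + S' t * of_real (w' t)) - (S' t * of_real (w' t) + (of_real (pot t) - z) * S t * of_real (w t))) (at t)"
        by (intro has_vector_derivative_diff has_vector_derivative_mult S S' wd t)
      moreover have "(S t * of_real (pot t * w t) + S' t * of_real (w' t)) - (S' t * of_real (w' t) + (of_real (pot t) - z) * S t * of_real (w t))
         = of_real (w t) * ?k t" by (simp add: algebra_simps)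
      ultimately show "(?A has_vector_derivative of_real (w t) * ?k t) (at t within {x..b})"
        by (simp only: has_vector_derivative_at_within)
    qed
    then have "upper w ?k x = ?A b - ?A x" unfolding upper_def by (rule integral_unique)
    then show ?thesis by (simp add: Sb algebra_simps)
  qed
  have cu: "S x * of_real (solv' x) - S' x * of_real (solv x) = coefu ?k ?c x"
    and cv: "S x * of_real (solu' x) - S' x * of_real (solu x) = coefv ?k ?c x" if "0 < x" "x \<le> b" for x
    using key[OF sol_pairs(2) that] key[OF sol_pairs(1) that] by (simp_all add: coefu_def coefv_def)
  have "S x = adj_fun ?k ?c x" if x: "0 < x" "x < b" for x
  proof -
    have x': "x \<le> b" using x by simp
    have "adj_fun ?k ?c x = S x * (of_real (solu x) * of_real (solv' x) - of_real (solu' x) * of_real (solv x))"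
      unfolding adj_fun_coef cu[OF x(1) x', symmetric] cv[OF x(1) x', symmetric] by (simp add: algebra_simps)
    then show ?thesis using wronskian_complex[OF x(1)] by simp
  qed
  then have cls: "L2_class b S = L2_class b (adj_fun ?k ?c)" by (intro L2_class_cong_Ioo) auto
  show "L2_class b S \<in> eigenspace X Amax z"
    unfolding eigenspace_def mem_Collect_eq vscale_L2[OF sq] adjoint_bessel_eq
    using cls k by blast
  have ev: "\<forall>\<^sub>F x in at_right 0. 0 < x \<and> x \<le> b"
    unfolding eventually_at_right_field using b_pos by (meson less_imp_le)
  have "(coefv ?k ?c \<longlongrightarrow> l0) (at_right 0)"
    by (rule Lim_transform_eventually[OF l0]) (use ev in eventually_elim, simp only: cv)
  then have "l0 = coefv ?k ?c 0"
    using coef_limits(2)[OF k, of ?c] by (intro tendsto_unique[of "at_right 0"]) auto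
  then show "\<Gamma>0 (L2_class b S) = l0"
    unfolding cls Gamma0_eq[OF k] by (simp add: coefv_def upper_0)
  have "(coefu ?k ?c \<longlongrightarrow> l1) (at_right 0)"
    by (rule Lim_transform_eventually[OF l1]) (use ev in eventually_elim, simp only: cu)
  then have "l1 = coefu ?k ?c 0"
    using coef_limits(1)[OF k, of ?c] by (intro tendsto_unique[of "at_right 0"]) auto
  then show "\<Gamma>1 (L2_class b S) = l1"
    unfolding cls Gamma1_eq[OF k] by (simp add: coefu_def upper_0)
qed

text \<open>
The logarithm in \<open>solv\<close> contributes the term \<open>u\<close> to \<open>x v'\<close>; this number switches the term on for \<open>\<nu> = 0\<close>.
\<close>

definition logflag :: complex where "logflag = (if \<nu> = 0 then 1 else 0)"

lemma x_solu': "0 < x \<Longrightarrow> x * solu' x = (1/2 + \<nu>) * solu x"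
proof -
  assume x: "0 < x"
  have "x * x powr (\<nu> - 1/2) = x powr (1 + (\<nu> - 1/2))" using x by (simp only: powr_add powr_one)
  then show ?thesis by (simp add: solu_def solu'_def algebra_simps)
qed

lemma x_solv': "0 < x \<Longrightarrow> complex_of_real (x * solv' x) = of_real ((1/2 - \<nu>) * solv x) + logflag * of_real (solu x)"
proof (cases "\<nu> = 0")
  case True
  assume x: "0 < x"
  have "x * x powr (-1/2) = x powr (1 + (-1/2))" using x by (simp only: powr_add powr_one)
  then have "x * (x powr (-1/2) * (ln x / 2 + 1)) = x powr (1/2) * (ln x / 2 + 1)" by simp
  then have "x * solv' x = (1/2 - \<nu>) * solv x + solu x"
    using True unfolding solv_def solv'_def solu_def by (simp add: algebra_simps)
  then have "complex_of_real (x * solv' x) = of_real ((1/2 - \<nu>) * solv x + solu x)" by (rule arg_cong)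
  then show ?thesis using True unfolding logflag_def by simp
next
  case False
  assume x: "0 < x"
  have "x * x powr (-1/2 - \<nu>) = x powr (1 + (-1/2 - \<nu>))" using x by (simp only: powr_add powr_one)
  then have "x * x powr (-1/2 - \<nu>) = x powr (1/2 - \<nu>)" by simp
  then have "x * solv' x = (1/2 - \<nu>) * solv x"
    using False unfolding solv_def solv'_def by (simp add: field_simps)
  then have "complex_of_real (x * solv' x) = of_real ((1/2 - \<nu>) * solv x)" by (rule arg_cong)
  then show ?thesis using False unfolding logflag_def by simp
qed

definition frob_fun :: "(nat \<Rightarrow> complex) \<Rightarrow> (nat \<Rightarrow> complex) \<Rightarrow> real \<Rightarrow> complex" where
  "frob_fun a c x = of_real (solu x) * pser a (of_real (x\<^sup>2)) + of_real (solv x) * pser c (of_real (x\<^sup>2))"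

text \<open>
The recurrences that make \<open>u a(x\<^sup>2) + v c(x\<^sup>2)\<close> a solution of \<open>\<tau> f = z f\<close>, in a form common to \<open>\<nu> = 0\<close> and \<open>\<nu> > 0\<close>.
\<close>

definition frob_pair :: "complex \<Rightarrow> (nat \<Rightarrow> complex) \<Rightarrow> (nat \<Rightarrow> complex) \<Rightarrow> bool" where
  "frob_pair z a c \<longleftrightarrow> entire_coeffs a \<and> entire_coeffs c \<and>
     (\<forall>k. of_nat (Suc k) * (of_nat k + of_real (1 + \<nu>)) * a (Suc k) + logflag * (of_nat (Suc k) * c (Suc k)) + z / 4 * a k = 0) \<and>
     (\<forall>k. of_nat (Suc k) * (of_nat k + of_real (1 - \<nu>)) * c (Suc k) + z / 4 * c k = 0)"

lemma pser_square_deriv: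
  assumes "entire_coeffs a"
  shows "((\<lambda>x. pser a (of_real (x\<^sup>2))) has_vector_derivative of_real (2 * x) * pser (diffs a) (of_real (x\<^sup>2))) (at x)"
proof -
  have "((\<lambda>x::real. x\<^sup>2) has_real_derivative 2 * x) (at x)" by (auto intro!: derivative_eq_intros)
  then have "((\<lambda>x. complex_of_real (x\<^sup>2)) has_vector_derivative of_real (2 * x)) (at x)"
    by (rule has_vector_derivative_of_real_lift)
  from field_vector_diff_chain_at[OF this pser_deriv[OF assms]]
  show ?thesis by (simp add: o_def)
qed

lemma continuous_pser_square:
  assumes "entire_coeffs a"
  shows "continuous_on S (\<lambda>x. pser a (of_real (x\<^sup>2)))"
  by (rule continuous_at_imp_continuous_on)
    (use pser_square_deriv[OF assms] in \<open>auto intro: has_vector_derivative_continuous simp: \<close>)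

lemma tendsto_sol_products:
  "((\<lambda>x. complex_of_real (x * (solu x * solu x))) \<longlongrightarrow> 0) (at_right 0)"
  "((\<lambda>x. complex_of_real (x * (solu x * solv x))) \<longlongrightarrow> 0) (at_right 0)"
  "((\<lambda>x. complex_of_real (x * (solv x * solv x))) \<longlongrightarrow> 0) (at_right 0)"
proof -
  obtain C1 where C1: "C1 \<ge> 0" "\<And>x. 0 < x \<Longrightarrow> x \<le> b \<Longrightarrow> \<bar>solu x\<bar> \<le> C1 * x powr (1/2 - sing)"
    using solu_weak_bound by blast
  obtain C2 where C2: "C2 \<ge> 0" "\<And>x. 0 < x \<Longrightarrow> x \<le> b \<Longrightarrow> \<bar>solv x\<bar> \<le> C2 * x powr (1/2 - sing)"
    using solv_weak_bound by blast
  have g: "((\<lambda>x. complex_of_real (x * (f x * g x))) \<longlongrightarrow> 0) (at_right 0)"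
    if f: "C \<ge> 0" "\<And>x. 0 < x \<Longrightarrow> x \<le> b \<Longrightarrow> \<bar>f x\<bar> \<le> C * x powr (1/2 - sing)"
      and g: "D \<ge> 0" "\<And>x. 0 < x \<Longrightarrow> x \<le> b \<Longrightarrow> \<bar>g x\<bar> \<le> D * x powr (1/2 - sing)" for f g :: "real \<Rightarrow> real" and C D
  proof (rule tendsto_0_powr_bound[OF _ b_pos])
    show "0 < 2 - 2 * sing" using sing_bounds by simp
    fix x assume x: "0 < x" "x \<le> b"
    have "norm (complex_of_real (x * (f x * g x))) = x * (\<bar>f x\<bar> * \<bar>g x\<bar>)"
      using x unfolding norm_of_real by (simp add: abs_mult)
    also have "\<dots> \<le> x * ((C * x powr (1/2 - sing)) * (D * x powr (1/2 - sing)))"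
      using x f g by (intro mult_left_mono mult_mono) auto
    also have "\<dots> = C * D * (x powr 1 * (x powr (1/2 - sing) * x powr (1/2 - sing)))" using x by simp
    also have "x powr 1 * (x powr (1/2 - sing) * x powr (1/2 - sing)) = x powr (2 - 2 * sing)"
      by (simp only: powr_add[symmetric]) simp
    finally show "norm (complex_of_real (x * (f x * g x))) \<le> C * D * x powr (2 - 2 * sing)" .
  qed
  show "((\<lambda>x. complex_of_real (x * (solu x * solu x))) \<longlongrightarrow> 0) (at_right 0)"
    "((\<lambda>x. complex_of_real (x * (solu x * solv x))) \<longlongrightarrow> 0) (at_right 0)"
    "((\<lambda>x. complex_of_real (x * (solv x * solv x))) \<longlongrightarrow> 0) (at_right 0)"
    by (rule g[OF C1 C1], assumption+, rule g[OF C1 C2], assumption+, rule g[OF C2 C2])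
qed

text \<open>
The brackets with \<open>u\<close> and \<open>v\<close> are \<open>- c(x\<^sup>2)\<close> and \<open>a(x\<^sup>2)\<close> up to terms with a factor \<open>x u\<^sup>2\<close>, \<open>x u v\<close> or
\<open>x v\<^sup>2\<close>, which vanish at \<open>0\<close>. Hence the boundary values are the constant terms of the two series.
\<close>

lemma frob_fun_eigen:
  assumes fp: "frob_pair z a c" and zero: "frob_fun a c b = 0"
  shows "L2_class b (frob_fun a c) \<in> eigenspace X Amax z"
    "\<Gamma>0 (L2_class b (frob_fun a c)) = - c 0" "\<Gamma>1 (L2_class b (frob_fun a c)) = a 0"
proof -
  have a: "entire_coeffs a" and c: "entire_coeffs c" using fp by (auto simp: frob_pair_def)
  let ?u = "\<lambda>x. complex_of_real (solu x)" and ?v = "\<lambda>x. complex_of_real (solv x)"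
  let ?u' = "\<lambda>x. complex_of_real (solu' x)" and ?v' = "\<lambda>x. complex_of_real (solv' x)"
  let ?P = "\<lambda>d x. pser d (complex_of_real (x\<^sup>2))"
  let ?x = "\<lambda>x. complex_of_real (2 * x)"
  define S' where "S' x = (?u x * (?x x * ?P (diffs a) x) + ?u' x * ?P a x) + (?v x * (?x x * ?P (diffs c) x) + ?v' x * ?P c x)" for x
  note d2 = entire_coeffs_diffs
  have du: "(?u has_vector_derivative ?u' x) (at x)" "(?u' has_vector_derivative of_real (pot x * solu x)) (at x)"
    "(?v has_vector_derivative ?v' x) (at x)" "(?v' has_vector_derivative of_real (pot x * solv x)) (at x)" if "0 < x" for x
    by (intro has_vector_derivative_of_real_lift solu_deriv solu'_deriv solv_deriv solv'_deriv that)+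
  have dx: "(?x has_vector_derivative 2) (at x)" for x
  proof -
    have "((\<lambda>x::real. 2 * x) has_real_derivative 2) (at x)" by (auto intro!: derivative_eq_intros)
    from has_vector_derivative_of_real_lift[OF this] show ?thesis by simp
  qed
  have ode: "of_real (x\<^sup>2) * ?P (diffs (diffs a)) x + of_real (1 + \<nu>) * ?P (diffs a) x + logflag * ?P (diffs c) x + z / 4 * ?P a x = 0"
    "of_real (x\<^sup>2) * ?P (diffs (diffs c)) x + of_real (1 - \<nu>) * ?P (diffs c) x + 0 * ?P (diffs c) x + z / 4 * ?P c x = 0" for x
  proof -
    have r: "of_nat (Suc k) * (of_nat k + of_real (1 + \<nu>)) * a (Suc k) + logflag * (of_nat (Suc k) * c (Suc k)) + z / 4 * a k = 0"
      "of_nat (Suc k) * (of_nat k + of_real (1 - \<nu>)) * c (Suc k) + 0 * (of_nat (Suc k) * c (Suc k)) + z / 4 * c k = 0" for k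
      using fp unfolding frob_pair_def by auto
    show "of_real (x\<^sup>2) * ?P (diffs (diffs a)) x + of_real (1 + \<nu>) * ?P (diffs a) x + logflag * ?P (diffs c) x + z / 4 * ?P a x = 0"
      "of_real (x\<^sup>2) * ?P (diffs (diffs c)) x + of_real (1 - \<nu>) * ?P (diffs c) x + 0 * ?P (diffs c) x + z / 4 * ?P c x = 0"
      by (rule frobenius_ode[OF a c r(1)], rule frobenius_ode[OF c c r(2)])
  qed
  show "L2_class b (frob_fun a c) \<in> eigenspace X Amax z"
    "\<Gamma>0 (L2_class b (frob_fun a c)) = - c 0" "\<Gamma>1 (L2_class b (frob_fun a c)) = a 0"
  proof -
    have D1: "(frob_fun a c has_vector_derivative S' x) (at x)" if "0 < x" for x
      unfolding frob_fun_def[abs_def] S'_def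
      by (intro has_vector_derivative_add has_vector_derivative_mult du[OF that] pser_square_deriv a c)
    have D2: "(S' has_vector_derivative (of_real (pot x) - z) * frob_fun a c x) (at x)" if x: "0 < x" for x
    proof -
      have "(S' has_vector_derivative
         ((?u x * (?x x * (?x x * ?P (diffs (diffs a)) x) + 2 * ?P (diffs a) x) + ?u' x * (?x x * ?P (diffs a) x))
          + (?u' x * (?x x * ?P (diffs a) x) + of_real (pot x * solu x) * ?P a x))
        + ((?v x * (?x x * (?x x * ?P (diffs (diffs c)) x) + 2 * ?P (diffs c) x) + ?v' x * (?x x * ?P (diffs c) x))
          + (?v' x * (?x x * ?P (diffs c) x) + of_real (pot x * solv x) * ?P c x))) (at x)"
        unfolding S'_def[abs_def]
        by (intro has_vector_derivative_add has_vector_derivative_mult du[OF x] dx pser_square_deriv d2 a c)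
      moreover have "((?u x * (?x x * (?x x * ?P (diffs (diffs a)) x) + 2 * ?P (diffs a) x) + ?u' x * (?x x * ?P (diffs a) x))
          + (?u' x * (?x x * ?P (diffs a) x) + of_real (pot x * solu x) * ?P a x))
        + ((?v x * (?x x * (?x x * ?P (diffs (diffs c)) x) + 2 * ?P (diffs c) x) + ?v' x * (?x x * ?P (diffs c) x))
          + (?v' x * (?x x * ?P (diffs c) x) + of_real (pot x * solv x) * ?P c x))
        = (of_real (pot x) - z) * frob_fun a c x"
      proof -
        have xu: "complex_of_real x * ?u' x = (1/2 + of_real \<nu>) * ?u x"
          using arg_cong[OF x_solu'[OF x], of complex_of_real] by simp
        have xv: "complex_of_real x * ?v' x = (1/2 - of_real \<nu>) * ?v x + logflag * ?u x"
          using x_solv'[OF x] by simp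
        have alg: "((U * (2*X * (2*X * A2) + 2 * A1) + U' * (2*X * A1)) + (U' * (2*X * A1) + q * U * A))
          + ((V * (2*X * (2*X * C2) + 2 * C1) + V' * (2*X * C1)) + (V' * (2*X * C1) + q * V * C))
          = (q - z) * (U * A + V * C)"
          if "X * U' = (1/2 + n) * U" "X * V' = (1/2 - n) * V + e * U"
            "X^2 * A2 + (1 + n) * A1 + e * C1 + z/4 * A = 0" "X^2 * C2 + (1 - n) * C1 + z/4 * C = 0"
          for X U U' V V' A A1 A2 C C1 C2 q n e :: complex
        proof -
          have "((U * (2*X * (2*X * A2) + 2 * A1) + U' * (2*X * A1)) + (U' * (2*X * A1) + q * U * A))
          + ((V * (2*X * (2*X * C2) + 2 * C1) + V' * (2*X * C1)) + (V' * (2*X * C1) + q * V * C))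
          - (q - z) * (U * A + V * C) =
            4 * U * (X^2 * A2 + (1 + n) * A1 + e * C1 + z/4 * A) + 4 * V * (X^2 * C2 + (1 - n) * C1 + z/4 * C)
            + 4 * A1 * (X * U' - (1/2 + n) * U) + 4 * C1 * (X * V' - ((1/2 - n) * V + e * U))"
            by (simp add: algebra_simps power2_eq_square)
          also have "\<dots> = 0" unfolding that by simp
          finally show ?thesis by simp
        qed
        show ?thesis
          using alg[OF xu xv, of "?P (diffs (diffs a)) x" "?P (diffs a) x" "?P (diffs c) x" "?P a x" "?P (diffs (diffs c)) x" "?P c x" "of_real (pot x)"]
            ode[of x] by (simp add: frob_fun_def)
      qed
      ultimately show ?thesis by simp
    qed
    have sq: "sq_integrable b (frob_fun a c)"
      unfolding frob_fun_def[abs_def]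
      using sq_integrable_add[OF sq_integrable_mult_continuous[OF sq_solu continuous_pser_square[OF a]]
          sq_integrable_mult_continuous[OF sq_solv continuous_pser_square[OF c]]]
      by (simp add: mult.commute)
    have lim: "(?P d \<longlongrightarrow> d 0) (at_right 0)" if "entire_coeffs d" for d
    proof -
      have "((\<lambda>x. ?P d x) \<longlongrightarrow> ?P d 0) (at 0)"
        using has_vector_derivative_continuous[OF pser_square_deriv[OF that, of 0]] by (simp add: continuous_within)
      then have "((\<lambda>x. ?P d x) \<longlongrightarrow> ?P d 0) (at_right 0)"
        by (rule tendsto_within_subset) auto
      then show ?thesis by (simp add: pser_0)
    qed
    have W: "?u x * ?v' x - ?u' x * ?v x = 1" if "0 < x" for x by (rule wronskian_complex[OF that])
    have ev: "\<forall>\<^sub>F x in at_right (0::real). 0 < x" by (rule eventually_at_right_less)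
    note L = tendsto_sol_products
    have l0: "((\<lambda>x. frob_fun a c x * ?u' x - S' x * ?u x) \<longlongrightarrow> - c 0) (at_right 0)"
    proof (rule Lim_transform_eventually)
      show "((\<lambda>x. - ?P c x - 2 * (of_real (x * (solu x * solu x)) * ?P (diffs a) x + of_real (x * (solu x * solv x)) * ?P (diffs c) x))
         \<longlongrightarrow> - c 0) (at_right 0)"
        using tendsto_diff[OF tendsto_minus[OF lim[OF c]] tendsto_mult[OF tendsto_const[of 2]
          tendsto_add[OF tendsto_mult[OF L(1) lim[OF d2[OF a]]] tendsto_mult[OF L(2) lim[OF d2[OF c]]]]]] by simp
      show "\<forall>\<^sub>F x in at_right 0. - ?P c x - 2 * (of_real (x * (solu x * solu x)) * ?P (diffs a) x + of_real (x * (solu x * solv x)) * ?P (diffs c) x)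
         = frob_fun a c x * ?u' x - S' x * ?u x"
        using ev
      proof eventually_elim
        case (elim x)
        have "frob_fun a c x * ?u' x - S' x * ?u x = - ?P c x * (?u x * ?v' x - ?u' x * ?v x)
           - 2 * (of_real (x * (solu x * solu x)) * ?P (diffs a) x + of_real (x * (solu x * solv x)) * ?P (diffs c) x)"
          by (simp add: frob_fun_def S'_def algebra_simps)
        then show ?case unfolding W[OF elim] by simp
      qed
    qed
    have l1: "((\<lambda>x. frob_fun a c x * ?v' x - S' x * ?v x) \<longlongrightarrow> a 0) (at_right 0)"
    proof (rule Lim_transform_eventually)
      show "((\<lambda>x. ?P a x - 2 * (of_real (x * (solu x * solv x)) * ?P (diffs a) x + of_real (x * (solv x * solv x)) * ?P (diffs c) x))
         \<longlongrightarrow> a 0) (at_right 0)"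
        using tendsto_diff[OF lim[OF a] tendsto_mult[OF tendsto_const[of 2]
          tendsto_add[OF tendsto_mult[OF L(2) lim[OF d2[OF a]]] tendsto_mult[OF L(3) lim[OF d2[OF c]]]]]] by simp
      show "\<forall>\<^sub>F x in at_right 0. ?P a x - 2 * (of_real (x * (solu x * solv x)) * ?P (diffs a) x + of_real (x * (solv x * solv x)) * ?P (diffs c) x)
         = frob_fun a c x * ?v' x - S' x * ?v x"
        using ev
      proof eventually_elim
        case (elim x)
        have "frob_fun a c x * ?v' x - S' x * ?v x = ?P a x * (?u x * ?v' x - ?u' x * ?v x)
           - 2 * (of_real (x * (solu x * solv x)) * ?P (diffs a) x + of_real (x * (solv x * solv x)) * ?P (diffs c) x)"
          by (simp add: frob_fun_def S'_def algebra_simps)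
        then show ?case unfolding W[OF elim] by simp
      qed
    qed
    show "L2_class b (frob_fun a c) \<in> eigenspace X Amax z"
      "\<Gamma>0 (L2_class b (frob_fun a c)) = - c 0" "\<Gamma>1 (L2_class b (frob_fun a c)) = a 0"
      by (rule ode_solution_eigen[OF D1 D2 sq zero l0 l1]; assumption)+
  qed
qed

end

section \<open>Bessel functions\<close>

text \<open>
The Taylor coefficients, in \<open>y = x\<^sup>2\<close>, of the Bessel function of order \<open>\<mu>\<close> and argument \<open>x \<surd>z\<close>, divided by the power of
\<open>x\<close> and normalised to constant term \<open>1\<close>. They are polynomials in \<open>z\<close>, which keeps the branches of \<open>\<surd>z\<close> out of the
construction of the eigenfunctions.
\<close>

definition bcoef :: "real \<Rightarrow> complex \<Rightarrow> nat \<Rightarrow> complex" where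
  "bcoef \<mu> z k = of_real (Gamma (1 + \<mu>)) * (rGamma (of_real (real k + \<mu> + 1)) / fact k * (- z / 4) ^ k)"

text \<open>
The coefficients of the regular part of the logarithmic solution for \<open>\<nu> = 0\<close>.
\<close>

definition lcoef :: "complex \<Rightarrow> nat \<Rightarrow> complex" where
  "lcoef z k = - harm k * bcoef 0 z k"

lemma bcoef_0: "\<mu> > -1 \<Longrightarrow> bcoef \<mu> z 0 = 1"
proof -
  assume "\<mu> > -1"
  then have "Gamma (1 + \<mu>) > 0" by (intro Gamma_real_pos) simp
  then have "Gamma (1 + \<mu>) * rGamma (\<mu> + 1) = 1"
    by (simp add: rGamma_inverse_Gamma add.commute)
  then have "complex_of_real (Gamma (1 + \<mu>)) * of_real (rGamma (\<mu> + 1)) = 1"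
    by (metis of_real_1 of_real_mult)
  then show ?thesis by (simp add: bcoef_def rGamma_complex_of_real del: of_real_add)
qed

lemma bcoef_rec: "of_nat (Suc k) * (of_nat k + of_real (1 + \<mu>)) * bcoef \<mu> z (Suc k) = - z / 4 * bcoef \<mu> z k"
proof -
  let ?w = "complex_of_real (real k + \<mu> + 1)"
  have 1: "complex_of_real (real (Suc k) + \<mu> + 1) = ?w + 1" "of_nat k + complex_of_real (1 + \<mu>) = ?w" by simp_all
  have "of_nat (Suc k) * (of_nat k + of_real (1 + \<mu>)) * bcoef \<mu> z (Suc k)
    = of_real (Gamma (1 + \<mu>)) * ((?w * rGamma (?w + 1)) * (of_nat (Suc k) / fact (Suc k)) * (- z / 4) ^ Suc k)"
    unfolding bcoef_def 1 by (simp only: ac_simps times_divide_eq_right times_divide_eq_left)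
  also have "of_nat (Suc k) / fact (Suc k) = (1 / fact k :: complex)"
    by (simp add: divide_simps del: of_nat_Suc)
  also have "?w * rGamma (?w + 1) = rGamma ?w" by (rule rGamma_plus1)
  finally have e: "of_nat (Suc k) * (of_nat k + of_real (1 + \<mu>)) * bcoef \<mu> z (Suc k)
    = of_real (Gamma (1 + \<mu>)) * (rGamma ?w * (1 / fact k) * (- z / 4) ^ Suc k)" .
  have gen: "G * (R * (1 / F) * (c * P)) = c * (G * (R / F * P))" for G R F c P :: complex
    by simp
  show ?thesis unfolding e unfolding bcoef_def power_Suc by (rule gen)
qed

lemma entire_bcoef:
  assumes "\<mu> > -1" shows "entire_coeffs (bcoef \<mu> z)"
  unfolding entire_coeffs_def
proof
  fix y
  show "summable (\<lambda>k. bcoef \<mu> z k * y ^ k)"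
  proof (rule summable_nat_ratio[of _ "norm (z / 4 * y)"])
    fix k
    have "real k * 1 \<le> real (Suc k) * (real k + 1 + \<mu>)" if "k \<noteq> 0"
    proof -
      have "1 \<le> real k + 1 + \<mu>" using that assms by (simp add: Suc_le_eq[symmetric])
      then show ?thesis by (intro mult_mono) auto
    qed
    then have "real k \<le> real (Suc k) * (real k + 1 + \<mu>)" using assms by (cases "k = 0") auto
    also have "\<dots> = norm (of_nat (Suc k) * (of_nat k + complex_of_real (1 + \<mu>)))"
    proof -
      have "of_nat (Suc k) * (of_nat k + complex_of_real (1 + \<mu>)) = complex_of_real (real (Suc k) * (real k + 1 + \<mu>))"
        by simp
      moreover have "0 \<le> real (Suc k) * (real k + 1 + \<mu>)" using assms by simp
      ultimately show ?thesis by (simp only: norm_of_real abs_of_nonneg)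
    qed
    finally have n: "real k \<le> norm (of_nat (Suc k) * (of_nat k + complex_of_real (1 + \<mu>)))" .
    have "norm (bcoef \<mu> z (Suc k) * y ^ Suc k) * of_nat k
      \<le> norm (bcoef \<mu> z (Suc k) * y ^ Suc k) * norm (of_nat (Suc k) * (of_nat k + complex_of_real (1 + \<mu>)))"
      by (rule mult_left_mono) (use n in auto)
    also have "\<dots> = norm ((of_nat (Suc k) * (of_nat k + complex_of_real (1 + \<mu>)) * bcoef \<mu> z (Suc k)) * y ^ Suc k)"
      by (simp only: norm_mult ac_simps)
    also have "\<dots> = norm (z / 4 * y) * norm (bcoef \<mu> z k * y ^ k)"
      unfolding bcoef_rec by (simp add: norm_mult norm_divide ac_simps)
    finally show "norm (bcoef \<mu> z (Suc k) * y ^ Suc k) * of_nat k \<le> norm (z / 4 * y) * norm (bcoef \<mu> z k * y ^ k)" .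
  qed
qed

lemma norm_harm_le: "norm (harm k :: complex) \<le> 2 ^ k"
proof (induction k)
  case (Suc k)
  have "norm (harm (Suc k) :: complex) \<le> norm (harm k :: complex) + norm (inverse (of_nat (Suc k)) :: complex)"
    unfolding harm_Suc by (rule norm_triangle_ineq)
  also have "norm (inverse (of_nat (Suc k)) :: complex) \<le> 1"
    unfolding norm_inverse norm_of_nat by (simp add: divide_simps)
  also have "norm (harm k :: complex) + 1 \<le> 2 ^ k + 2 ^ k"
    using Suc one_le_power[of 2 k] by (intro add_mono) auto
  finally show ?case by simp
qed (simp add: harm_def)

lemma entire_lcoef: "entire_coeffs (lcoef z)"
  unfolding entire_coeffs_def
proof
  fix y :: complex
  have "summable (\<lambda>k. bcoef 0 z k * (2 * of_real (norm y) + 1) ^ k)"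
    using entire_bcoef[of 0 z] unfolding entire_coeffs_def by simp
  moreover have "norm (2 * y) < norm (2 * complex_of_real (norm y) + 1)"
  proof -
    have "2 * complex_of_real (norm y) + 1 = of_real (2 * norm y + 1)" by simp
    then have "norm (2 * complex_of_real (norm y) + 1) = 2 * norm y + 1" by (simp only: norm_of_real) simp
    then show ?thesis by (simp add: norm_mult)
  qed
  ultimately have s: "summable (\<lambda>k. norm (bcoef 0 z k * (2 * y) ^ k))"
    by (rule powser_insidea)
  show "summable (\<lambda>k. lcoef z k * y ^ k)"
  proof (rule summable_comparison_test'[OF s])
    fix k
    have "norm (lcoef z k * y ^ k) = norm (harm k :: complex) * (norm (bcoef 0 z k) * norm y ^ k)"
      by (simp add: lcoef_def norm_mult norm_power)
    also have "\<dots> \<le> 2 ^ k * (norm (bcoef 0 z k) * norm y ^ k)"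
      by (intro mult_right_mono norm_harm_le) auto
    also have "\<dots> = norm (bcoef 0 z k * (2 * y) ^ k)"
      by (simp add: norm_mult norm_power power_mult_distrib)
    finally show "norm (lcoef z k * y ^ k) \<le> norm (bcoef 0 z k * (2 * y) ^ k)" .
  qed
qed

lemma lcoef_0: "lcoef z 0 = 0" by (simp add: lcoef_def harm_def)

lemma lcoef_rec:
  "of_nat (Suc k) * (of_nat k + 1) * lcoef z (Suc k) + of_nat (Suc k) * bcoef 0 z (Suc k) + z / 4 * lcoef z k = 0"
proof -
  have r: "of_nat (Suc k) * (of_nat k + 1) * bcoef 0 z (Suc k) = - z / 4 * bcoef 0 z k"
    using bcoef_rec[of k 0 z] by simp
  have "of_nat (Suc k) * (of_nat k + 1) * lcoef z (Suc k) =
     - (harm k * (of_nat (Suc k) * (of_nat k + 1) * bcoef 0 z (Suc k)))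
     - (inverse (of_nat (Suc k)) * of_nat (Suc k)) * ((of_nat k + 1) * bcoef 0 z (Suc k))"
  proof -
    have gen: "K * L * (- (H + i) * c) = - (H * (K * L * c)) - (i * K) * (L * c)" for K L H i c :: complex
      by (simp add: algebra_simps)
    show ?thesis unfolding lcoef_def harm_Suc by (rule gen)
  qed
  also have "inverse (of_nat (Suc k)) * of_nat (Suc k) = (1::complex)"
    by (rule left_inverse) (simp del: of_nat_Suc)
  finally have e: "of_nat (Suc k) * (of_nat k + 1) * lcoef z (Suc k) =
     - (harm k * (- z / 4 * bcoef 0 z k)) - 1 * ((of_nat k + 1) * bcoef 0 z (Suc k))"
    unfolding r .
  show ?thesis unfolding e unfolding lcoef_def by (simp add: algebra_simps)
qed

lemma bessel_J_pser:
  assumes "\<mu> > -1"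
  shows "bessel_J \<mu> (of_real b * s) =
    (if \<mu> = 0 then 1 else (of_real b * s / 2) powr of_real \<mu>) * pser (bcoef \<mu> (s\<^sup>2)) (of_real (b\<^sup>2)) / of_real (Gamma (1 + \<mu>))"
proof -
  let ?G = "complex_of_real (Gamma (1 + \<mu>))"
  have "Gamma (1 + \<mu>) > 0" using assms by (intro Gamma_real_pos) simp
  then have G: "?G \<noteq> 0" by simp
  have t: "(-1) ^ k * rGamma (of_real (real k + \<mu> + 1)) / fact k * (of_real b * s / 2) ^ (2 * k)
     = bcoef \<mu> (s\<^sup>2) k * of_real (b\<^sup>2) ^ k / ?G" for k
  proof -
    have "(of_real b * s / 2) ^ (2 * k) = (s\<^sup>2 / 4) ^ k * of_real (b\<^sup>2) ^ k"
      by (simp add: power_mult power_mult_distrib power_divide)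
    moreover have "(- s\<^sup>2 / 4) ^ k = (-1) ^ k * (s\<^sup>2 / 4) ^ k"
      by (simp add: power_mult_distrib[symmetric])
    ultimately show ?thesis using G by (simp add: bcoef_def del: of_real_add of_real_power)
  qed
  have "(\<Sum>k. bcoef \<mu> (s\<^sup>2) k * of_real (b\<^sup>2) ^ k / ?G) = pser (bcoef \<mu> (s\<^sup>2)) (of_real (b\<^sup>2)) / ?G"
    unfolding pser_def
    by (rule suminf_divide) (use entire_bcoef[OF assms] in \<open>auto simp: entire_coeffs_def\<close>)
  then show ?thesis unfolding bessel_J_def t by simp
qed

text \<open>
Passing from \<open>k\<close> to \<open>k + 1\<close> divides the reciprocal Gamma function by \<open>k + 1 + \<alpha>\<close>, whose modulus is at least
\<open>1/2\<close> for \<open>k = 0\<close> and at least \<open>1\<close> afterwards. The bound permits differentiation of the Bessel series with respect to the order.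
\<close>

lemma rGamma_bounded_near_nat:
  "\<exists>M\<ge>0. \<forall>\<alpha>. norm (\<alpha>::complex) \<le> 1/2 \<longrightarrow> (\<forall>k. norm (rGamma (of_nat k + 1 + \<alpha>)) \<le> M)"
proof -
  have "compact ((\<lambda>\<alpha>::complex. rGamma (1 + \<alpha>)) ` cball 0 (1/2))"
    by (intro compact_continuous_image
        continuous_on_compose2[OF holomorphic_on_imp_continuous_on[OF holomorphic_rGamma[of UNIV]]] continuous_intros) auto
  then obtain B where B: "\<And>\<alpha>::complex. \<alpha> \<in> cball 0 (1/2) \<Longrightarrow> norm (rGamma (1 + \<alpha>)) \<le> B"
    by (meson compact_imp_bounded bounded_iff imageI)
  have B0: "0 \<le> B" using order_trans[OF norm_ge_zero B[of 0]] by simp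
  show ?thesis
  proof (intro exI[of _ "2 * B"] conjI allI impI)
    fix \<alpha> :: complex and k assume a: "norm \<alpha> \<le> 1/2"
    have low: "real k + 1/2 \<le> norm (of_nat k + 1 + \<alpha>)" for k
    proof -
      have "real k + 1 = norm (of_nat (Suc k) :: complex)" by (simp only: norm_of_nat)
      also have "\<dots> \<le> norm (of_nat (Suc k) + \<alpha>) + norm \<alpha>"
        using norm_triangle_ineq4[of "of_nat (Suc k) + \<alpha>" \<alpha>] by (simp del: of_nat_Suc)
      finally show ?thesis using a by (simp add: add.commute)
    qed
    have step: "norm (rGamma (of_nat (Suc k) + 1 + \<alpha>)) * norm (of_nat k + 1 + \<alpha>) = norm (rGamma (of_nat k + 1 + \<alpha>))" for k
      using arg_cong[OF rGamma_plus1[of "of_nat k + 1 + \<alpha>"], of norm] by (simp add: norm_mult ac_simps)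
    have 1: "norm (rGamma (of_nat (Suc k) + 1 + \<alpha>)) \<le> 2 * B" for k
    proof (induction k)
      case 0
      have "norm (rGamma (of_nat (Suc 0) + 1 + \<alpha>)) * (1/2) \<le> norm (rGamma (of_nat (Suc 0) + 1 + \<alpha>)) * norm (of_nat 0 + 1 + \<alpha>)"
        by (rule mult_left_mono) (use low[of 0] in auto)
      also have "\<dots> \<le> B" unfolding step using B[of \<alpha>] a by simp
      finally show ?case by simp
    next
      case (Suc k)
      have "norm (rGamma (of_nat (Suc (Suc k)) + 1 + \<alpha>)) * 1 \<le> norm (rGamma (of_nat (Suc (Suc k)) + 1 + \<alpha>)) * norm (of_nat (Suc k) + 1 + \<alpha>)"
        by (rule mult_left_mono) (use low[of "Suc k"] in auto)
      also have "\<dots> \<le> 2 * B" unfolding step using Suc .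
      finally show ?case by simp
    qed
    show "norm (rGamma (of_nat k + 1 + \<alpha>)) \<le> 2 * B"
    proof (cases k)
      case 0
      then show ?thesis using B[of \<alpha>] a B0 by simp
    next
      case (Suc m)
      then show ?thesis using 1[of m] by simp
    qed
  qed (use B0 in auto)
qed

text \<open>
The power series of the Bessel function as a function of its complex order.
\<close>

definition jser :: "complex \<Rightarrow> complex \<Rightarrow> complex" where
  "jser q \<alpha> = (\<Sum>k. (-1) ^ k * rGamma (of_nat k + 1 + \<alpha>) / fact k * q ^ k)"

text \<open>
The partial sums are holomorphic in the order and converge uniformly near \<open>0\<close>, so that the series may be
differentiated termwise; the derivative of the reciprocal Gamma function at \<open>k + 1\<close> produces the harmonic numbers.
\<close>

lemma jser_deriv_0:
  "(jser q has_field_derivative (\<Sum>k. (euler_mascheroni - harm k) * ((-1) ^ k / (fact k)\<^sup>2 * q ^ k))) (at 0)"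
proof -
  let ?t = "\<lambda>k \<alpha>. (-1) ^ k * rGamma (of_nat k + 1 + \<alpha>) / fact k * q ^ k"
  let ?t' = "\<lambda>k \<alpha>. (-1) ^ k * deriv rGamma (of_nat k + 1 + \<alpha>) / fact k * q ^ k"
  let ?S = "ball (0::complex) (1/2)"
  from rGamma_bounded_near_nat obtain M
    where M0: "M \<ge> 0 \<and> (\<forall>\<alpha>. norm (\<alpha>::complex) \<le> 1/2 \<longrightarrow> (\<forall>k. norm (rGamma (of_nat k + 1 + \<alpha>)) \<le> M))" ..
  have M2: "norm (rGamma (of_nat k + 1 + \<alpha>)) \<le> M" if "norm \<alpha> \<le> 1/2" for \<alpha> :: complex and k
    by (rule M0[THEN conjunct2, rule_format, OF that])
  have ul: "uniform_limit ?S (\<lambda>n \<alpha>. \<Sum>k<n. ?t k \<alpha>) (jser q) sequentially"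
    unfolding jser_def[abs_def]
  proof (rule Weierstrass_m_test)
    show "norm (?t k \<alpha>) \<le> M * (inverse (fact k) * norm q ^ k)" if "\<alpha> \<in> ?S" for k \<alpha>
    proof -
      have "norm (?t k \<alpha>) = norm (rGamma (of_nat k + 1 + \<alpha>)) * (inverse (fact k) * norm q ^ k)"
        by (simp add: norm_mult norm_power divide_inverse norm_inverse)
      also have "\<dots> \<le> M * (inverse (fact k) * norm q ^ k)"
        by (rule mult_right_mono[OF M2]) (use that in auto)
      finally show ?thesis .
    qed
    show "summable (\<lambda>k. M * (inverse (fact k) * norm q ^ k))"
      using summable_exp[of "norm q"] by (intro summable_mult) (simp add: ac_simps)
  qed
  have "\<exists>g'. \<forall>x\<in>?S. (jser q has_field_derivative g' x) (at x) \<and> (\<lambda>n. \<Sum>k<n. ?t' k x) \<longlonglongrightarrow> g' x"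
  proof (rule has_complex_derivative_uniform_sequence)
    show "open ?S" by simp
    show "((\<lambda>\<alpha>. \<Sum>k<n. ?t k \<alpha>) has_field_derivative (\<Sum>k<n. ?t' k x)) (at x)" for n x
    proof -
      have "((\<lambda>\<alpha>. rGamma (of_nat k + 1 + \<alpha>)) has_field_derivative deriv rGamma (of_nat k + 1 + x) * 1) (at x)" for k
      proof (rule DERIV_chain2[where f=rGamma])
        show "(rGamma has_field_derivative deriv rGamma (of_nat k + 1 + x)) (at (of_nat k + 1 + x))"
          unfolding DERIV_deriv_iff_field_differentiable
          by (rule holomorphic_on_imp_differentiable_at[OF holomorphic_rGamma, of UNIV]) auto
        show "((\<lambda>\<alpha>. of_nat k + 1 + \<alpha>) has_field_derivative 1) (at x)" by (auto intro!: derivative_eq_intros)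
      qed
      then show ?thesis
        by (intro DERIV_sum DERIV_cmult_right DERIV_cdivide DERIV_cmult) simp
    qed
    fix x :: complex assume x: "x \<in> ?S"
    have "open ?S" by simp
    with x obtain d where d: "d > 0" "cball x d \<subseteq> ?S" unfolding open_contains_cball by blast
    then show "\<exists>d>0. cball x d \<subseteq> ?S \<and> uniform_limit (cball x d) (\<lambda>n \<alpha>. \<Sum>k<n. ?t k \<alpha>) (jser q) sequentially"
      using uniform_limit_on_subset[OF ul] by blast
  qed
  then obtain h where h: "\<forall>x\<in>?S. (jser q has_field_derivative h x) (at x) \<and> (\<lambda>n. \<Sum>k<n. ?t' k x) \<longlonglongrightarrow> h x" ..
  define g' where "g' = h 0"
  have "0 \<in> ?S" by simp
  from bspec[OF h this] have g': "(jser q has_field_derivative g') (at 0)" "(\<lambda>n. \<Sum>k<n. ?t' k 0) \<longlonglongrightarrow> g'"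
    unfolding g'_def by (rule conjunct1, rule conjunct2)
  have t0: "?t' k 0 = (euler_mascheroni - harm k) * ((-1) ^ k / (fact k)\<^sup>2 * q ^ k)" for k
  proof -
    have n: "(of_nat k + 1 :: complex) = of_nat (Suc k)" by simp
    have "(of_nat (Suc k) :: complex) \<notin> \<int>\<^sub>\<le>\<^sub>0" by (simp add: of_nat_in_nonpos_Ints_iff del: of_nat_Suc)
    then have "(rGamma has_field_derivative - rGamma (of_nat (Suc k)) * Digamma (of_nat (Suc k))) (at (of_nat (Suc k) :: complex))"
      by (rule has_field_derivative_rGamma_no_nonpos_int)
    then have "deriv rGamma (of_nat (Suc k) :: complex) = - rGamma (of_nat (Suc k)) * Digamma (of_nat (Suc k))"
      by (rule DERIV_imp_deriv)
    also have "rGamma (of_nat (Suc k) :: complex) = inverse (fact k)"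
      using Gamma_fact[of k, where ?'a=complex] by (simp add: rGamma_inverse_Gamma add.commute)
    also have "Digamma (of_nat (Suc k) :: complex) = harm k - euler_mascheroni"
      by (rule Digamma_of_nat)
    finally have "deriv rGamma (of_nat k + 1 + 0 :: complex) = (euler_mascheroni - harm k) / fact k"
      unfolding n add_0_right by (simp add: field_simps)
    then show ?thesis by (simp add: power2_eq_square)
  qed
  have "(\<lambda>k. (euler_mascheroni - harm k) * ((-1) ^ k / (fact k)\<^sup>2 * q ^ k)) sums g'"
    using g'(2) unfolding sums_def t0 .
  then show ?thesis using g'(1) by (simp only: sums_iff)
qed

lemma bessel_J_jser:
  assumes "w \<noteq> 0"
  shows "bessel_J \<alpha> w = exp (of_real \<alpha> * Ln (w / 2)) * jser ((w / 2)\<^sup>2) (of_real \<alpha>)"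
proof -
  have "(\<Sum>k. (-1) ^ k * rGamma (of_real (real k + \<alpha> + 1)) / fact k * (w / 2) ^ (2 * k)) = jser ((w / 2)\<^sup>2) (of_real \<alpha>)"
    unfolding jser_def by (simp add: power_mult add.commute add.left_commute)
  moreover have "(if \<alpha> = 0 then 1 else (w / 2) powr of_real \<alpha>) = exp (of_real \<alpha> * Ln (w / 2))"
    using assms by (simp add: powr_def)
  ultimately show ?thesis unfolding bessel_J_def by simp
qed

text \<open>
The limit that defines \<open>Y\<^sub>0\<close> is a quotient of two functions of the order that vanish at \<open>0\<close>. Their derivatives there are
twice the derivative of \<open>J\<close> with respect to the order, and \<open>\<pi>\<close>.
\<close>

lemma bessel_Y_0:
  assumes w: "w \<noteq> 0"
  shows "bessel_Y 0 w = of_real (2 / pi) * (Ln (w / 2) * bessel_J 0 w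
     + (\<Sum>k. (euler_mascheroni - harm k) * ((-1) ^ k / (fact k)\<^sup>2 * ((w / 2)\<^sup>2) ^ k)))"
proof -
  define D where "D = (\<Sum>k. (euler_mascheroni - harm k) * ((-1) ^ k / (fact k)\<^sup>2 * ((w / 2)\<^sup>2) ^ k))"
  define j where "j \<alpha> = exp (\<alpha> * Ln (w / 2)) * jser ((w / 2)\<^sup>2) \<alpha>" for \<alpha>
  define J' where "J' = Ln (w / 2) * bessel_J 0 w + D"
  have jd: "(j has_field_derivative J') (at 0)"
  proof -
    have "((\<lambda>\<alpha>. exp (\<alpha> * Ln (w / 2))) has_field_derivative Ln (w / 2)) (at 0)"
      by (auto intro!: derivative_eq_intros)
    from DERIV_mult[OF this jser_deriv_0[of "(w / 2)\<^sup>2"]] show ?thesis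
      unfolding j_def[abs_def] J'_def D_def[symmetric] using bessel_J_jser[OF w, of 0] by (simp add: mult.commute)
  qed
  define N where "N \<alpha> = j \<alpha> * cos (\<alpha> * of_real pi) - j (- \<alpha>)" for \<alpha>
  have c: "((\<lambda>\<alpha>::complex. cos (\<alpha> * of_real pi)) has_field_derivative 0) (at 0)"
    by (auto intro!: derivative_eq_intros)
  have jm: "((\<lambda>\<alpha>. j (- \<alpha>)) has_field_derivative J' * (-1)) (at 0)"
    by (rule DERIV_chain2[where f=j]) (use jd in \<open>auto intro!: derivative_eq_intros\<close>)
  have "(N has_field_derivative 2 * J') (at 0)"
    using DERIV_diff[OF DERIV_mult[OF jd c] jm] unfolding N_def[abs_def] by simp
  then have N: "(\<lambda>h. N h / h) \<midarrow>0\<rightarrow> 2 * J'"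
    by (simp add: has_field_derivative_iff N_def)
  have "((\<lambda>\<alpha>::complex. sin (\<alpha> * of_real pi)) has_field_derivative of_real pi) (at 0)"
    by (auto intro!: derivative_eq_intros)
  then have S: "(\<lambda>h::complex. sin (h * of_real pi) / h) \<midarrow>0\<rightarrow> of_real pi"
    by (simp add: has_field_derivative_iff)
  have "(\<lambda>h. (N h / h) / (sin (h * of_real pi) / h)) \<midarrow>0\<rightarrow> 2 * J' / of_real pi"
    by (rule tendsto_divide[OF N S]) simp
  then have "(\<lambda>h. N h / sin (h * of_real pi)) \<midarrow>0\<rightarrow> 2 * J' / of_real pi"
  proof (rule Lim_transform_eventually)
    show "\<forall>\<^sub>F h in at 0. (N h / h) / (sin (h * of_real pi) / h) = N h / sin (h * of_real pi)"
      by (rule eventually_mono[OF eventually_neq_at_within[of 0]]) simp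
  qed
  moreover have "filterlim complex_of_real (at 0) (at 0)"
    unfolding filterlim_at using tendsto_of_real[OF tendsto_ident_at, of 0 UNIV]
    by (auto intro: eventually_mono[OF eventually_neq_at_within[of 0]])
  ultimately have "(\<lambda>h. N (of_real h) / sin (of_real h * of_real pi)) \<midarrow>0\<rightarrow> 2 * J' / of_real pi"
    by (rule filterlim_compose)
  moreover have "N (of_real h) / sin (of_real h * of_real pi) =
     (bessel_J h w * of_real (cos (h * pi)) - bessel_J (- h) w) / of_real (sin (h * pi))" for h
    unfolding N_def j_def bessel_J_jser[OF w] by (simp flip: sin_of_real cos_of_real)
  ultimately have "((\<lambda>h. (bessel_J h w * of_real (cos (h * pi)) - bessel_J (- h) w) / of_real (sin (h * pi))) \<longlongrightarrow> 2 * J' / of_real pi) (at 0)"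
    by simp
  from tendsto_Lim[OF _ this] show ?thesis
    unfolding bessel_Y_def Let_def J'_def D_def[symmetric] by (simp add: mult.commute)
qed

section \<open>Eigenspaces of the adjoint\<close>

lemma pser_lincomb:
  assumes "entire_coeffs a" "entire_coeffs c"
  shows "entire_coeffs (\<lambda>k. p * a k + q * c k)" "pser (\<lambda>k. p * a k + q * c k) y = p * pser a y + q * pser c y"
proof -
  have s: "(\<lambda>k. (p * a k + q * c k) * y ^ k) sums (p * pser a y + q * pser c y)" for y
  proof -
    have "(\<lambda>k. p * (a k * y ^ k) + q * (c k * y ^ k)) sums (p * pser a y + q * pser c y)"
      unfolding pser_def using assms by (intro sums_add sums_mult summable_sums) (auto simp: entire_coeffs_def)
    then show ?thesis by (simp add: algebra_simps)
  qed
  show "entire_coeffs (\<lambda>k. p * a k + q * c k)"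
    unfolding entire_coeffs_def using s sums_summable by blast
  show "pser (\<lambda>k. p * a k + q * c k) y = p * pser a y + q * pser c y"
    unfolding pser_def[of "\<lambda>k. p * a k + q * c k"] using s by (simp add: sums_iff)
qed

lemma entire_zero: "entire_coeffs (\<lambda>k. 0)" and pser_zero: "pser (\<lambda>k. 0) y = 0"
  by (simp_all add: entire_coeffs_def pser_def)

text \<open>
With \<open>L\<close> the logarithm of \<open>z\<close> of argument in \<open>[0, 2 \<pi>)\<close>, the cut square root is \<open>exp (L / 2)\<close>, with argument in \<open>[0, \<pi>)\<close>.
There it is compatible with the principal logarithm, which is why the two conventions for branches agree.
\<close>

lemma cut_exponent:
  assumes "z \<noteq> 0"
  defines "L \<equiv> of_real (ln (norm z)) + \<i> * of_real (Arg2pi z)"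
  shows "exp L = z" "(cut_sqrt z)\<^sup>2 = z" "cut_sqrt z \<noteq> 0" "Ln (cut_sqrt z / 2) = L / 2 - of_real (ln 2)"
    "0 < c \<Longrightarrow> Ln (of_real c * cut_sqrt z / 2) = L / 2 + of_real (ln c) - of_real (ln 2)"
    "cut_power z \<nu> = exp (of_real \<nu> * L)"
proof -
  show e: "exp L = z"
    unfolding L_def exp_add using assms(1) Arg2pi_eq[of z] by (simp add: exp_of_real)
  have cs: "cut_sqrt z = exp (L / 2)" by (simp add: cut_sqrt_def cut_power_def L_def)
  show "(cut_sqrt z)\<^sup>2 = z"
    unfolding cs by (simp add: exp_double[symmetric] e)
  show "cut_sqrt z \<noteq> 0" unfolding cs by simp
  have im: "Im L = Arg2pi z" by (simp add: L_def)
  have *: "Ln (of_real c * cut_sqrt z / 2) = L / 2 + of_real (ln c) - of_real (ln 2)" if "0 < c" for c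
  proof -
    have "of_real c * cut_sqrt z / 2 = exp (L / 2 + of_real (ln c) - of_real (ln 2))"
      unfolding cs exp_diff exp_add using that by (simp add: exp_of_real)
    moreover have "Ln (exp (L / 2 + of_real (ln c) - of_real (ln 2))) = L / 2 + of_real (ln c) - of_real (ln 2)"
      by (rule Ln_exp) (use im Arg2pi[of z] pi_gt_zero in auto)
    ultimately show ?thesis by simp
  qed
  show "0 < c \<Longrightarrow> Ln (of_real c * cut_sqrt z / 2) = L / 2 + of_real (ln c) - of_real (ln 2)" by (rule *)
  show "Ln (cut_sqrt z / 2) = L / 2 - of_real (ln 2)" using *[of 1] by simp
  show "cut_power z \<nu> = exp (of_real \<nu> * L)" by (simp add: cut_power_def L_def)
qed

context bessel_setting
begin

lemma Amax_add:
  assumes "(F, F') \<in> Amax" "(G, G') \<in> Amax"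
  shows "(vadd X F G, vadd X F' G') \<in> Amax"
proof -
  obtain k c where k: "sq_integrable b k" "F = L2_class b (adj_fun k c)" "F' = L2_class b k"
    using assms(1) unfolding adjoint_bessel_eq by blast
  obtain l d where l: "sq_integrable b l" "G = L2_class b (adj_fun l d)" "G' = L2_class b l"
    using assms(2) unfolding adjoint_bessel_eq by blast
  show ?thesis
    unfolding k(2,3) l(2,3) vadd_adj_fun[OF k(1) l(1)] vadd_L2[OF k(1) l(1)] adjoint_bessel_eq
    using sq_integrable_add[OF k(1) l(1)] by blast
qed

lemma Amax_scale:
  assumes "(F, F') \<in> Amax"
  shows "(vscale X d F, vscale X d F') \<in> Amax"
proof -
  obtain k c where k: "sq_integrable b k" "F = L2_class b (adj_fun k c)" "F' = L2_class b k"
    using assms(1) unfolding adjoint_bessel_eq by blast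
  show ?thesis
    unfolding k(2,3) vscale_adj_fun[OF k(1)] vscale_L2[OF k(1)] adjoint_bessel_eq
    using sq_integrable_scale[OF k(1)] by blast
qed

lemma Amax_carrier: "(F, F') \<in> Amax \<Longrightarrow> F \<in> vcarrier X \<and> F' \<in> vcarrier X"
  by (auto simp: adjoint_op_def)

lemma Gamma_add:
  assumes "F \<in> Domain Amax" "G \<in> Domain Amax"
  shows "\<Gamma>0 (vadd X F G) = \<Gamma>0 F + \<Gamma>0 G" "\<Gamma>1 (vadd X F G) = \<Gamma>1 F + \<Gamma>1 G"
  using linear_Gamma assms by (auto simp: linear_on_domain_def complex_space_def)

lemma Gamma_scale:
  assumes "F \<in> Domain Amax"
  shows "\<Gamma>0 (vscale X c F) = c * \<Gamma>0 F" "\<Gamma>1 (vscale X c F) = c * \<Gamma>1 F"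
  using linear_Gamma assms by (auto simp: linear_on_domain_def complex_space_def)

lemma green_identity:
  assumes "(F, F') \<in> Amax" "(G, G') \<in> Amax"
  shows "vinner X F' G - vinner X F G' = \<Gamma>1 F * cnj (\<Gamma>0 G) - \<Gamma>0 F * cnj (\<Gamma>1 G)"
proof -
  obtain k c where k: "sq_integrable b k" "F = L2_class b (adj_fun k c)" "F' = L2_class b k"
    using assms(1) unfolding adjoint_bessel_eq by blast
  obtain l d where l: "sq_integrable b l" "G = L2_class b (adj_fun l d)" "G' = L2_class b l"
    using assms(2) unfolding adjoint_bessel_eq by blast
  show ?thesis
    unfolding k(2,3) l(2,3) vinner_L2[OF k(1) sq_adj_fun[OF l(1)]] vinner_L2[OF sq_adj_fun[OF k(1)] l(1)]
      Gamma0_eq[OF k(1)] Gamma1_eq[OF k(1)] Gamma0_eq[OF l(1)] Gamma1_eq[OF l(1)]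
    by (rule green_adj[OF k(1) l(1)])
qed

abbreviation "eig z \<equiv> eigenspace X Amax z"

lemma eig_Domain: "F \<in> eig z \<Longrightarrow> F \<in> Domain Amax" "F \<in> eig z \<Longrightarrow> F \<in> vcarrier X"
  unfolding eigenspace_def using Amax_carrier by blast+

lemma eig_scale: "F \<in> eig z \<Longrightarrow> vscale X c F \<in> eig z"
proof -
  assume F: "F \<in> eig z"
  obtain f where f: "sq_integrable b f" "F = L2_class b f" using eig_Domain(2)[OF F] by (rule L2_carrierE)
  have "vscale X c (vscale X z F) = vscale X z (vscale X c F)"
    by (simp add: f vscale_L2 sq_integrable_scale mult.left_commute)
  then show ?thesis using F Amax_scale[of F "vscale X z F" c] by (simp add: eigenspace_def)
qed

lemma eig_add: "F \<in> eig z \<Longrightarrow> G \<in> eig z \<Longrightarrow> vadd X F G \<in> eig z"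
proof -
  assume F: "F \<in> eig z" and G: "G \<in> eig z"
  obtain f where f: "sq_integrable b f" "F = L2_class b f" using eig_Domain(2)[OF F] by (rule L2_carrierE)
  obtain g where g: "sq_integrable b g" "G = L2_class b g" using eig_Domain(2)[OF G] by (rule L2_carrierE)
  have "vadd X (vscale X z F) (vscale X z G) = vscale X z (vadd X F G)"
    by (simp add: f g vscale_L2 vadd_L2 sq_integrable_scale sq_integrable_add distrib_left)
  then show ?thesis using F G Amax_add[of F "vscale X z F" G "vscale X z G"] by (simp add: eigenspace_def)
qed

lemma zero_Amax: "(vzero X, vzero X) \<in> Amax"
proof -
  have "(\<lambda>x. 0) = adj_fun (\<lambda>x. 0) 0"
    by (simp add: fun_eq_iff adj_fun_def Volb_def upper_def)
  then have "L2_class b (\<lambda>x. 0) = L2_class b (adj_fun (\<lambda>x. 0) 0)" by (rule arg_cong)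
  then show ?thesis unfolding adjoint_bessel_eq vzero_L2 using sq_integrable_zero by blast
qed

lemma vscale_zero: "vscale X z (vzero X) = vzero X"
  by (simp add: vzero_L2 vscale_L2 sq_integrable_zero)

lemma Gamma_zero: "\<Gamma>0 (vzero X) = 0" "\<Gamma>1 (vzero X) = 0"
proof -
  have "vzero X \<in> Domain Amax" using zero_Amax by blast
  from Gamma_scale[OF this, of 0] show "\<Gamma>0 (vzero X) = 0" "\<Gamma>1 (vzero X) = 0"
    by (simp_all add: vscale_zero)
qed

lemma zero_eig: "vzero X \<in> eig z"
  using zero_Amax by (simp add: eigenspace_def vscale_zero)

lemma diff_zero_imp_eq:
  assumes "F \<in> vcarrier X" "G \<in> vcarrier X" "vadd X F (vscale X (-c) G) = vzero X"
  shows "F = vscale X c G"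
proof -
  obtain f where f: "sq_integrable b f" "F = L2_class b f" using assms(1) by (rule L2_carrierE)
  obtain g where g: "sq_integrable b g" "G = L2_class b g" using assms(2) by (rule L2_carrierE)
  have "L2_class b (\<lambda>x. f x + (- c) * g x) = L2_class b (\<lambda>x. 0)"
    using assms(3) by (simp only: f g vscale_L2 vadd_L2 sq_integrable_scale vzero_L2)
  then have "AE x in leb b. f x + (- c) * g x = 0"
    by (rule L2_class_eq_iff[OF sq_integrable_add[OF f(1) sq_integrable_scale[OF g(1)]], THEN iffD1])
  then have "AE x in leb b. f x = c * g x" by eventually_elim simp
  then show ?thesis unfolding f g vscale_L2[OF g(1)] by (rule L2_class_cong)
qed

abbreviation "A0 \<equiv> triplet_extension X Amin complex_space \<Gamma>0"

lemma A0_iff: "(F, H) \<in> A0 \<longleftrightarrow> (F, H) \<in> Amax \<and> \<Gamma>0 F = 0"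
  by (auto simp: triplet_extension_def restrict_op_def complex_space_def)

text \<open>
The general argument for boundary triplets: the difference of two eigenvectors with the same \<open>\<Gamma>\<^sub>0\<close> is annihilated by
\<open>A\<^sub>0 - z\<close>, hence zero; an eigenvector with \<open>\<Gamma>\<^sub>0 = h\<close> is obtained from any \<open>f\<close> with \<open>\<Gamma>\<^sub>0 f = h\<close> by
subtracting the image of \<open>(A\<^sup>* - z) f\<close> under the resolvent of \<open>A\<^sub>0\<close>.
\<close>

lemma Gamma0_bij_eig:
  assumes z: "z \<in> resolvent_set X A0"
  shows "bij_betw \<Gamma>0 (eig z) UNIV"
proof -
  have ex1: "\<exists>!f. (f, vadd X g (vscale X z f)) \<in> A0" if "g \<in> vcarrier X" for g
    using z that unfolding resolvent_set_def by blast
  have "inj_on \<Gamma>0 (eig z)"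
  proof (rule inj_onI)
    fix F G assume F: "F \<in> eig z" and G: "G \<in> eig z" and eq: "\<Gamma>0 F = \<Gamma>0 G"
    let ?D = "vadd X F (vscale X (-1) G)"
    have D: "?D \<in> eig z" by (intro eig_add eig_scale F G)
    have "\<Gamma>0 ?D = 0"
      using eq eig_Domain(1)[OF F] eig_Domain(1)[OF G] eig_Domain(1)[OF eig_scale[OF G, of "-1"]]
      by (simp add: Gamma_add Gamma_scale)
    moreover have "vadd X (vzero X) (vscale X z ?D) = vscale X z ?D"
    proof -
      obtain f where f: "sq_integrable b f" "?D = L2_class b f" using eig_Domain(2)[OF D] by (rule L2_carrierE)
      show ?thesis unfolding f(2) vzero_L2 by (simp add: f(1) vscale_L2 vadd_L2 sq_integrable_zero sq_integrable_scale)
    qed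
    ultimately have 1: "(?D, vadd X (vzero X) (vscale X z ?D)) \<in> A0"
      using D by (simp add: A0_iff eigenspace_def)
    have "vadd X (vzero X) (vscale X z (vzero X)) = vzero X"
      unfolding vscale_zero by (simp add: vzero_L2 vadd_L2 sq_integrable_zero)
    then have 2: "(vzero X, vadd X (vzero X) (vscale X z (vzero X))) \<in> A0"
      using zero_Amax Gamma_zero by (simp add: A0_iff)
    have "vzero X \<in> vcarrier X" by (simp add: vzero_L2 sq_integrable_zero)
    from ex1[OF this] have "?D = vzero X" using 1 2 by blast
    then have "F = vscale X 1 G"
      using diff_zero_imp_eq[of F G 1] eig_Domain(2)[OF F] eig_Domain(2)[OF G] by simp
    moreover have "vscale X 1 G = G" using hilbert_space.scale_one[OF hilbert_space_L2 eig_Domain(2)[OF G]] .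
    ultimately show "F = G" by simp
  qed
  moreover have "\<Gamma>0 ` eig z = UNIV"
  proof (intro subset_antisym subsetI UNIV_I)
    fix h :: complex
    obtain F F' where F: "(F, F') \<in> Amax" "\<Gamma>0 F = h" using Gamma_surjective[of h 0] by auto
    obtain f where f: "sq_integrable b f" "F = L2_class b f" using Amax_carrier[OF F(1)] by (auto elim: L2_carrierE)
    obtain f' where f': "sq_integrable b f'" "F' = L2_class b f'" using Amax_carrier[OF F(1)] by (auto elim: L2_carrierE)
    let ?g = "vadd X F' (vscale X (-z) F)"
    let ?gf = "\<lambda>x. f' x + (- z) * f x"
    have g: "?g = L2_class b ?gf" "sq_integrable b ?gf"
      unfolding f(2) f'(2) vscale_L2[OF f(1)] vadd_L2[OF f'(1) sq_integrable_scale[OF f(1)]]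
      by (rule refl, intro sq_integrable_add sq_integrable_scale f f')
    have "?g \<in> vcarrier X" unfolding g(1) by (rule L2_class_in_carrier[OF g(2)])
    then obtain P where P: "(P, vadd X ?g (vscale X z P)) \<in> A0" using ex1 by blast
    then have P': "(P, vadd X ?g (vscale X z P)) \<in> Amax" "\<Gamma>0 P = 0" by (auto simp: A0_iff)
    obtain p where p: "sq_integrable b p" "P = L2_class b p" using Amax_carrier[OF P'(1)] by (auto elim: L2_carrierE)
    let ?D = "vadd X F (vscale X (-1) P)"
    have "(?D, vadd X F' (vscale X (-1) (vadd X ?g (vscale X z P)))) \<in> Amax"
      by (rule Amax_add[OF F(1) Amax_scale[OF P'(1)]])
    moreover have "vadd X F' (vscale X (-1) (vadd X ?g (vscale X z P))) = vscale X z ?D"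
    proof -
      note sp = sq_integrable_scale[OF p(1), of z]
      note ss = sq_integrable_add[OF g(2) sp]
      have D: "?D = L2_class b (\<lambda>x. f x + (-1) * p x)" "sq_integrable b (\<lambda>x. f x + (-1) * p x)"
        unfolding f(2) p(2) vscale_L2[OF p(1)] vadd_L2[OF f(1) sq_integrable_scale[OF p(1)]]
        by (rule refl, intro sq_integrable_add sq_integrable_scale f p)
      show ?thesis
        unfolding D(1) vscale_L2[OF D(2)] g(1)
        unfolding f'(2) p(2) vscale_L2[OF p(1)] vadd_L2[OF g(2) sp] vscale_L2[OF ss]
          vadd_L2[OF f'(1) sq_integrable_scale[OF ss]]
        by (rule L2_class_cong_Ioo) (simp add: algebra_simps)
    qed
    ultimately have D: "?D \<in> eig z" by (simp add: eigenspace_def)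
    have "F \<in> Domain Amax" "P \<in> Domain Amax" "vscale X (-1) P \<in> Domain Amax"
      using F(1) P'(1) Amax_scale[OF P'(1), of "-1"] by blast+
    then have "\<Gamma>0 ?D = h" using F(2) P'(2) by (simp add: Gamma_add Gamma_scale)
    then show "h \<in> \<Gamma>0 ` eig z" using D by blast
  qed
  ultimately show ?thesis by (simp add: bij_betw_def)
qed

section \<open>The boundary triplet and its Weyl function\<close>

definition acoef2 :: "complex \<Rightarrow> nat \<Rightarrow> complex" where
  "acoef2 z = (if \<nu> = 0 then lcoef z else (\<lambda>k. 0))"

definition ccoef2 :: "complex \<Rightarrow> nat \<Rightarrow> complex" where
  "ccoef2 z = (if \<nu> = 0 then bcoef 0 z else bcoef (-\<nu>) z)"

text \<open>
The values at \<open>b\<close> of the solutions \<open>S\<^sub>1\<close> and \<open>S\<^sub>2\<close> of \<open>\<tau> f = z f\<close> that behave like \<open>u\<close> and \<open>v\<close> at \<open>0\<close>.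
\<close>

definition reg_b :: "complex \<Rightarrow> complex" where
  "reg_b z = frob_fun (bcoef \<nu> z) (\<lambda>k. 0) b"

definition sec_b :: "complex \<Rightarrow> complex" where
  "sec_b z = frob_fun (acoef2 z) (ccoef2 z) b"

lemma frob_pair_1: "frob_pair z (bcoef \<nu> z) (\<lambda>k. 0)"
  unfolding frob_pair_def using nu_nonneg
  by (simp add: entire_bcoef entire_zero bcoef_rec del: of_nat_Suc of_real_add)

lemma frob_pair_2: "frob_pair z (acoef2 z) (ccoef2 z)"
proof (cases "\<nu> = 0")
  case True
  have 1: "of_nat (Suc k) * (of_nat k + of_real (1 - \<nu>)) * bcoef 0 z (Suc k) + z / 4 * bcoef 0 z k = 0" for k
    using bcoef_rec[of k 0 z] True by simp
  have 2: "of_nat (Suc k) * (of_nat k + of_real (1 + \<nu>)) * lcoef z (Suc k) + 1 * (of_nat (Suc k) * bcoef 0 z (Suc k)) + z / 4 * lcoef z k = 0" for k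
    using lcoef_rec[of k z] True by simp
  have e: "acoef2 z = lcoef z" "ccoef2 z = bcoef 0 z" "logflag = 1"
    using True unfolding acoef2_def ccoef2_def logflag_def by auto
  show ?thesis
    unfolding frob_pair_def e
    by (intro conjI allI 1 2 entire_lcoef entire_bcoef) simp
next
  case False
  have 1: "of_nat (Suc k) * (of_nat k + of_real (1 - \<nu>)) * bcoef (-\<nu>) z (Suc k) + z / 4 * bcoef (-\<nu>) z k = 0" for k
    using bcoef_rec[of k "-\<nu>" z] by simp
  have e: "acoef2 z = (\<lambda>k. 0)" "ccoef2 z = bcoef (-\<nu>) z" "logflag = 0"
    using False unfolding acoef2_def ccoef2_def logflag_def by auto
  show ?thesis
    unfolding frob_pair_def e
    by (intro conjI allI 1 entire_zero entire_bcoef) (use nu_less in auto)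
qed

lemma frob_pair_lincomb:
  assumes "frob_pair z a c" "frob_pair z a' c'"
  shows "frob_pair z (\<lambda>k. p * a k + q * a' k) (\<lambda>k. p * c k + q * c' k)"
    "frob_fun (\<lambda>k. p * a k + q * a' k) (\<lambda>k. p * c k + q * c' k) x = p * frob_fun a c x + q * frob_fun a' c' x"
proof -
  have en: "entire_coeffs a" "entire_coeffs c" "entire_coeffs a'" "entire_coeffs c'"
    using assms by (auto simp: frob_pair_def)
  show "frob_fun (\<lambda>k. p * a k + q * a' k) (\<lambda>k. p * c k + q * c' k) x = p * frob_fun a c x + q * frob_fun a' c' x"
    unfolding frob_fun_def pser_lincomb(2)[OF en(1,3)] pser_lincomb(2)[OF en(2,4)] by (simp add: algebra_simps)
  have 1: "of_nat (Suc k) * (of_nat k + of_real (1 + \<nu>)) * (p * a (Suc k) + q * a' (Suc k))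
     + logflag * (of_nat (Suc k) * (p * c (Suc k) + q * c' (Suc k))) + z / 4 * (p * a k + q * a' k) = 0" (is "?l = 0")
    and 2: "of_nat (Suc k) * (of_nat k + of_real (1 - \<nu>)) * (p * c (Suc k) + q * c' (Suc k)) + z / 4 * (p * c k + q * c' k) = 0" (is "?m = 0") for k
  proof -
    let ?r = "\<lambda>a c. of_nat (Suc k) * (of_nat k + of_real (1 + \<nu>)) * a (Suc k) + logflag * (of_nat (Suc k) * c (Suc k)) + z / 4 * a k"
    let ?s = "\<lambda>c. of_nat (Suc k) * (of_nat k + of_real (1 - \<nu>)) * c (Suc k) + z / 4 * c k"
    have r: "?r a c = 0" "?r a' c' = 0" "?s c = 0" "?s c' = 0" using assms unfolding frob_pair_def by blast+
    have "?l = p * ?r a c + q * ?r a' c'" "?m = p * ?s c + q * ?s c'" by (simp_all only: algebra_simps)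
    then show "?l = 0" "?m = 0" by (simp_all only: r) simp_all
  qed
  show "frob_pair z (\<lambda>k. p * a k + q * a' k) (\<lambda>k. p * c k + q * c' k)"
    unfolding frob_pair_def using pser_lincomb(1)[OF en(1,3)] pser_lincomb(1)[OF en(2,4)] 1 2 by blast
qed

lemma coef2_at_0: "acoef2 z 0 = 0" "ccoef2 z 0 = 1"
  using nu_less nu_nonneg by (auto simp: acoef2_def ccoef2_def lcoef_0 bcoef_0)

text \<open>
This is \<open>S\<^sub>2(b) S\<^sub>1 - S\<^sub>1(b) S\<^sub>2\<close>.
\<close>

lemma weyl_solution:
  obtains F where "F \<in> eig z" "\<Gamma>0 F = reg_b z" "\<Gamma>1 F = sec_b z"
proof -
  let ?a = "\<lambda>k. sec_b z * bcoef \<nu> z k + (- reg_b z) * acoef2 z k"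
  let ?c = "\<lambda>k. sec_b z * 0 + (- reg_b z) * ccoef2 z k"
  note l = frob_pair_lincomb[OF frob_pair_1[of z] frob_pair_2[of z], where p="sec_b z" and q="- reg_b z"]
  have "frob_fun ?a ?c b = 0" unfolding l(2) by (simp add: reg_b_def sec_b_def)
  note r = frob_fun_eigen[OF l(1) this]
  show ?thesis
  proof (rule that[OF r(1)])
    show "\<Gamma>0 (L2_class b (frob_fun ?a ?c)) = reg_b z" unfolding r(2) by (simp add: coef2_at_0)
    show "\<Gamma>1 (L2_class b (frob_fun ?a ?c)) = sec_b z" unfolding r(3) using nu_nonneg by (simp add: coef2_at_0 bcoef_0)
  qed
qed

text \<open>
If \<open>S\<^sub>1\<close> itself vanishes at \<open>b\<close>, it is an eigenfunction of \<open>A\<^sub>0\<close>.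
\<close>

lemma degenerate_solution:
  assumes "reg_b z = 0"
  obtains F where "F \<in> eig z" "\<Gamma>0 F = 0" "\<Gamma>1 F = 1"
  using frob_fun_eigen[OF frob_pair_1, of z] assms that nu_nonneg by (simp add: reg_b_def bcoef_0)

lemma eig_nonzero: "\<exists>F\<in>eig z. F \<noteq> vzero X"
proof (cases "reg_b z = 0")
  case True
  obtain F where F: "F \<in> eig z" "\<Gamma>0 F = 0" "\<Gamma>1 F = 1" by (rule degenerate_solution[OF True])
  have "F \<noteq> vzero X" using F(3) Gamma_zero(2) by auto
  then show ?thesis using F(1) by blast
next
  case False
  obtain F where F: "F \<in> eig z" "\<Gamma>0 F = reg_b z" "\<Gamma>1 F = sec_b z" by (rule weyl_solution)
  have "F \<noteq> vzero X" using F(2) Gamma_zero(1) False by auto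
  then show ?thesis using F(1) by blast
qed

text \<open>
Green's identity shows that \<open>A\<^sub>0\<close> has no nonreal eigenvalues.
\<close>

lemma eig_nonreal_Gamma0:
  assumes F: "F \<in> eig z" "\<Gamma>0 F = 0" and z: "Im z \<noteq> 0"
  shows "F = vzero X"
proof -
  obtain f where f: "sq_integrable b f" "F = L2_class b f" using eig_Domain(2)[OF F(1)] by (rule L2_carrierE)
  have "vinner X (vscale X z F) F - vinner X F (vscale X z F) = 0"
    using green_identity[of F "vscale X z F" F "vscale X z F"] F by (simp add: eigenspace_def)
  then have "(z - cnj z) * of_real (sqnorm b f) = 0"
    by (simp add: f vscale_L2 vinner_L2 sq_integrable_scale sqinner_scale sqinner_scale_right sqinner_self algebra_simps)
  moreover have "z - cnj z \<noteq> 0" using z by (simp add: complex_eq_iff)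
  ultimately have "sqnorm b f = 0" by simp
  then have "AE x in leb b. f x = 0" using sqnorm_eq_0[OF f(1)] by simp
  then show ?thesis unfolding f(2) vzero_L2 by (rule L2_class_cong)
qed

text \<open>
\<open>\<Gamma>\<^sub>0\<close> is injective on the eigenspace, which is therefore at most one-dimensional, and an explicit solution shows that it
is not trivial. Hence both deficiency indices are \<open>1\<close>.
\<close>

lemma deficiency_basis:
  assumes z: "Im z \<noteq> 0"
  shows "\<exists>e. orthonormal_basis X (eig z) {e}"
proof -
  interpret H: hilbert_space X by (rule hilbert_space_L2)
  obtain G where G: "G \<in> eig z" "G \<noteq> vzero X" using eig_nonzero by blast
  obtain g where g: "sq_integrable b g" "G = L2_class b g" using eig_Domain(2)[OF G(1)] by (rule L2_carrierE)
  have "sqnorm b g \<noteq> 0"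
    using G(2) H.inner_definite[OF eig_Domain(2)[OF G(1)]] sqinner_self[OF g(1)] by (auto simp: g vinner_L2)
  then have n: "sqnorm b g > 0" using sqnorm_nonneg[of b g] by simp
  define t where "t = complex_of_real (1 / sqrt (sqnorm b g))"
  have t: "t \<noteq> 0" using n by (simp add: t_def)
  define e where "e = vscale X t G"
  have e: "e \<in> eig z" unfolding e_def by (rule eig_scale[OF G(1)])
  have "vinner X e e = t * cnj t * of_real (sqnorm b g)"
    by (simp add: e_def g vscale_L2 vinner_L2 sq_integrable_scale sqinner_scale sqinner_scale_right sqinner_self)
  also have "\<dots> = of_real (1 / sqrt (sqnorm b g) * (1 / sqrt (sqnorm b g)) * sqnorm b g)"
    unfolding t_def by (simp only: complex_cnj_complex_of_real of_real_mult)
  also have "1 / sqrt (sqnorm b g) * (1 / sqrt (sqnorm b g)) * sqnorm b g = 1" using n by simp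
  finally have ee: "vinner X e e = 1" by simp
  have Ge: "\<Gamma>0 e \<noteq> 0"
  proof
    assume "\<Gamma>0 e = 0"
    then have "e = vzero X" by (rule eig_nonreal_Gamma0[OF e _ z])
    then have "vinner X e e = 0" by (simp add: vzero_L2 vinner_L2 sq_integrable_zero sqinner_def)
    then show False using ee by simp
  qed
  have "F = vzero X" if F: "F \<in> eig z" and o: "vinner X F e = 0" for F
  proof -
    define s where "s = \<Gamma>0 F / \<Gamma>0 e"
    let ?D = "vadd X F (vscale X (- s) e)"
    have "?D \<in> eig z" by (intro eig_add eig_scale F e)
    moreover have "\<Gamma>0 ?D = 0"
      using Ge eig_Domain(1)[OF F] eig_Domain(1)[OF e] eig_Domain(1)[OF eig_scale[OF e, of "- s"]]
      by (simp add: Gamma_add Gamma_scale s_def)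
    ultimately have "?D = vzero X" by (rule eig_nonreal_Gamma0[OF _ _ z])
    then have Fs: "F = vscale X s e" by (rule diff_zero_imp_eq[OF eig_Domain(2)[OF F] eig_Domain(2)[OF e]])
    then have "s = 0" using o ee H.inner_scale[OF eig_Domain(2)[OF e] eig_Domain(2)[OF e], of s] by simp
    moreover obtain k where k: "sq_integrable b k" "e = L2_class b k" using eig_Domain(2)[OF e] by (rule L2_carrierE)
    ultimately show ?thesis using Fs by (simp add: k vscale_L2 vzero_L2)
  qed
  then have "orthonormal_basis X (eig z) {e}"
    unfolding orthonormal_basis_def using e ee by auto
  then show ?thesis by blast
qed

lemma equal_deficiency: "equal_deficiency_indices X Amin"
proof -
  obtain e where e: "orthonormal_basis X (eig \<i>) {e}" using deficiency_basis[of \<i>] by auto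
  obtain f where f: "orthonormal_basis X (eig (- \<i>)) {f}" using deficiency_basis[of "- \<i>"] by auto
  have "{e} \<approx> {f}" unfolding eqpoll_def by (rule exI[of _ "\<lambda>_. f"]) (simp add: bij_betw_def)
  with e f show ?thesis unfolding equal_deficiency_indices_def by blast
qed

theorem boundary_triplet_bessel: "boundary_triplet X Amin complex_space \<Gamma>0 \<Gamma>1"
  unfolding boundary_triplet_def
proof (intro conjI)
  show "\<forall>(f, f')\<in>Amax. \<forall>(g, g')\<in>Amax. vinner X f' g - vinner X f g'
    = vinner complex_space (\<Gamma>1 f) (\<Gamma>0 g) - vinner complex_space (\<Gamma>0 f) (\<Gamma>1 g)"
    using green_identity by (auto simp: complex_space_def)
  show "\<forall>h0\<in>vcarrier complex_space. \<forall>h1\<in>vcarrier complex_space. \<exists>f\<in>Domain Amax. \<Gamma>0 f = h0 \<and> \<Gamma>1 f = h1"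
    using Gamma_surjective by blast
qed (fact hilbert_space_L2 linear_bessel densely_defined_bessel closed_bessel symmetric_bessel equal_deficiency
    hilbert_space_complex linear_Gamma)+

lemma reg_b_eq: "reg_b z = of_real (solu b) * pser (bcoef \<nu> z) (of_real (b\<^sup>2))"
  unfolding reg_b_def frob_fun_def by (simp add: pser_zero)

text \<open>
Only here do the branches matter. For \<open>\<nu> > 0\<close> the powers of \<open>b \<surd>z / 2\<close> in front of the two Bessel series combine with
\<open>z\<^sup>\<nu>\<close> to a real constant; for \<open>\<nu> = 0\<close> the logarithm in \<open>Y\<^sub>0\<close> cancels the logarithm of \<open>\<surd>z / 2\<close> up to \<open>ln b\<close>.
\<close>

lemma weyl_quotient:
  assumes z: "z \<noteq> 0" and v: "reg_b z \<noteq> 0"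
  shows "bessel_J \<nu> (of_real b * cut_sqrt z) \<noteq> 0" "sec_b z / reg_b z = bessel_weyl \<nu> b z"
proof -
  define L where "L = of_real (ln (norm z)) + \<i> * of_real (Arg2pi z)"
  note ce = cut_exponent[OF z, folded L_def]
  define s where "s = cut_sqrt z"
  have s: "s\<^sup>2 = z" "s \<noteq> 0" using ce by (auto simp: s_def)
  define w where "w = of_real b * s"
  have w0: "w \<noteq> 0" using s b_pos by (simp add: w_def)
  define P where "P = pser (bcoef \<nu> z) (of_real (b\<^sup>2))"
  have P: "P \<noteq> 0" using v by (auto simp: reg_b_eq P_def)
  have Lw: "Ln (w / 2) = L / 2 + of_real (ln b) - of_real (ln 2)"
    using ce(5)[OF b_pos] by (simp add: w_def s_def)
  have pw: "(w / 2) powr of_real \<mu> = exp (of_real \<mu> * (L / 2 + of_real (ln b) - of_real (ln 2)))" for \<mu>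
    using w0 Lw by (simp add: powr_def)
  have G: "Gamma (1 + \<mu>) > 0" if "\<mu> > -1" for \<mu> :: real using that by (intro Gamma_real_pos) simp
  have Jnu: "bessel_J \<nu> w = (if \<nu> = 0 then 1 else (w / 2) powr of_real \<nu>) * P / of_real (Gamma (1 + \<nu>))"
    using bessel_J_pser[of \<nu> b s] nu_nonneg by (simp add: s w_def P_def)
  show J: "bessel_J \<nu> (of_real b * cut_sqrt z) \<noteq> 0"
  proof -
    have "Gamma (1 + \<nu>) > 0" by (rule G) (use nu_nonneg in auto)
    then show ?thesis using P w0 unfolding Jnu[unfolded w_def s_def] by (auto simp: w_def s_def)
  qed
  show "sec_b z / reg_b z = bessel_weyl \<nu> b z"
  proof (cases "\<nu> = 0")
    case False
    then have nu: "\<nu> > 0" using nu_nonneg by simp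
    define Q where "Q = pser (bcoef (-\<nu>) z) (of_real (b\<^sup>2))"
    have Jm: "bessel_J (-\<nu>) w = (w / 2) powr of_real (-\<nu>) * Q / of_real (Gamma (1 - \<nu>))"
      using bessel_J_pser[of "-\<nu>" b s] nu_less False by (simp add: s w_def Q_def)
    have v2: "sec_b z = of_real (solv b) * Q"
      using False unfolding sec_b_def frob_fun_def acoef2_def ccoef2_def by (simp add: pser_zero Q_def)
    have sb: "solv b / solu b = - (b powr (- 2 * \<nu>) / (2 * \<nu>))"
    proof -
      have "b powr (1/2 - \<nu>) / b powr (1/2 + \<nu>) = b powr (- 2 * \<nu>)" by (simp add: powr_diff[symmetric])
      then show ?thesis using False unfolding solv_def solu_def by (simp add: field_simps)
    qed
    have "sec_b z / reg_b z = of_real (solv b / solu b) * (Q / P)"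
      unfolding v2 reg_b_eq P_def[symmetric] by simp
    also have "\<dots> = - of_real (b powr (- 2 * \<nu>) / (2 * \<nu>)) * (Q / P)" unfolding sb by simp
    finally have lhs: "sec_b z / reg_b z = - of_real (b powr (- 2 * \<nu>) / (2 * \<nu>)) * (Q / P)" .
    have "bessel_J (-\<nu>) w / bessel_J \<nu> w * cut_power z \<nu> =
      ((w / 2) powr of_real (-\<nu>) / (w / 2) powr of_real \<nu> * cut_power z \<nu>) * (of_real (Gamma (1 + \<nu>)) / of_real (Gamma (1 - \<nu>))) * (Q / P)"
      unfolding Jnu Jm using False by (simp add: ac_simps)
    also have "(w / 2) powr of_real (-\<nu>) / (w / 2) powr of_real \<nu> * cut_power z \<nu> = of_real (b powr (- 2 * \<nu>) * 4 powr \<nu>)"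
    proof -
      have "(w / 2) powr of_real (-\<nu>) / (w / 2) powr of_real \<nu> * cut_power z \<nu> =
        exp (of_real (-\<nu>) * (L / 2 + of_real (ln b) - of_real (ln 2)) - of_real \<nu> * (L / 2 + of_real (ln b) - of_real (ln 2)) + of_real \<nu> * L)"
        unfolding pw ce(6) exp_diff exp_add ..
      also have "of_real (-\<nu>) * (L / 2 + of_real (ln b) - of_real (ln 2)) - of_real \<nu> * (L / 2 + of_real (ln b) - of_real (ln 2)) + of_real \<nu> * L
        = of_real (- 2 * \<nu> * ln b + \<nu> * (2 * ln 2))"
        by (simp add: algebra_simps)
      also have "exp \<dots> = of_real (exp (- 2 * \<nu> * ln b + \<nu> * (2 * ln 2)))" by (rule exp_of_real)
      also have "2 * ln 2 = ln (4::real)" using ln_realpow[of 2 2] by simp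
      also have "exp (- 2 * \<nu> * ln b + \<nu> * ln 4) = b powr (- 2 * \<nu>) * 4 powr \<nu>"
        using b_pos unfolding exp_add powr_def by simp
      finally show ?thesis .
    qed
    finally have rhs: "bessel_J (-\<nu>) w / bessel_J \<nu> w * cut_power z \<nu> =
      of_real (b powr (- 2 * \<nu>) * 4 powr \<nu>) * (of_real (Gamma (1 + \<nu>)) / of_real (Gamma (1 - \<nu>))) * (Q / P)" .
    have c: "Gamma (1 - \<nu>) / (2 * \<nu> * 4 powr \<nu> * Gamma (1 + \<nu>)) * (b powr (- 2 * \<nu>) * 4 powr \<nu> * (Gamma (1 + \<nu>) / Gamma (1 - \<nu>)))
      = b powr (- 2 * \<nu>) / (2 * \<nu>)"
    proof -
      have g: "Gamma (1 + \<nu>) > 0" "Gamma (1 + (-\<nu>)) > 0" by (rule G, use nu nu_less in simp)+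
      have "Gamma (1 + \<nu>) \<noteq> 0" by (rule less_imp_neq[OF g(1), symmetric])
      moreover have "Gamma (1 - \<nu>) \<noteq> 0" using less_imp_neq[OF g(2), symmetric] by simp
      ultimately show ?thesis using nu by (simp add: field_simps)
    qed
    have "bessel_weyl \<nu> b z = - of_real (Gamma (1 - \<nu>) / (2 * \<nu> * 4 powr \<nu> * Gamma (1 + \<nu>))) *
      (bessel_J (-\<nu>) w / bessel_J \<nu> w * cut_power z \<nu>)"
      using False unfolding bessel_weyl_def w_def s_def by (simp only: if_False mult.assoc)
    also have "\<dots> = - of_real (Gamma (1 - \<nu>) / (2 * \<nu> * 4 powr \<nu> * Gamma (1 + \<nu>)) * (b powr (- 2 * \<nu>) * 4 powr \<nu> * (Gamma (1 + \<nu>) / Gamma (1 - \<nu>)))) * (Q / P)"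
      unfolding rhs by (simp only: of_real_mult of_real_divide mult.assoc minus_mult_left)
    finally show ?thesis unfolding lhs c by simp
  next
    case True
    define R where "R = pser (lcoef z) (of_real (b\<^sup>2))"
    have J0: "bessel_J 0 w = P" using Jnu True by simp
    have P0: "P = pser (bcoef 0 z) (of_real (b\<^sup>2))" using True by (simp add: P_def)
    have us: "solu b = sqrt b" "solv b = sqrt b * ln b"
      using True b_pos unfolding solu_def solv_def by (simp_all add: powr_half_sqrt)
    have v1: "reg_b z = of_real (sqrt b) * P" unfolding reg_b_eq P_def us ..
    have v2: "sec_b z = of_real (sqrt b) * R + of_real (sqrt b * ln b) * P"
      using True unfolding sec_b_def frob_fun_def acoef2_def ccoef2_def us P0 R_def by simp
    have t: "bcoef 0 z k * of_real (b\<^sup>2) ^ k = (-1) ^ k / (fact k)\<^sup>2 * ((w / 2)\<^sup>2) ^ k" for k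
    proof -
      have r: "rGamma (complex_of_real (real k + 0 + 1)) = inverse (fact k)"
        using Gamma_fact[of k, where ?'a=complex] by (simp add: rGamma_inverse_Gamma add.commute)
      have q: "((w / 2)\<^sup>2) ^ k = (z / 4) ^ k * of_real (b\<^sup>2) ^ k"
        unfolding w_def by (simp add: power_divide power_mult_distrib s(1))
      have m: "(- z / 4) ^ k = (-1) ^ k * (z / 4) ^ k" by (simp add: power_mult_distrib[symmetric])
      have G1: "complex_of_real (Gamma (1 + 0)) = 1" by simp
      have gen: "1 * (inverse F / F * (u * y)) * B = u / F\<^sup>2 * (y * B)" for F u y B :: complex
        by (simp add: power2_eq_square divide_inverse)
      show ?thesis unfolding bcoef_def r q m G1 by (rule gen)
    qed
    have sums: "(\<lambda>k. (euler_mascheroni - harm k) * ((-1) ^ k / (fact k)\<^sup>2 * ((w / 2)\<^sup>2) ^ k)) sums (euler_mascheroni * P + R)"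
    proof -
      have "(\<lambda>k. euler_mascheroni * (bcoef 0 z k * of_real (b\<^sup>2) ^ k) + lcoef z k * of_real (b\<^sup>2) ^ k) sums (euler_mascheroni * P + R)"
        unfolding P0 R_def pser_def using entire_bcoef[of 0 z] entire_lcoef[of z]
        by (intro sums_add sums_mult summable_sums) (auto simp: entire_coeffs_def)
      moreover have "euler_mascheroni * (bcoef 0 z k * of_real (b\<^sup>2) ^ k) + lcoef z k * of_real (b\<^sup>2) ^ k =
         (euler_mascheroni - harm k) * (bcoef 0 z k * of_real (b\<^sup>2) ^ k)" for k
        by (simp add: lcoef_def algebra_simps)
      ultimately show ?thesis by (simp only: t)
    qed
    have Y: "bessel_Y 0 w = of_real (2 / pi) * (Ln (w / 2) * P + (euler_mascheroni * P + R))"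
      unfolding bessel_Y_0[OF w0] J0 using sums by (simp add: sums_iff)
    have "bessel_weyl \<nu> b z = - (L / 2 - of_real (ln 2)) + of_real (pi / 2) * (bessel_Y 0 w / P) - euler_mascheroni"
      using True unfolding bessel_weyl_def w_def[symmetric, unfolded s_def] by (simp add: ce(4) J0 w_def[symmetric, unfolded s_def])
    also have "of_real (pi / 2) * (bessel_Y 0 w / P) = Ln (w / 2) + euler_mascheroni + R / P"
    proof -
      have "of_real (pi / 2) * of_real (2 / pi) = (1::complex)" by (simp flip: of_real_mult)
      then have "of_real (pi / 2) * (bessel_Y 0 w / P) = (Ln (w / 2) * P + (euler_mascheroni * P + R)) / P"
        unfolding Y by (metis mult.assoc mult_1 times_divide_eq_right)
      then show ?thesis using P by (simp add: add_divide_distrib)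
    qed
    also have "- (L / 2 - of_real (ln 2)) + (Ln (w / 2) + euler_mascheroni + R / P) - euler_mascheroni = of_real (ln b) + R / P"
      unfolding Lw by simp
    finally have "bessel_weyl \<nu> b z = of_real (ln b) + R / P" .
    moreover have "sec_b z / reg_b z = of_real (ln b) + R / P"
    proof -
      have "complex_of_real (sqrt b) \<noteq> 0" using b_pos by simp
      then show ?thesis unfolding v1 v2 using P by (simp add: field_simps)
    qed
    ultimately show ?thesis by simp
  qed
qed

theorem weyl_bessel:
  assumes z: "z \<in> resolvent_set X A0" "z \<noteq> 0"
  shows "bessel_J \<nu> (of_real b * cut_sqrt z) \<noteq> 0"
    "weyl_function X Amin \<Gamma>0 \<Gamma>1 z h = bessel_weyl \<nu> b z * h"
proof -
  have bij: "inj_on \<Gamma>0 (eig z)" using Gamma0_bij_eig[OF z(1)] by (simp add: bij_betw_def)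
  have v: "reg_b z \<noteq> 0"
  proof
    assume v0: "reg_b z = 0"
    obtain F where F: "F \<in> eig z" "\<Gamma>0 F = 0" "\<Gamma>1 F = 1" by (rule degenerate_solution[OF v0])
    have "F = vzero X" by (rule inj_onD[OF bij _ F(1) zero_eig]) (simp add: F Gamma_zero)
    then show False using F(3) Gamma_zero by simp
  qed
  show "bessel_J \<nu> (of_real b * cut_sqrt z) \<noteq> 0" by (rule weyl_quotient(1)[OF z(2) v])
  obtain F where F: "F \<in> eig z" "\<Gamma>0 F = reg_b z" "\<Gamma>1 F = sec_b z" by (rule weyl_solution)
  let ?F = "vscale X (h / reg_b z) F"
  note FD = eig_Domain(1)[OF F(1)]
  have "inv_into (eig z) \<Gamma>0 h = ?F"
    by (rule inv_into_f_eq[OF bij eig_scale[OF F(1)]]) (use F v in \<open>simp add: Gamma_scale[OF FD]\<close>)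
  then show "weyl_function X Amin \<Gamma>0 \<Gamma>1 z h = bessel_weyl \<nu> b z * h"
    unfolding weyl_function_def weyl_quotient(2)[OF z(2) v, symmetric]
    by (simp add: Gamma_scale[OF FD] F)
qed

lemma representatives:
  assumes "F \<in> Domain Amax"
  shows "\<exists>f\<in>F. f differentiable_on {0<..<b}"
    "\<exists>l. (bracket (diff_rep b F) (u_plus \<nu>) \<longlongrightarrow> l) (at_right 0)"
    "\<exists>l. (bracket (diff_rep b F) (u_minus \<nu>) \<longlongrightarrow> l) (at_right 0)"
proof -
  obtain k c where k: "sq_integrable b k" "F = L2_class b (adj_fun k c)"
    using assms unfolding adjoint_bessel_eq by auto
  show "\<exists>f\<in>F. f differentiable_on {0<..<b}"
    using L2_class_self[OF sq_adj_fun[OF k(1)]] adj_fun_differentiable[OF k(1)] k(2) by blast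
  show "\<exists>l. (bracket (diff_rep b F) (u_plus \<nu>) \<longlongrightarrow> l) (at_right 0)"
    "\<exists>l. (bracket (diff_rep b F) (u_minus \<nu>) \<longlongrightarrow> l) (at_right 0)"
    unfolding k(2) using bracket_limits[OF k(1)] by blast+
qed

end

theorem proposition4p2:
  fixes \<nu> b :: real
  assumes "0 \<le> \<nu>" and "\<nu> < 1" and "0 < b"
  shows
    "(\<forall>F\<in>Domain (adjoint_op (L2_space b) (bessel_operator \<nu> b)).
        (\<exists>f\<in>F. f differentiable_on {0<..<b}) \<and>
        (\<exists>l. (bracket (diff_rep b F) (u_plus \<nu>) \<longlongrightarrow> l) (at_right 0)) \<and>
        (\<exists>l. (bracket (diff_rep b F) (u_minus \<nu>) \<longlongrightarrow> l) (at_right 0))) \<and>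
     boundary_triplet (L2_space b) (bessel_operator \<nu> b) complex_space
       (bessel_Gamma0 \<nu> b) (bessel_Gamma1 \<nu> b) \<and>
     (\<forall>z\<in>resolvent_set (L2_space b)
            (triplet_extension (L2_space b) (bessel_operator \<nu> b) complex_space (bessel_Gamma0 \<nu> b)).
        bij_betw (bessel_Gamma0 \<nu> b)
          (eigenspace (L2_space b) (adjoint_op (L2_space b) (bessel_operator \<nu> b)) z) UNIV \<and>
        (z \<noteq> 0 \<longrightarrow>
          bessel_J \<nu> (of_real b * cut_sqrt z) \<noteq> 0 \<and>
          (\<forall>h. weyl_function (L2_space b) (bessel_operator \<nu> b)
                 (bessel_Gamma0 \<nu> b) (bessel_Gamma1 \<nu> b) z h
               = bessel_weyl \<nu> b z * h)))"
proof -
  interpret bessel_setting \<nu> b by unfold_locales (use assms in auto)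
  show ?thesis
    using representatives boundary_triplet_bessel Gamma0_bij_eig weyl_bessel by blast
qed

end
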